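(* Let $\alpha$ be a composition of $n$ and let $Y_\alpha$ be any one of the eight quasisymmetric functions $$\mathcal{S}_\alpha,\quad \widehat{\mathcal{S}}_\alpha=\rho(\mathcal{S}_{\alpha^{\mathrm r}}),\quad \mathcal{R}\mathcal{S}_\alpha=\psi(\mathcal{S}_\alpha),\quad \mathcal{R}_\alpha=\rho\circ\psi(\mathcal{S}_{\alpha^{\mathrm r}}),\quad \mathfrak{S}^*_\alpha,\quad \mathcal{R}\mathfrak{S}^*_\alpha=\psi(\mathfrak{S}^*_\alpha),\quad \mathcal{E}_\alpha,\quad \mathcal{R}\mathcal{E}_\alpha=\psi(\mathcal{E}_\alpha).$$ Then $Y_\alpha$ is a sum of $P$-partition generating functions of posets on $[n]$: $$Y_\alpha=\sum_{V\in\mathsf{ind}(\mathbf{Y}_\alpha)}K_{P_V},$$ where the index family $\mathsf{ind}(\mathbf{Y}_\alpha)$ and the posets $P_V$ on $[n]$ attached to its members are those described in the context.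
   Context: **Compositions and quasisymmetric functions.** For $\alpha=(\alpha_1,\dots,\alpha_{\ell(\alpha)})\models n$, $\mathrm{set}(\alpha)=\{\alpha_1,\alpha_1+\alpha_2,\dots,\alpha_1+\cdots+\alpha_{\ell(\alpha)-1}\}\subseteq[n-1]$, and $\mathrm{comp}$ is the inverse bijection from subsets of $[n-1]$ to compositions of $n$. $\alpha^{\mathrm r}$ is the reversal and $\mathrm{set}(\alpha^{\mathrm c})=[n-1]\setminus\mathrm{set}(\alpha)$. $F_\alpha=\sum x_{i_1}\cdots x_{i_n}$ over $1\le i_1\le\cdots\le i_n$ with $i_j<i_{j+1}$ if $j\in\mathrm{set}(\alpha)$. $\rho(F_\alpha)=F_{\alpha^{\mathrm r}}$, $\psi(F_\alpha)=F_{\alpha^{\mathrm c}}$, extended linearly. For a poset $P$ on $[n]$, a $P$-partition is a map $f:[n]\to\{1,2,\dots\}$ such that $i\preceq_P j$ implies $f(i)\le f(j)$, and $i\preceq_P j$ with $i>j$ implies $f(i)<f(j)$; $K_P=\sum_f\prod_{i\in[n]}x_{f(i)}$ over all $P$-partitions. **Tableaux.** The composition diagram $\mathtt{cd}(\alpha)$ is the left-justified array whose $i$th row from the top has $\alpha_i$ boxes; $(i,j)$ is the box in row $i$ (from the top), column $j$. All fillings below are bijective with entries $1,\dots,n$. $\mathrm{SIT}(\alpha)$: rows increase left to right and the first column increases top to bottom. $\mathrm{SET}(\alpha)$: rows increase left to right and every column increases top to bottom. $\mathrm{SRCT}(\alpha)$: rows decrease left to right, the first column increases top to bottom, and if $i<j$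 and $\tau_{i,k}>\tau_{j,k+1}$ then $(i,k+1)\in\mathtt{cd}(\alpha)$ and $\tau_{i,k+1}>\tau_{j,k+1}$. For $T$ in $\mathrm{SIT}(\alpha)$ or $\mathrm{SET}(\alpha)$, $\mathrm{Des}(T)$ is the set of $i\in[n-1]$ with $i+1$ in a row strictly below $i$. For $\tau\in\mathrm{SRCT}(\alpha)$, $\mathrm{Des}(\tau)$ is the set of $i\in[n-1]$ with $i+1$ weakly right of $i$. The dual immaculate, extended Schur and quasisymmetric Schur functions are $$\mathfrak{S}^*_\alpha=\sum_{T\in\mathrm{SIT}(\alpha)}F_{\mathrm{comp}(\mathrm{Des}(T))},\quad \mathcal{E}_\alpha=\sum_{T\in\mathrm{SET}(\alpha)}F_{\mathrm{comp}(\mathrm{Des}(T))},\quad \mathcal{S}_\alpha=\sum_{\tau\in\mathrm{SRCT}(\alpha)}F_{\mathrm{comp}(\mathrm{Des}(\tau))}.$$ **Posets from intervals.** Permutations are written in one-line notation and composed as functions; $w_0$ is the longest element of $\mathfrak{S}_n$; $\preceq_L$ is the left weak Bruhat order (covers $\gamma\prec s_i\gamma$ when $\ell(s_i\gamma)>\ell(\gamma)$) and $[\sigma,\rho]_L$ its intervals. For a poset $P$ on $[n]$, $\Sigma_R(P)=\{\sigma\in\mathfrak{S}_n:\sigma^{-1}(i)<\sigma^{-1}(j)\text{ whenever }i\prec_P j\}$. For $\sigma\preceq_L\rho$ there is a unique poset $P$ on $[n]$ with $\Sigma_R(P)=\{w_0\gamma^{-1}:\gamma\in[\sigma,\rho]_L\}$;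 call it $P\langle\sigma,\rho\rangle$. Poset involutions: $u\preceq_{\overline{P}}v\iff n+1-u\preceq_P n+1-v$; $u\preceq_{P^*}v\iff v\preceq_P u$. **The families $\mathsf{ind}(\mathbf{Y}_\alpha)$ and $P_V$.** ($\mathbf{Y}_\alpha$ is a left $H_n(0)$-module with quasisymmetric characteristic $Y_\alpha$ and $\mathsf{ind}(\mathbf{Y}_\alpha)$ is the family of its indecomposable direct summands; only the posets matter here.) For a filling $T$, $\mathsf{read}(T)$ is the word reading entries right to left in each row, starting with the top row. * $Y_\alpha=\mathfrak{S}^*_\alpha$: one member $\mathcal{V}_\alpha$, $P_{\mathcal{V}_\alpha}=P\langle\mathsf{read}(\mathscr{T}_\alpha),\mathsf{read}(\mathscr{T}'_\alpha)\rangle$, where $\mathscr{T}_\alpha$ is filled with $1,\dots,n$ left to right, top to bottom, and $\mathscr{T}'_\alpha$ has first column $1,\dots,\ell(\alpha)$ from top to bottom and the remaining boxes filled with $\ell(\alpha)+1,\dots,n$ left to right in each row, from the bottom row to the top row. * $Y_\alpha=\mathcal{E}_\alpha$: one member $X_\alpha$, $P_{X_\alpha}=P\langle\mathsf{read}(\mathsf{T}_\alpha),\mathsf{read}(\mathsf{T}'_\alpha)\rangle$, where $\mathsf{T}_\alpha$ is filled with $1,\dots,n$ left to right, top to bottom, and $\mathsf{T}'_\alpha$ is filled with $1,\dots,n$ top to bottom in each column, from the leftmost column to the rightmost. * $Y_\alpha=\mathcal{S}_\alpha$: members $\mathbf{S}_{\alpha,E}$ indexed by $E\in\mathcal{E}(\alpha)$,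 where $\mathcal{E}(\alpha)$ is the set of classes of $\mathrm{SRCT}(\alpha)$ under: $\tau_1\sim\tau_2$ iff for every column the entries of $\tau_1$ and $\tau_2$ in that column, read top to bottom, are in the same relative order. Each $E$ contains a unique source tableau $\tau^{\rightarrow}_E$ (for every $i\notin\mathrm{Des}$, $i\ne n$, $i+1$ is immediately left of $i$) and a unique sink tableau $\tau^{\leftarrow}_E$ (for every $i\in\mathrm{Des}$, either $i,i+1$ are in the same column, or they are in adjacent columns with $i+1$ lower-right of $i$). Let $\mathrm{Des}(\tau^{\rightarrow}_E)=\{d_1<\cdots<d_m\}$, $d_0=0$, $d_{m+1}=n$, and let $\mathtt{H}_j$ be the set of boxes with entries $d_{j-1}+1,\dots,d_j$ in $\tau^{\rightarrow}_E$. For $\tau\in E$, $\underline{\mathsf{read}}(\tau)$ is the concatenation over $j=1,\dots,m+1$ of the words of entries of $\tau$ in $\mathtt{H}_j$ read left to right. Then $P_{\mathbf{S}_{\alpha,E}}=P\langle\underline{\mathsf{read}}(\tau^{\rightarrow}_E),\underline{\mathsf{read}}(\tau^{\leftarrow}_E)\rangle$. * $Y_\alpha=\mathcal{R}\mathfrak{S}^*_\alpha$: one member with poset $\overline{P_{\mathcal{V}_\alpha}}$. $Y_\alpha=\mathcal{R}\mathcal{E}_\alpha$: one member with poset $\overline{P_{X_\alpha}}$. * $Y_\alpha=\widehat{\mathcal{S}}_\alpha$: members indexed by $E\in\mathcal{E}(\alpha^{\mathrm r})$ with posets $(\overline{P_{\mathbf{S}_{\alpha^{\mathrm r},E}}})^*$.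 $Y_\alpha=\mathcal{R}\mathcal{S}_\alpha$: members indexed by $E\in\mathcal{E}(\alpha)$ with posets $\overline{P_{\mathbf{S}_{\alpha,E}}}$. $Y_\alpha=\mathcal{R}_\alpha$: members indexed by $E\in\mathcal{E}(\alpha^{\mathrm r})$ with posets $(P_{\mathbf{S}_{\alpha^{\mathrm r},E}})^*$. *)

theory Defs
  imports
    "HOL-Combinatorics.Permutations"
    "HOL-Library.FuncSet"
    "HOL-Library.Function_Algebras"
    "HOL-Library.Multiset"
    "HOL-Library.Poly_Mapping"
begin

section \<open>Compositions\<close>

definition composition :: "nat list \<Rightarrow> nat \<Rightarrow> bool" where
  "composition \<alpha> n \<longleftrightarrow> 0 \<notin> set \<alpha> \<and> sum_list \<alpha> = n"

definition comp_set :: "nat list \<Rightarrow> nat set" where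
  "comp_set \<alpha> = {sum_list (take k \<alpha>) | k. 1 \<le> k \<and> k < length \<alpha>}"

definition comp_of :: "nat \<Rightarrow> nat set \<Rightarrow> nat list" where
  "comp_of n = the_inv_into {\<alpha>. composition \<alpha> n} comp_set"

definition comp_compl :: "nat list \<Rightarrow> nat list" where
  "comp_compl \<alpha> = comp_of (sum_list \<alpha>) ({1..<sum_list \<alpha>} - comp_set \<alpha>)"


section \<open>Quasisymmetric functions\<close>

text \<open>A formal power series in $x_1, x_2, \dots$ over the integers is its coefficient function on
  monomials; the monomial $x_{i_1} \cdots x_{i_n}$ is the multiset of its indices. Sums of series
  are taken in the pointwise additive structure on functions.\<close>

type_synonym series = "nat multiset \<Rightarrow> int"

definition scale :: "int \<Rightarrow> series \<Rightarrow> series" where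
  "scale c f = (\<lambda>m. c * f m)"

text \<open>In lists, the entry with mathematical index $j \ge 1$ is at position $j - 1$.\<close>

definition fund :: "nat list \<Rightarrow> series" where
  "fund \<alpha> = (\<lambda>m. int (card {is. length is = sum_list \<alpha> \<and> (\<forall>i\<in>set is. 1 \<le> i) \<and> sorted is \<and>
     (\<forall>j\<in>comp_set \<alpha>. is ! (j - 1) < is ! j) \<and> mset is = m}))"

definition fund_coeffs :: "series \<Rightarrow> nat list \<Rightarrow>\<^sub>0 int" where
  "fund_coeffs f = (THE c. (\<forall>\<beta>\<in>Poly_Mapping.keys c. 0 \<notin> set \<beta>) \<and>
     f = (\<Sum>\<beta>\<in>Poly_Mapping.keys c. scale (Poly_Mapping.lookup c \<beta>) (fund \<beta>)))"

text \<open>The linear map on quasisymmetric functions sending each \<open>fund \<beta>\<close> to \<open>fund (\<phi> \<beta>)\<close>.\<close>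

definition fund_linear :: "(nat list \<Rightarrow> nat list) \<Rightarrow> series \<Rightarrow> series" where
  "fund_linear \<phi> f = (\<Sum>\<beta>\<in>Poly_Mapping.keys (fund_coeffs f).
     scale (Poly_Mapping.lookup (fund_coeffs f) \<beta>) (fund (\<phi> \<beta>)))"

definition qsym_rho :: "series \<Rightarrow> series" where
  "qsym_rho = fund_linear rev"

definition qsym_psi :: "series \<Rightarrow> series" where
  "qsym_psi = fund_linear comp_compl"


section \<open>Posets and their generating functions\<close>

text \<open>A poset on $[n]$ is a relation \<open>P\<close> with \<open>partial_order_on {1..n} P\<close>;
  \<open>(i, j) \<in> P\<close> means $i \preceq_P j$.\<close>

definition P_partitions :: "nat \<Rightarrow> nat rel \<Rightarrow> (nat \<Rightarrow> nat) set" where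
  "P_partitions n P = {f \<in> {1..n} \<rightarrow>\<^sub>E {1..}.
     \<forall>(i, j)\<in>P. f i \<le> f j \<and> (i > j \<longrightarrow> f i < f j)}"

definition K :: "nat \<Rightarrow> nat rel \<Rightarrow> series" where
  "K n P = (\<lambda>m. int (card {f \<in> P_partitions n P. image_mset f (mset_set {1..n}) = m}))"

definition poset_bar :: "nat \<Rightarrow> nat rel \<Rightarrow> nat rel" where
  "poset_bar n P = {(u, v). u \<in> {1..n} \<and> v \<in> {1..n} \<and> (n + 1 - u, n + 1 - v) \<in> P}"

definition poset_star :: "nat rel \<Rightarrow> nat rel" where
  "poset_star P = P\<inverse>"


section \<open>Intervals in left weak Bruhat order\<close>

definition simple_prod :: "nat list \<Rightarrow> nat \<Rightarrow> nat" where
  "simple_prod is = foldr (\<lambda>i p. transpose i (Suc i) \<circ> p) is id"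

definition perm_length :: "nat \<Rightarrow> (nat \<Rightarrow> nat) \<Rightarrow> nat" where
  "perm_length n \<gamma> = (LEAST k. \<exists>is. length is = k \<and> set is \<subseteq> {1..<n} \<and> \<gamma> = simple_prod is)"

definition longest_perm :: "nat \<Rightarrow> nat \<Rightarrow> nat" where
  "longest_perm n = (\<lambda>i. if i \<in> {1..n} then n + 1 - i else i)"

definition left_cover :: "nat \<Rightarrow> (nat \<Rightarrow> nat) rel" where
  "left_cover n = {(\<gamma>, \<delta>). \<gamma> permutes {1..n} \<and>
     (\<exists>i\<in>{1..<n}. \<delta> = transpose i (Suc i) \<circ> \<gamma> \<and> perm_length n \<delta> > perm_length n \<gamma>)}"

definition left_interval :: "nat \<Rightarrow> (nat \<Rightarrow> nat) \<Rightarrow> (nat \<Rightarrow> nat) \<Rightarrow> (nat \<Rightarrow> nat) set" where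
  "left_interval n \<sigma> \<rho> = {\<gamma>. \<gamma> permutes {1..n} \<and> (\<sigma>, \<gamma>) \<in> (left_cover n)\<^sup>* \<and> (\<gamma>, \<rho>) \<in> (left_cover n)\<^sup>*}"

definition Sigma_R :: "nat \<Rightarrow> nat rel \<Rightarrow> (nat \<Rightarrow> nat) set" where
  "Sigma_R n P = {\<sigma>. \<sigma> permutes {1..n} \<and> (\<forall>(i, j)\<in>P. i \<noteq> j \<longrightarrow> inv \<sigma> i < inv \<sigma> j)}"

definition interval_poset :: "nat \<Rightarrow> (nat \<Rightarrow> nat) \<Rightarrow> (nat \<Rightarrow> nat) \<Rightarrow> nat rel" where
  "interval_poset n \<sigma> \<rho> = (THE P. partial_order_on {1..n} P \<and>
     Sigma_R n P = {longest_perm n \<circ> inv \<gamma> | \<gamma>. \<gamma> \<in> left_interval n \<sigma> \<rho>})"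

definition perm_of_word :: "nat list \<Rightarrow> nat \<Rightarrow> nat" where
  "perm_of_word w = (\<lambda>i. if i \<in> {1..length w} then w ! (i - 1) else i)"

definition word_poset :: "nat list \<Rightarrow> nat list \<Rightarrow> nat rel" where
  "word_poset v w = interval_poset (length v) (perm_of_word v) (perm_of_word w)"


section \<open>Tableaux\<close>

type_synonym box = "nat \<times> nat"
type_synonym filling = "box \<Rightarrow> nat"

definition part :: "nat list \<Rightarrow> nat \<Rightarrow> nat" where
  "part \<alpha> i = \<alpha> ! (i - 1)"

definition cd :: "nat list \<Rightarrow> box set" where
  "cd \<alpha> = {(i, j). i \<in> {1..length \<alpha>} \<and> j \<in> {1..part \<alpha> i}}"

text \<open>Fillings are \<open>undefined\<close> outside the diagram, so that tableaux correspond one-to-one to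
  functions.\<close>

definition fillings :: "nat list \<Rightarrow> filling set" where
  "fillings \<alpha> = {T \<in> extensional (cd \<alpha>). bij_betw T (cd \<alpha>) {1..sum_list \<alpha>}}"

definition SIT :: "nat list \<Rightarrow> filling set" where
  "SIT \<alpha> = {T \<in> fillings \<alpha>.
     (\<forall>i j k. (i, j) \<in> cd \<alpha> \<and> (i, k) \<in> cd \<alpha> \<and> j < k \<longrightarrow> T (i, j) < T (i, k)) \<and>
     (\<forall>i j. (i, 1) \<in> cd \<alpha> \<and> (j, 1) \<in> cd \<alpha> \<and> i < j \<longrightarrow> T (i, 1) < T (j, 1))}"

definition SET :: "nat list \<Rightarrow> filling set" where
  "SET \<alpha> = {T \<in> fillings \<alpha>.
     (\<forall>i j k. (i, j) \<in> cd \<alpha> \<and> (i, k) \<in> cd \<alpha> \<and> j < k \<longrightarrow> T (i, j) < T (i, k)) \<and>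
     (\<forall>i j k. (i, k) \<in> cd \<alpha> \<and> (j, k) \<in> cd \<alpha> \<and> i < j \<longrightarrow> T (i, k) < T (j, k))}"

definition SRCT :: "nat list \<Rightarrow> filling set" where
  "SRCT \<alpha> = {T \<in> fillings \<alpha>.
     (\<forall>i j k. (i, j) \<in> cd \<alpha> \<and> (i, k) \<in> cd \<alpha> \<and> j < k \<longrightarrow> T (i, j) > T (i, k)) \<and>
     (\<forall>i j. (i, 1) \<in> cd \<alpha> \<and> (j, 1) \<in> cd \<alpha> \<and> i < j \<longrightarrow> T (i, 1) < T (j, 1)) \<and>
     (\<forall>i j k. (i, k) \<in> cd \<alpha> \<and> (j, Suc k) \<in> cd \<alpha> \<and> i < j \<and> T (i, k) > T (j, Suc k) \<longrightarrow>
        (i, Suc k) \<in> cd \<alpha> \<and> T (i, Suc k) > T (j, Suc k))}"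

definition box_of :: "nat list \<Rightarrow> filling \<Rightarrow> nat \<Rightarrow> box" where
  "box_of \<alpha> T = the_inv_into (cd \<alpha>) T"

definition Des :: "nat list \<Rightarrow> filling \<Rightarrow> nat set" where
  "Des \<alpha> T = {i \<in> {1..<sum_list \<alpha>}. fst (box_of \<alpha> T i) < fst (box_of \<alpha> T (Suc i))}"

definition Des_SRCT :: "nat list \<Rightarrow> filling \<Rightarrow> nat set" where
  "Des_SRCT \<alpha> T = {i \<in> {1..<sum_list \<alpha>}. snd (box_of \<alpha> T i) \<le> snd (box_of \<alpha> T (Suc i))}"

definition dual_immaculate :: "nat list \<Rightarrow> series" where
  "dual_immaculate \<alpha> = (\<Sum>T\<in>SIT \<alpha>. fund (comp_of (sum_list \<alpha>) (Des \<alpha> T)))"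

definition extended_schur :: "nat list \<Rightarrow> series" where
  "extended_schur \<alpha> = (\<Sum>T\<in>SET \<alpha>. fund (comp_of (sum_list \<alpha>) (Des \<alpha> T)))"

definition quasi_schur :: "nat list \<Rightarrow> series" where
  "quasi_schur \<alpha> = (\<Sum>T\<in>SRCT \<alpha>. fund (comp_of (sum_list \<alpha>) (Des_SRCT \<alpha> T)))"


section \<open>The posets\<close>

text \<open>The list \<open>bs\<close> of distinct boxes is filled with 1, 2, and so on in the order of the list.\<close>

definition fill_along :: "box list \<Rightarrow> filling" where
  "fill_along bs = restrict (\<lambda>b. Suc (length (takeWhile (\<lambda>x. x \<noteq> b) bs))) (set bs)"

definition row_boxes :: "nat list \<Rightarrow> box list" where
  "row_boxes \<alpha> = [(i, j). i \<leftarrow> [1..<Suc (length \<alpha>)], j \<leftarrow> [1..<Suc (part \<alpha> i)]]"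

definition column_boxes :: "nat list \<Rightarrow> box list" where
  "column_boxes \<alpha> = [(i, j). j \<leftarrow> [1..<Suc (sum_list \<alpha>)], i \<leftarrow> [1..<Suc (length \<alpha>)], j \<le> part \<alpha> i]"

definition reading :: "nat list \<Rightarrow> filling \<Rightarrow> nat list" where
  "reading \<alpha> T = [T (i, j). i \<leftarrow> [1..<Suc (length \<alpha>)], j \<leftarrow> rev [1..<Suc (part \<alpha> i)]]"

definition V_poset :: "nat list \<Rightarrow> nat rel" where
  "V_poset \<alpha> = word_poset
     (reading \<alpha> (fill_along (row_boxes \<alpha>)))
     (reading \<alpha> (fill_along
       ([(i, 1). i \<leftarrow> [1..<Suc (length \<alpha>)]] @
        [(i, j). i \<leftarrow> rev [1..<Suc (length \<alpha>)], j \<leftarrow> [2..<Suc (part \<alpha> i)]])))"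

definition X_poset :: "nat list \<Rightarrow> nat rel" where
  "X_poset \<alpha> = word_poset
     (reading \<alpha> (fill_along (row_boxes \<alpha>)))
     (reading \<alpha> (fill_along (column_boxes \<alpha>)))"

definition column_equiv :: "nat list \<Rightarrow> filling rel" where
  "column_equiv \<alpha> = {(\<tau>1, \<tau>2). \<tau>1 \<in> SRCT \<alpha> \<and> \<tau>2 \<in> SRCT \<alpha> \<and>
     (\<forall>i j k. (i, k) \<in> cd \<alpha> \<and> (j, k) \<in> cd \<alpha> \<longrightarrow>
        (\<tau>1 (i, k) < \<tau>1 (j, k) \<longleftrightarrow> \<tau>2 (i, k) < \<tau>2 (j, k)))}"

definition SRCT_classes :: "nat list \<Rightarrow> filling set set" where
  "SRCT_classes \<alpha> = SRCT \<alpha> // column_equiv \<alpha>"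

definition is_source :: "nat list \<Rightarrow> filling \<Rightarrow> bool" where
  "is_source \<alpha> \<tau> \<longleftrightarrow> (\<forall>i\<in>{1..<sum_list \<alpha>} - Des_SRCT \<alpha> \<tau>.
     fst (box_of \<alpha> \<tau> (Suc i)) = fst (box_of \<alpha> \<tau> i) \<and>
     Suc (snd (box_of \<alpha> \<tau> (Suc i))) = snd (box_of \<alpha> \<tau> i))"

definition is_sink :: "nat list \<Rightarrow> filling \<Rightarrow> bool" where
  "is_sink \<alpha> \<tau> \<longleftrightarrow> (\<forall>i\<in>Des_SRCT \<alpha> \<tau>.
     snd (box_of \<alpha> \<tau> (Suc i)) = snd (box_of \<alpha> \<tau> i) \<or>
     snd (box_of \<alpha> \<tau> (Suc i)) = Suc (snd (box_of \<alpha> \<tau> i)) \<and>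
     fst (box_of \<alpha> \<tau> i) < fst (box_of \<alpha> \<tau> (Suc i)))"

definition source_tableau :: "nat list \<Rightarrow> filling set \<Rightarrow> filling" where
  "source_tableau \<alpha> E = (THE \<tau>. \<tau> \<in> E \<and> is_source \<alpha> \<tau>)"

definition sink_tableau :: "nat list \<Rightarrow> filling set \<Rightarrow> filling" where
  "sink_tableau \<alpha> E = (THE \<tau>. \<tau> \<in> E \<and> is_sink \<alpha> \<tau>)"

text \<open>The strips $H_1, \dots, H_{m+1}$ of the source tableau \<open>\<tau>\<^sub>0\<close>. Each of them lies in a single row,
  so \<open>column_boxes\<close> lists its boxes from left to right.\<close>

definition strips :: "nat list \<Rightarrow> filling \<Rightarrow> box set list" where
  "strips \<alpha> \<tau>\<^sub>0 = (let ds = sorted_list_of_set (Des_SRCT \<alpha> \<tau>\<^sub>0) in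
     map (\<lambda>(d, d'). {b \<in> cd \<alpha>. d < \<tau>\<^sub>0 b \<and> \<tau>\<^sub>0 b \<le> d'}) (zip (0 # ds) (ds @ [sum_list \<alpha>])))"

definition strip_reading :: "nat list \<Rightarrow> filling set \<Rightarrow> filling \<Rightarrow> nat list" where
  "strip_reading \<alpha> E \<tau> =
     concat (map (\<lambda>H. map \<tau> (filter (\<lambda>b. b \<in> H) (column_boxes \<alpha>))) (strips \<alpha> (source_tableau \<alpha> E)))"

definition S_poset :: "nat list \<Rightarrow> filling set \<Rightarrow> nat rel" where
  "S_poset \<alpha> E = word_poset (strip_reading \<alpha> E (source_tableau \<alpha> E))
     (strip_reading \<alpha> E (sink_tableau \<alpha> E))"


section \<open>The eight families\<close>

text \<open>In order: $\mathcal{S}$, $\widehat{\mathcal{S}}$, $\mathcal{RS}$, $\mathcal{R}$,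
  $\mathfrak{S}^*$, $\mathcal{R}\mathfrak{S}^*$, $\mathcal{E}$, $\mathcal{RE}$.\<close>

datatype family = QS | YQS | RQS | YRQS | DI | RDI | ES | RES

primrec qfun :: "family \<Rightarrow> nat list \<Rightarrow> series" where
  "qfun QS \<alpha> = quasi_schur \<alpha>"
| "qfun YQS \<alpha> = qsym_rho (quasi_schur (rev \<alpha>))"
| "qfun RQS \<alpha> = qsym_psi (quasi_schur \<alpha>)"
| "qfun YRQS \<alpha> = qsym_rho (qsym_psi (quasi_schur (rev \<alpha>)))"
| "qfun DI \<alpha> = dual_immaculate \<alpha>"
| "qfun RDI \<alpha> = qsym_psi (dual_immaculate \<alpha>)"
| "qfun ES \<alpha> = extended_schur \<alpha>"
| "qfun RES \<alpha> = qsym_psi (extended_schur \<alpha>)"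

text \<open>Labels of the members of $\mathsf{ind}(\mathbf{Y}_\alpha)$: either there is one member, or the
  members are indexed by classes of tableaux.\<close>

datatype ind_label = Single | Class "filling set"

primrec ind :: "family \<Rightarrow> nat list \<Rightarrow> ind_label set" where
  "ind QS \<alpha> = Class ` SRCT_classes \<alpha>"
| "ind YQS \<alpha> = Class ` SRCT_classes (rev \<alpha>)"
| "ind RQS \<alpha> = Class ` SRCT_classes \<alpha>"
| "ind YRQS \<alpha> = Class ` SRCT_classes (rev \<alpha>)"
| "ind DI \<alpha> = {Single}"
| "ind RDI \<alpha> = {Single}"
| "ind ES \<alpha> = {Single}"
| "ind RES \<alpha> = {Single}"

text \<open>Only values at labels in \<open>ind Y \<alpha>\<close> matter.\<close>

fun ind_poset :: "family \<Rightarrow> nat list \<Rightarrow> ind_label \<Rightarrow> nat rel" where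
  "ind_poset QS \<alpha> (Class E) = S_poset \<alpha> E"
| "ind_poset YQS \<alpha> (Class E) = poset_star (poset_bar (sum_list \<alpha>) (S_poset (rev \<alpha>) E))"
| "ind_poset RQS \<alpha> (Class E) = poset_bar (sum_list \<alpha>) (S_poset \<alpha> E)"
| "ind_poset YRQS \<alpha> (Class E) = poset_star (S_poset (rev \<alpha>) E)"
| "ind_poset DI \<alpha> Single = V_poset \<alpha>"
| "ind_poset RDI \<alpha> Single = poset_bar (sum_list \<alpha>) (V_poset \<alpha>)"
| "ind_poset ES \<alpha> Single = X_poset \<alpha>"
| "ind_poset RES \<alpha> Single = poset_bar (sum_list \<alpha>) (X_poset \<alpha>)"
| "ind_poset _ _ _ = {}"

end

(* In each case the tableaux are the linear extensions of a poset on the boxes of the diagram, and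
   reading the boxes in a fixed order turns them into permutations. Left multiplication acts on
   values, so the left weak order compares inversion sets of pairs of positions; hence the tableaux
   form the interval between two of them as soon as, for every pair of boxes, an inversion of the
   minimum is an inversion of all and an inversion of any is one of the maximum. The descents of a
   tableau are the i for which the box of i is read before that of i + 1, and the fundamental theorem
   on P-partitions gives the generating function. Complementing and reversing linear extensions
   accounts for psi and rho.

   For reverse composition tableaux, fixing the relative orders in the columns turns the triple
   condition into order relations between boxes of adjacent columns. Columns are chains and every
   generating relation moves by at most one column, so a chain of relations meets all columns in
   between. Consequently, in the source tableau two incomparable boxes are ordered by their columns,
   and in the sink tableau they are ordered the opposite way. *)
theory Submission
  imports Defs
begin

section \<open>Compositions\<close>

text \<open>Two notions are given by definite descriptions, and each needs its own uniqueness proof: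
  \<open>fund_coeffs\<close>, hence \<psi> and \<rho>, rests on the linear independence of the
  fundamental functions, and \<open>interval_poset\<close> on the fact that a poset is the
  intersection of its linear extensions. The interval poset is two-dimensional: on positions it is
  the intersection of the linear orders given by the two end points, and the
  \<open>poset_bar\<close> around it comes from the longest element in
  \<open>longest_perm n \<circ> inv \<gamma>\<close>.

  For reverse composition tableaux the reading order is cut along the strips of one tableau, the
  source, while descents are prescribed for every tableau of the class. The two agree because a step
  to the left between consecutive entries of any tableau, if forced by the relations, is already a
  step between consecutive entries of the source. Source and sink are exchanged by negating the
  column index; columns are therefore integers, and one argument serves both.\<close>

lemma sum_fun_app: "(\<Sum>x\<in>A. f x) m = (\<Sum>x\<in>A. f x m)"
  for f :: "'a \<Rightarrow> 'b \<Rightarrow> 'c::comm_monoid_add"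
  by (induction A rule: infinite_finite_induct) auto

lemma comp_set_Nil [simp]: "comp_set [] = {}"
  by (auto simp: comp_set_def)

lemma comp_set_Cons:
  "comp_set (a # \<beta>) = (if \<beta> = [] then {} else insert a ((+) a ` comp_set \<beta>))"
proof (cases "\<beta> = []")
  case False
  have "x \<in> comp_set (a # \<beta>) \<longleftrightarrow> x \<in> insert a ((+) a ` comp_set \<beta>)" for x
  proof
    assume "x \<in> comp_set (a # \<beta>)"
    then obtain k where k: "x = sum_list (take k (a # \<beta>))" "1 \<le> k" "k < Suc (length \<beta>)"
      by (auto simp: comp_set_def)
    then obtain l where l: "k = Suc l"
      by (cases k) auto
    show "x \<in> insert a ((+) a ` comp_set \<beta>)"
    proof (cases "l = 0")
      case False
      then have "sum_list (take l \<beta>) \<in> comp_set \<beta>"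
        using k l by (auto simp: comp_set_def)
      then show ?thesis
        using k l by simp
    qed (use k l in simp)
  next
    assume "x \<in> insert a ((+) a ` comp_set \<beta>)"
    then consider "x = a" | k where "x = a + sum_list (take k \<beta>)" "1 \<le> k" "k < length \<beta>"
      by (auto simp: comp_set_def)
    then show "x \<in> comp_set (a # \<beta>)"
    proof cases
      case 1
      then show ?thesis
        using False by (auto simp: comp_set_def neq_Nil_conv intro!: exI[of _ 1])
    next
      case 2
      then show ?thesis
        by (auto simp: comp_set_def intro!: exI[of _ "Suc k"])
    qed
  qed
  then show ?thesis
    using False by auto
qed (auto simp: comp_set_def)

lemma comp_set_subset: "0 \<notin> set \<beta> \<Longrightarrow> comp_set \<beta> \<subseteq> {1..<sum_list \<beta>}"
proof (induction \<beta>)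
  case (Cons a \<beta>)
  have "0 < sum_list \<beta>" if "\<beta> \<noteq> []"
    using that Cons.prems by (cases \<beta>) auto
  moreover have "x < sum_list \<beta>" if "x \<in> comp_set \<beta>" for x
    using that Cons by auto
  moreover have "0 < a"
    using Cons.prems by auto
  ultimately show ?case
    by (auto simp: comp_set_Cons simp del: sum_list_eq_0_iff neq0_conv)
qed simp

lemma comp_set_inject:
  assumes "0 \<notin> set \<beta>" "0 \<notin> set \<gamma>" "sum_list \<beta> = sum_list \<gamma>" "comp_set \<beta> = comp_set \<gamma>"
  shows "\<beta> = \<gamma>"
  using assms
proof (induction \<beta> arbitrary: \<gamma>)
  case Nil
  then show ?case
    by (cases \<gamma>) auto
next
  case (Cons a \<beta>)
  then obtain b \<delta> where \<gamma>: "\<gamma> = b # \<delta>"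
    by (cases \<gamma>) auto
  show ?case
  proof (cases "\<beta> = [] \<or> \<delta> = []")
    case True
    with Cons.prems \<gamma> show ?thesis
      by (auto simp: comp_set_Cons split: if_splits)
  next
    case False
    with Cons.prems(4) \<gamma> have eq: "insert a ((+) a ` comp_set \<beta>) = insert b ((+) b ` comp_set \<delta>)"
      by (simp add: comp_set_Cons)
    then have "a \<in> insert b ((+) b ` comp_set \<delta>)" "b \<in> insert a ((+) a ` comp_set \<beta>)"
      by blast+
    \<comment> \<open>Each set has its first part as least element, the shifted elements being at
      least as large; the two memberships give both inequalities.\<close>
    then have ab: "a = b"
      by auto
    have nin: "a \<notin> (+) a ` comp_set \<beta>" "a \<notin> (+) a ` comp_set \<delta>"
      using comp_set_subset[of \<beta>] comp_set_subset[of \<delta>] Cons.prems \<gamma> by auto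
    then have "(+) a ` comp_set \<beta> = (+) a ` comp_set \<delta>"
      using eq ab by (metis insert_ident)
    then have "comp_set \<beta> = comp_set \<delta>"
      by (simp add: inj_image_eq_iff)
    with Cons ab \<gamma> show ?thesis
      by auto
  qed
qed

text \<open>The parts are the successive differences of the list \<open>l # ds @ [u]\<close>. The
  left end \<open>l\<close> is kept general because the induction removes the first cut and restarts
  from it.\<close>

lemma composition_with_comp_set:
  assumes "sorted_wrt (<) (l # ds @ [u])"
  shows "\<exists>\<beta>. 0 \<notin> set \<beta> \<and> sum_list \<beta> = u - l \<and> (+) l ` comp_set \<beta> = set ds \<and> \<beta> \<noteq> []"
  using assms
proof (induction ds arbitrary: l)
  case Nil
  then show ?case
    by (intro exI[of _ "[u - l]"]) (auto simp: comp_set_Cons)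
next
  case (Cons d ds)
  then have "sorted_wrt (<) (d # ds @ [u])"
    by simp
  from Cons.IH[OF this] obtain \<beta> where \<beta>: "0 \<notin> set \<beta>" "sum_list \<beta> = u - d"
    "(+) d ` comp_set \<beta> = set ds" "\<beta> \<noteq> []"
    by blast
  have "l < d" "d < u"
    using Cons.prems by auto
  then have "(+) l ` (+) (d - l) ` comp_set \<beta> = set ds"
    unfolding image_image \<beta>(3)[symmetric] by (intro image_cong) auto
  with \<open>l < d\<close> \<open>d < u\<close> \<beta> show ?case
    by (intro exI[of _ "(d - l) # \<beta>"]) (auto simp: comp_set_Cons)
qed

lemma comp_set_bij: "bij_betw comp_set {\<beta>. composition \<beta> n} (Pow {1..<n})"
  unfolding bij_betw_def
proof
  show "inj_on comp_set {\<beta>. composition \<beta> n}"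
    by (auto simp: inj_on_def composition_def intro: comp_set_inject)
  have "\<exists>\<beta>. composition \<beta> n \<and> comp_set \<beta> = D" if "D \<subseteq> {1..<n}" for D
  \<comment> \<open>For n = 0 a list with both ends 0 and n is not strictly increasing, so the empty
    composition is given directly.\<close>
  proof (cases "n = 0")
    case True
    with that show ?thesis
      by (intro exI[of _ "[]"]) (auto simp: composition_def)
  next
    case False
    have fin: "finite D"
      using that finite_subset by blast
    have "sorted_wrt (<) (0 # sorted_list_of_set D @ [n])"
      using that fin False by (auto simp: sorted_wrt_append)
    from composition_with_comp_set[OF this] fin show ?thesis
      by (auto simp: composition_def)
  qed
  moreover have "comp_set \<beta> \<subseteq> {1..<n}" if "composition \<beta> n" for \<beta>
    using that comp_set_subset[of \<beta>] by (simp add: composition_def)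
  ultimately show "comp_set ` {\<beta>. composition \<beta> n} = Pow {1..<n}"
    by blast
qed

lemma comp_of_composition: "D \<subseteq> {1..<n} \<Longrightarrow> composition (comp_of n D) n"
  unfolding comp_of_def
  using the_inv_into_into[OF bij_betw_imp_inj_on[OF comp_set_bij], of D n "{\<beta>. composition \<beta> n}"]
    comp_set_bij[of n] by (auto simp: bij_betw_def)

lemma comp_set_comp_of: "D \<subseteq> {1..<n} \<Longrightarrow> comp_set (comp_of n D) = D"
  unfolding comp_of_def by (intro f_the_inv_into_f_bij_betw[OF comp_set_bij]) auto

lemma comp_of_eqI: "composition \<beta> n \<Longrightarrow> comp_set \<beta> = D \<Longrightarrow> comp_of n D = \<beta>"
  unfolding comp_of_def
  using the_inv_into_f_f[OF bij_betw_imp_inj_on[OF comp_set_bij], of \<beta> n] by auto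

lemma comp_compl_comp_of:
  assumes "D \<subseteq> {1..<n}"
  shows "comp_compl (comp_of n D) = comp_of n ({1..<n} - D)"
  using comp_of_composition[OF assms] comp_set_comp_of[OF assms]
  by (simp add: comp_compl_def composition_def)

text \<open>A prefix of the reversal is a reversed suffix, so its sum is the total minus the sum of
  the complementary prefix.\<close>

lemma comp_set_rev: "comp_set (rev \<beta>) = (\<lambda>x. sum_list \<beta> - x) ` comp_set \<beta>"
proof -
  have eq: "sum_list (take k (rev \<beta>)) = sum_list \<beta> - sum_list (take (length \<beta> - k) \<beta>)" for k
    using arg_cong[OF append_take_drop_id[of "length \<beta> - k" \<beta>], of sum_list]
    by (simp add: take_rev del: append_take_drop_id)
  show ?thesis
  proof (intro equalityI subsetI)
    fix x
    assume "x \<in> comp_set (rev \<beta>)"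
    then obtain k where "x = sum_list (take k (rev \<beta>))" "1 \<le> k" "k < length \<beta>"
      by (auto simp: comp_set_def)
    moreover from this have "sum_list (take (length \<beta> - k) \<beta>) \<in> comp_set \<beta>"
      by (auto simp: comp_set_def intro!: exI[of _ "length \<beta> - k"])
    ultimately show "x \<in> (\<lambda>x. sum_list \<beta> - x) ` comp_set \<beta>"
      by (simp add: eq)
  next
    fix x
    assume "x \<in> (\<lambda>x. sum_list \<beta> - x) ` comp_set \<beta>"
    then obtain k where "x = sum_list \<beta> - sum_list (take k \<beta>)" "1 \<le> k" "k < length \<beta>"
      by (auto simp: comp_set_def)
    then show "x \<in> comp_set (rev \<beta>)"
      by (auto simp: comp_set_def eq intro!: exI[of _ "length \<beta> - k"])
  qed
qed

lemma rev_comp_of: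
  assumes "D \<subseteq> {1..<n}"
  shows "rev (comp_of n D) = comp_of n ((\<lambda>x. n - x) ` D)"
  using comp_of_composition[OF assms] comp_set_comp_of[OF assms]
  by (intro comp_of_eqI[symmetric]) (auto simp: composition_def comp_set_rev)


section \<open>Fundamental quasisymmetric functions\<close>

lemma length_sorted_list_of_multiset [simp]: "length (sorted_list_of_multiset m) = size m"
  by (metis mset_sorted_list_of_multiset size_mset)

text \<open>Among the words with content \<open>m\<close> only the sorted one is weakly increasing,
  so every coefficient is 0 or 1 and can be read off a single list.\<close>

lemma fund_eq:
  "fund \<beta> m = (if size m = sum_list \<beta> \<and> (\<forall>i\<in>#m. 1 \<le> i) \<and>
     (\<forall>j\<in>comp_set \<beta>. sorted_list_of_multiset m ! (j - 1) < sorted_list_of_multiset m ! j)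
   then 1 else 0)"
proof -
  let ?l = "sorted_list_of_multiset m"
  have "length is = sum_list \<beta> \<and> (\<forall>i\<in>set is. 1 \<le> i) \<and> sorted is \<and>
     (\<forall>j\<in>comp_set \<beta>. is ! (j - 1) < is ! j) \<and> mset is = m \<longleftrightarrow>
     is = ?l \<and> size m = sum_list \<beta> \<and> (\<forall>i\<in>#m. 1 \<le> i) \<and> (\<forall>j\<in>comp_set \<beta>. ?l ! (j - 1) < ?l ! j)" for "is"
    by (auto simp: sorted_sort_id)
  then have "{is. length is = sum_list \<beta> \<and> (\<forall>i\<in>set is. 1 \<le> i) \<and> sorted is \<and>
     (\<forall>j\<in>comp_set \<beta>. is ! (j - 1) < is ! j) \<and> mset is = m} =
     (if size m = sum_list \<beta> \<and> (\<forall>i\<in>#m. 1 \<le> i) \<and> (\<forall>j\<in>comp_set \<beta>. ?l ! (j - 1) < ?l ! j)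
      then {?l} else {})"
    by auto
  then show ?thesis
    unfolding fund_def by simp
qed

text \<open>The content of the word of length \<open>n\<close> that increases by one exactly when
  the zero-based position reaches an element of \<open>D\<close>. For \<open>D\<close> inside
  \<open>{1..<n}\<close> it is the monomial with smallest indices whose strict ascents sit at
  \<open>D\<close>.\<close>

definition set_monomial :: "nat \<Rightarrow> nat set \<Rightarrow> nat multiset" where
  "set_monomial n D = mset (map (\<lambda>j. Suc (card {d\<in>D. d \<le> j})) [0..<n])"

text \<open>Evaluated at these test monomials, the fundamental functions form a matrix that is
  unitriangular for inclusion of the sets of partial sums; linear independence rests on
  this.\<close>

lemma fund_set_monomial:
  assumes "finite D" "0 \<notin> set \<beta>"
  shows "fund \<beta> (set_monomial n D) = (if sum_list \<beta> = n \<and> comp_set \<beta> \<subseteq> D then 1 else 0)"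
proof -
  let ?f = "\<lambda>j. Suc (card {d\<in>D. d \<le> j})"
  have "?f i \<le> ?f j" if "i \<le> j" for i j
    using that assms by (auto intro!: card_mono)
  then have "sorted (map ?f [0..<n])"
    by (auto simp: sorted_iff_nth_mono)
  then have l: "sorted_list_of_multiset (set_monomial n D) = map ?f [0..<n]"
    unfolding set_monomial_def sorted_list_of_multiset_mset by (rule sorted_sort_id)
  have step: "?f (j - 1) < ?f j \<longleftrightarrow> j \<in> D" if "1 \<le> j" for j
  proof
    assume "j \<in> D"
    then have "{d\<in>D. d \<le> j - 1} \<subseteq> {d\<in>D. d \<le> j}" "j \<in> {d\<in>D. d \<le> j} - {d\<in>D. d \<le> j - 1}"
      using that by auto
    then have "{d\<in>D. d \<le> j - 1} \<subset> {d\<in>D. d \<le> j}"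
      by blast
    then show "?f (j - 1) < ?f j"
      using assms by (auto intro!: psubset_card_mono)
  next
    assume *: "?f (j - 1) < ?f j"
    show "j \<in> D"
    proof (rule ccontr)
      assume "j \<notin> D"
      have "d \<le> j \<longleftrightarrow> d \<le> j - 1" if "d \<in> D" for d
        using that \<open>j \<notin> D\<close> by (cases "d = j") auto
      then have "{d\<in>D. d \<le> j} = {d\<in>D. d \<le> j - 1}"
        by blast
      with * show False
        by simp
    qed
  qed
  have sz: "size (set_monomial n D) = n"
    by (simp add: set_monomial_def)
  have pos: "\<forall>i\<in>#set_monomial n D. 1 \<le> i"
    by (auto simp: set_monomial_def)
  have "(\<forall>j\<in>comp_set \<beta>. map ?f [0..<n] ! (j - 1) < map ?f [0..<n] ! j) \<longleftrightarrow> comp_set \<beta> \<subseteq> D"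
    if n: "sum_list \<beta> = n"
  proof -
    have "map ?f [0..<n] ! (j - 1) < map ?f [0..<n] ! j \<longleftrightarrow> j \<in> D" if "j \<in> comp_set \<beta>" for j
    proof -
      have "1 \<le> j" "j < n"
        using that comp_set_subset[OF assms(2)] n by auto
      then have "j - Suc 0 < n" "1 \<le> j" "j < n"
        by auto
      then show ?thesis
        using step by simp
    qed
    then show ?thesis
      by blast
  qed
  then show ?thesis
    unfolding fund_eq l using sz pos by auto
qed

text \<open>Choose a term with nonzero coefficient whose set of partial sums has least size and look
  at its own test monomial: only terms whose set is contained in that one contribute, and minimality
  leaves a single term.\<close>

lemma fund_independent:
  assumes fin: "finite S" and S: "\<And>\<beta>. \<beta> \<in> S \<Longrightarrow> 0 \<notin> set \<beta>"
    and zero: "(\<Sum>\<beta>\<in>S. scale (d \<beta>) (fund \<beta>)) = 0"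
  shows "\<forall>\<beta>\<in>S. d \<beta> = 0"
proof (rule ccontr)
  assume "\<not> ?thesis"
  then have "\<exists>\<beta>. \<beta> \<in> S \<and> d \<beta> \<noteq> 0"
    by blast
  then obtain \<beta> where \<beta>: "\<beta> \<in> S" "d \<beta> \<noteq> 0"
    and min: "\<And>\<gamma>. \<gamma> \<in> S \<Longrightarrow> d \<gamma> \<noteq> 0 \<Longrightarrow> card (comp_set \<beta>) \<le> card (comp_set \<gamma>)"
    using ex_has_least_nat[of "\<lambda>\<beta>. \<beta> \<in> S \<and> d \<beta> \<noteq> 0" _ "\<lambda>\<beta>. card (comp_set \<beta>)"] by blast
  have fin\<beta>: "finite (comp_set \<beta>)"
    using comp_set_subset[OF S[OF \<beta>(1)]] finite_subset by blast
  let ?m = "set_monomial (sum_list \<beta>) (comp_set \<beta>)"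
  have "d \<gamma> * fund \<gamma> ?m = (if \<gamma> = \<beta> then d \<beta> else 0)" if "\<gamma> \<in> S" for \<gamma>
  proof (cases "d \<gamma> = 0 \<or> fund \<gamma> ?m = 0")
    case True
    then show ?thesis
      using fund_set_monomial[OF fin\<beta> S[OF \<beta>(1)]] by auto
  next
    case False
    then have *: "sum_list \<gamma> = sum_list \<beta>" "comp_set \<gamma> \<subseteq> comp_set \<beta>"
      using fund_set_monomial[OF fin\<beta> S[OF that], of "sum_list \<beta>"] by (auto split: if_splits)
    then have "comp_set \<gamma> = comp_set \<beta>"
      using card_seteq[OF fin\<beta> *(2)] min[OF that] False by simp
    then have "\<gamma> = \<beta>"
      using comp_set_inject[OF S[OF that] S[OF \<beta>(1)]] * by simp
    then show ?thesis
      using fund_set_monomial[OF fin\<beta> S[OF \<beta>(1)]] by auto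
  qed
  then have "(\<Sum>\<gamma>\<in>S. d \<gamma> * fund \<gamma> ?m) = d \<beta>"
    using fin \<beta>(1) by simp
  moreover have "(\<Sum>\<gamma>\<in>S. d \<gamma> * fund \<gamma> ?m) = 0"
    using fun_cong[OF zero, of ?m] by (simp add: sum_fun_app scale_def)
  ultimately show False
    using \<beta>(2) by simp
qed

section \<open>Coefficients and linear maps in the fundamental basis\<close>

lemma sum_keys_superset:
  assumes "finite S" "Poly_Mapping.keys c \<subseteq> S"
  shows "(\<Sum>\<beta>\<in>Poly_Mapping.keys c. scale (Poly_Mapping.lookup c \<beta>) (g \<beta>)) =
    (\<Sum>\<beta>\<in>S. scale (Poly_Mapping.lookup c \<beta>) (g \<beta>))"
  using assms by (intro sum.mono_neutral_left) (auto simp: scale_def in_keys_iff)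

text \<open>Two expansions are compared over the union of their supports, where their difference
  vanishes and independence applies. This uniqueness lets the definite description be
  evaluated.\<close>

lemma fund_coeffs_eqI:
  assumes c: "\<And>\<beta>. \<beta> \<in> Poly_Mapping.keys c \<Longrightarrow> 0 \<notin> set \<beta>"
    and f: "f = (\<Sum>\<beta>\<in>Poly_Mapping.keys c. scale (Poly_Mapping.lookup c \<beta>) (fund \<beta>))"
  shows "fund_coeffs f = c"
  unfolding fund_coeffs_def
proof (rule the_equality)
  show "(\<forall>\<beta>\<in>Poly_Mapping.keys c. 0 \<notin> set \<beta>) \<and>
     f = (\<Sum>\<beta>\<in>Poly_Mapping.keys c. scale (Poly_Mapping.lookup c \<beta>) (fund \<beta>))"
    using assms by blast
next
  fix c'
  assume c': "(\<forall>\<beta>\<in>Poly_Mapping.keys c'. 0 \<notin> set \<beta>) \<and>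
     f = (\<Sum>\<beta>\<in>Poly_Mapping.keys c'. scale (Poly_Mapping.lookup c' \<beta>) (fund \<beta>))"
  let ?S = "Poly_Mapping.keys c \<union> Poly_Mapping.keys c'"
  have "(\<Sum>\<beta>\<in>?S. scale (Poly_Mapping.lookup c \<beta>) (fund \<beta>)) =
        (\<Sum>\<beta>\<in>?S. scale (Poly_Mapping.lookup c' \<beta>) (fund \<beta>))"
    using sum_keys_superset[of ?S c fund] sum_keys_superset[of ?S c' fund] f c' by simp
  then have diff: "(\<Sum>\<beta>\<in>?S. scale (Poly_Mapping.lookup c \<beta> - Poly_Mapping.lookup c' \<beta>) (fund \<beta>)) = 0"
    by (simp add: fun_eq_iff sum_fun_app scale_def left_diff_distrib sum_subtractf)
  have "0 \<notin> set \<beta>" if "\<beta> \<in> ?S" for \<beta>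
    using that c c' by blast
  from fund_independent[OF _ this diff]
  have eq: "\<forall>\<beta>\<in>?S. Poly_Mapping.lookup c \<beta> - Poly_Mapping.lookup c' \<beta> = 0"
    by simp
  have "Poly_Mapping.lookup c' \<beta> = Poly_Mapping.lookup c \<beta>" for \<beta>
  proof (cases "\<beta> \<in> ?S")
    case True
    with eq show ?thesis
      by simp
  next
    case False
    then show ?thesis
      by (simp add: in_keys_iff)
  qed
  then show "c' = c"
    by (simp add: poly_mapping_eqI)
qed

text \<open>The map \<open>b\<close> may repeat compositions, so the coefficients are
  multiplicities: they are collected as a sum of singletons, and the double sum over compositions
  and indices is then exchanged.\<close>

lemma fund_linear_sum:
  assumes "finite A" "\<And>x. x \<in> A \<Longrightarrow> 0 \<notin> set (b x)"
  shows "fund_linear \<phi> (\<Sum>x\<in>A. fund (b x)) = (\<Sum>x\<in>A. fund (\<phi> (b x)))"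
proof -
  define c where "c = (\<Sum>x\<in>A. Poly_Mapping.single (b x) (1::int))"
  have lookup: "Poly_Mapping.lookup c \<beta> = (\<Sum>x\<in>A. if b x = \<beta> then 1 else 0)" for \<beta>
    unfolding c_def by (simp add: lookup_sum lookup_single when_def eq_commute)
  have keys: "Poly_Mapping.keys c \<subseteq> b ` A"
    using keys_sum[of "\<lambda>x. Poly_Mapping.single (b x) (1::int)" A] by (auto simp: c_def)
  have *: "(\<Sum>\<beta>\<in>Poly_Mapping.keys c. scale (Poly_Mapping.lookup c \<beta>) (g \<beta>)) =
     (\<Sum>x\<in>A. g (b x))" for g :: "nat list \<Rightarrow> series"
  proof (rule ext)
    fix m
    have "(\<Sum>\<beta>\<in>Poly_Mapping.keys c. scale (Poly_Mapping.lookup c \<beta>) (g \<beta>)) m =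
      (\<Sum>\<beta>\<in>b ` A. \<Sum>x\<in>A. if b x = \<beta> then g \<beta> m else 0)"
      unfolding sum_keys_superset[OF finite_imageI[OF assms(1)] keys]
      by (simp add: sum_fun_app scale_def lookup sum_distrib_right if_distrib cong: if_cong)
        (auto intro!: sum.cong)
    also have "\<dots> = (\<Sum>x\<in>A. \<Sum>\<beta>\<in>b ` A. if b x = \<beta> then g \<beta> m else 0)"
      by (rule sum.swap)
    also have "\<dots> = (\<Sum>x\<in>A. g (b x) m)"
      using assms(1) by (intro sum.cong) (auto simp: sum.delta)
    finally show "(\<Sum>\<beta>\<in>Poly_Mapping.keys c. scale (Poly_Mapping.lookup c \<beta>) (g \<beta>)) m =
      (\<Sum>x\<in>A. g (b x)) m"
      by (simp add: sum_fun_app)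
  qed
  have "fund_coeffs (\<Sum>x\<in>A. fund (b x)) = c"
    using assms(2) keys * by (intro fund_coeffs_eqI) auto
  then show ?thesis
    unfolding fund_linear_def using *[of "\<lambda>\<beta>. fund (\<phi> \<beta>)"] by simp
qed

section \<open>Left weak order through inversion sets\<close>

text \<open>Pairs of positions, since left multiplication permutes the values.\<close>

definition inversions :: "nat \<Rightarrow> (nat \<Rightarrow> nat) \<Rightarrow> nat rel" where
  "inversions n \<gamma> = {(a, b). a \<in> {1..n} \<and> b \<in> {1..n} \<and> a < b \<and> \<gamma> b < \<gamma> a}"

lemma finite_inversions [simp]: "finite (inversions n \<gamma>)"
  by (rule finite_subset[of _ "{1..n} \<times> {1..n}"]) (auto simp: inversions_def)

lemma inversions_id [simp]: "inversions n id = {}"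
  by (auto simp: inversions_def)

lemma increasing_permutes_id:
  assumes p: "p permutes {1..n}" and inc: "\<And>i. i \<in> {1..<n} \<Longrightarrow> p i < p (Suc i)"
  shows "p = id"
proof -
  have ge: "i \<le> n \<longrightarrow> i \<le> p i" if "1 \<le> i" for i :: nat
    using that
  proof (induction i rule: dec_induct)
    case base
    then show ?case
      using permutes_in_image[OF p, of 1] by auto
  next
    case (step i)
    then show ?case
      using inc[of i] by auto
  qed
  have le: "p i \<le> i" if "i \<in> {1..n}" for i
  proof -
    \<comment> \<open>Downward induction from n, written as an upward one on the distance k.\<close>
    have "p (n - k) \<le> n - k" if "k < n" for k
      using that
    proof (induction k)
      case 0
      then show ?case
        using permutes_in_image[OF p, of n] by auto
    next
      case (Suc k)
      then have "Suc (n - Suc k) = n - k" "n - Suc k \<in> {1..<n}"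
        by auto
      with Suc.IH Suc.prems inc[of "n - Suc k"] show ?case
        by simp
    qed
    from this[of "n - i"] that show ?thesis
      by auto
  qed
  show ?thesis
  proof
    fix i
    show "p i = id i"
      using ge[of i] le[of i] permutes_not_in[OF p, of i] by (cases "i \<in> {1..n}") auto
  qed
qed

lemma transpose_Suc_less_iff:
  assumes "x \<noteq> y" "{x, y} \<noteq> {i, Suc i}"
  shows "transpose i (Suc i) x < transpose i (Suc i) y \<longleftrightarrow> x < y"
  using assms by (auto simp: transpose_def)

lemma transpose_Suc_permutes:
  "\<gamma> permutes {1..n} \<Longrightarrow> i \<in> {1..<n} \<Longrightarrow> transpose i (Suc i) \<circ> \<gamma> permutes {1..n}"
  by (intro permutes_compose permutes_swap_id) auto

text \<open>Left multiplication by an adjacent transposition reverses the comparison of the values i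
  and i + 1 only, so exactly one pair of positions, the one holding these values, enters the
  inversion set.\<close>

lemma inversions_transpose:
  assumes \<gamma>: "\<gamma> permutes {1..n}" and i: "i \<in> {1..<n}" and lt: "inv \<gamma> i < inv \<gamma> (Suc i)"
  shows "inversions n (transpose i (Suc i) \<circ> \<gamma>) = insert (inv \<gamma> i, inv \<gamma> (Suc i)) (inversions n \<gamma>)"
    and "(inv \<gamma> i, inv \<gamma> (Suc i)) \<notin> inversions n \<gamma>"
proof -
  have inv_in: "inv \<gamma> i \<in> {1..n}" "inv \<gamma> (Suc i) \<in> {1..n}"
    using permutes_in_image[OF permutes_inv[OF \<gamma>]] i by auto
  have app: "\<gamma> (inv \<gamma> x) = x" "inv \<gamma> (\<gamma> x) = x" for x
    using permutes_inverses[OF \<gamma>] by auto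
  show "(inv \<gamma> i, inv \<gamma> (Suc i)) \<notin> inversions n \<gamma>"
    by (simp add: inversions_def app)
  have "(a, b) \<in> inversions n (transpose i (Suc i) \<circ> \<gamma>) \<longleftrightarrow>
    (a, b) \<in> insert (inv \<gamma> i, inv \<gamma> (Suc i)) (inversions n \<gamma>)" for a b
  proof (cases "a < b \<and> {\<gamma> a, \<gamma> b} \<noteq> {i, Suc i}")
    case True
    then have "\<gamma> b \<noteq> \<gamma> a" "{\<gamma> b, \<gamma> a} \<noteq> {i, Suc i}"
      using app(2) by (metis nat_neq_iff) (metis True insert_commute)
    then have "transpose i (Suc i) (\<gamma> b) < transpose i (Suc i) (\<gamma> a) \<longleftrightarrow> \<gamma> b < \<gamma> a"
      by (rule transpose_Suc_less_iff)
    moreover have "(a, b) \<noteq> (inv \<gamma> i, inv \<gamma> (Suc i))"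
      using True app(1) by auto
    ultimately show ?thesis
      by (auto simp: inversions_def)
  next
    case False
    show ?thesis
    proof (cases "a < b")
      case True
      with False have "\<gamma> a = i \<and> \<gamma> b = Suc i \<or> \<gamma> a = Suc i \<and> \<gamma> b = i"
        by (auto simp: doubleton_eq_iff)
      then have "a = inv \<gamma> i \<and> b = inv \<gamma> (Suc i) \<or> a = inv \<gamma> (Suc i) \<and> b = inv \<gamma> i"
        using app(2) by metis
      with True lt have "a = inv \<gamma> i" "b = inv \<gamma> (Suc i)"
        by auto
      with inv_in lt show ?thesis
        by (auto simp: inversions_def app)
    next
      case False
      with lt show ?thesis
        by (auto simp: inversions_def)
    qed
  qed
  then show "inversions n (transpose i (Suc i) \<circ> \<gamma>) = insert (inv \<gamma> i, inv \<gamma> (Suc i)) (inversions n \<gamma>)"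
    by auto
qed

lemma transpose_Suc_twice [simp]: "transpose i (Suc i) \<circ> (transpose i (Suc i) \<circ> \<gamma>) = \<gamma>"
  by (simp add: fun_eq_iff)

lemma inv_transpose_comp:
  assumes "\<gamma> permutes {1..n}"
  shows "inv (transpose i (Suc i) \<circ> \<gamma>) i = inv \<gamma> (Suc i)"
    and "inv (transpose i (Suc i) \<circ> \<gamma>) (Suc i) = inv \<gamma> i"
proof -
  have "inv (transpose i (Suc i) \<circ> \<gamma>) = inv \<gamma> \<circ> inv (transpose i (Suc i))"
    using assms by (intro o_inv_distrib) (auto simp: permutes_bij)
  then show "inv (transpose i (Suc i) \<circ> \<gamma>) i = inv \<gamma> (Suc i)"
    "inv (transpose i (Suc i) \<circ> \<gamma>) (Suc i) = inv \<gamma> i"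
    by simp_all
qed

lemma card_inversions_transpose:
  assumes \<gamma>: "\<gamma> permutes {1..n}" and i: "i \<in> {1..<n}"
  shows "card (inversions n (transpose i (Suc i) \<circ> \<gamma>)) =
    (if inv \<gamma> i < inv \<gamma> (Suc i) then Suc (card (inversions n \<gamma>)) else card (inversions n \<gamma>) - 1)"
proof (cases "inv \<gamma> i < inv \<gamma> (Suc i)")
  case True
  with inversions_transpose[OF assms] show ?thesis
    by simp
next
  case False
  let ?\<delta> = "transpose i (Suc i) \<circ> \<gamma>"
  have "inv \<gamma> i \<noteq> inv \<gamma> (Suc i)"
    using permutes_inj[OF permutes_inv[OF \<gamma>]] by (simp add: inj_eq)
  with False have "inv ?\<delta> i < inv ?\<delta> (Suc i)"
    using inv_transpose_comp[OF \<gamma>] by simp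
  from inversions_transpose[OF transpose_Suc_permutes[OF assms] i this] False show ?thesis
    by simp
qed

text \<open>Some i has \<sigma> larger at the \<rho>-position of i than at that of i + 1, since
  otherwise \<open>\<sigma> \<circ> inv \<rho>\<close> would be increasing. Containment forces the
  position of i + 1 to come first, so this pair is an inversion of \<rho> but not of \<sigma>, and
  undoing it keeps \<sigma> below.\<close>

lemma inversions_descend:
  assumes \<sigma>: "\<sigma> permutes {1..n}" and \<rho>: "\<rho> permutes {1..n}"
    and sub: "inversions n \<sigma> \<subseteq> inversions n \<rho>" and ne: "\<sigma> \<noteq> \<rho>"
  obtains i where "i \<in> {1..<n}" "inv \<rho> (Suc i) < inv \<rho> i"
    "inversions n \<sigma> \<subseteq> inversions n (transpose i (Suc i) \<circ> \<rho>)"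
    "card (inversions n \<rho>) = Suc (card (inversions n (transpose i (Suc i) \<circ> \<rho>)))"
proof -
  have app: "\<rho> (inv \<rho> x) = x" "inv \<rho> (\<rho> x) = x" for x
    using permutes_inverses[OF \<rho>] by auto
  have inv_in: "inv \<rho> i \<in> {1..n}" if "i \<in> {1..n}" for i
    using permutes_in_image[OF permutes_inv[OF \<rho>]] that by auto
  have "\<exists>i\<in>{1..<n}. \<not> \<sigma> (inv \<rho> i) < \<sigma> (inv \<rho> (Suc i))"
  proof (rule ccontr)
    assume "\<not> ?thesis"
    then have "\<sigma> \<circ> inv \<rho> = id"
      by (intro increasing_permutes_id[of _ n] permutes_compose permutes_inv \<sigma> \<rho>) auto
    then have "\<sigma> (inv \<rho> (\<rho> x)) = \<rho> x" for x
      by (simp add: fun_eq_iff)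
    with ne app show False
      by (simp add: fun_eq_iff)
  qed
  then obtain i where i: "i \<in> {1..<n}" and "\<not> \<sigma> (inv \<rho> i) < \<sigma> (inv \<rho> (Suc i))"
    by blast
  moreover have "inv \<rho> i \<noteq> inv \<rho> (Suc i)"
    using permutes_inj[OF permutes_inv[OF \<rho>]] by (simp add: inj_eq)
  moreover from this have "\<sigma> (inv \<rho> i) \<noteq> \<sigma> (inv \<rho> (Suc i))"
    using permutes_inj[OF \<sigma>] by (simp add: inj_eq)
  ultimately have gt: "\<sigma> (inv \<rho> (Suc i)) < \<sigma> (inv \<rho> i)"
    by simp
  have lt: "inv \<rho> (Suc i) < inv \<rho> i"
  proof (rule ccontr)
    assume "\<not> ?thesis"
    with \<open>inv \<rho> i \<noteq> inv \<rho> (Suc i)\<close> have "inv \<rho> i < inv \<rho> (Suc i)"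
      by simp
    with gt inv_in i have "(inv \<rho> i, inv \<rho> (Suc i)) \<in> inversions n \<sigma>"
      by (auto simp: inversions_def)
    with sub have "(inv \<rho> i, inv \<rho> (Suc i)) \<in> inversions n \<rho>"
      by blast
    then show False
      by (simp add: inversions_def app)
  qed
  let ?\<delta> = "transpose i (Suc i) \<circ> \<rho>"
  have \<delta>: "?\<delta> permutes {1..n}"
    using \<rho> i by (rule transpose_Suc_permutes)
  have "inv ?\<delta> i < inv ?\<delta> (Suc i)"
    using inv_transpose_comp[OF \<rho>] lt by simp
  from inversions_transpose[OF \<delta> i this]
  have *: "inversions n \<rho> = insert (inv \<rho> (Suc i), inv \<rho> i) (inversions n ?\<delta>)"
    "(inv \<rho> (Suc i), inv \<rho> i) \<notin> inversions n ?\<delta>"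
    using inv_transpose_comp[OF \<rho>] by simp_all
  have "(inv \<rho> (Suc i), inv \<rho> i) \<notin> inversions n \<sigma>"
    using gt by (simp add: inversions_def)
  with sub *(1) have "inversions n \<sigma> \<subseteq> inversions n ?\<delta>"
    by (metis subset_insert)
  with that i lt * show ?thesis
    by simp
qed

section \<open>Length as the number of inversions\<close>

lemma simple_prod_inversions:
  "set is \<subseteq> {1..<n} \<Longrightarrow>
    simple_prod is permutes {1..n} \<and> card (inversions n (simple_prod is)) \<le> length is"
proof (induction "is")
  case Nil
  then show ?case
    by (simp add: simple_prod_def permutes_id flip: id_def)
next
  case (Cons i "is")
  then have IH: "simple_prod is permutes {1..n}" "card (inversions n (simple_prod is)) \<le> length is"
    and i: "i \<in> {1..<n}"
    by auto
  have eq: "simple_prod (i # is) = transpose i (Suc i) \<circ> simple_prod is"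
    by (simp add: simple_prod_def)
  show ?case
    unfolding eq card_inversions_transpose[OF IH(1) i] using IH transpose_Suc_permutes[OF IH(1) i] by (auto simp del: comp_apply)
qed

text \<open>Bubble sort: descending from \<gamma> towards the identity removes one inversion per
  simple transposition, which makes the bound of \<open>simple_prod_inversions\<close>
  sharp.\<close>

lemma simple_prod_exists:
  "\<gamma> permutes {1..n} \<Longrightarrow>
    \<exists>is. length is = card (inversions n \<gamma>) \<and> set is \<subseteq> {1..<n} \<and> \<gamma> = simple_prod is"
proof (induction "card (inversions n \<gamma>)" arbitrary: \<gamma> rule: less_induct)
  case less
  show ?case
  proof (cases "\<gamma> = id")
    case True
    then show ?thesis
      by (intro exI[of _ "[]"]) (simp add: simple_prod_def)
  next
    case False
    then obtain i where i: "i \<in> {1..<n}"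
      and card: "card (inversions n \<gamma>) = Suc (card (inversions n (transpose i (Suc i) \<circ> \<gamma>)))"
      using inversions_descend[OF permutes_id less.prems] by auto
    then obtain "is" where "length is = card (inversions n (transpose i (Suc i) \<circ> \<gamma>))"
      "set is \<subseteq> {1..<n}" "transpose i (Suc i) \<circ> \<gamma> = simple_prod is"
      using less.hyps[OF _ transpose_Suc_permutes[OF less.prems i]] by auto
    moreover from this have "\<gamma> = simple_prod (i # is)"
      using transpose_Suc_twice[of i \<gamma>] by (simp add: simple_prod_def)
    ultimately show ?thesis
      using i card by (intro exI[of _ "i # is"]) auto
  qed
qed

lemma perm_length_eq:
  assumes "\<gamma> permutes {1..n}"
  shows "perm_length n \<gamma> = card (inversions n \<gamma>)"
  unfolding perm_length_def
proof (rule Least_equality)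
  show "\<exists>is. length is = card (inversions n \<gamma>) \<and> set is \<subseteq> {1..<n} \<and> \<gamma> = simple_prod is"
    using simple_prod_exists[OF assms] .
next
  fix k
  assume "\<exists>is. length is = k \<and> set is \<subseteq> {1..<n} \<and> \<gamma> = simple_prod is"
  then show "card (inversions n \<gamma>) \<le> k"
    using simple_prod_inversions by blast
qed

lemma left_cover_iff:
  "(\<gamma>, \<delta>) \<in> left_cover n \<longleftrightarrow> \<gamma> permutes {1..n} \<and>
    (\<exists>i\<in>{1..<n}. \<delta> = transpose i (Suc i) \<circ> \<gamma> \<and> inv \<gamma> i < inv \<gamma> (Suc i))"
proof -
  have "perm_length n (transpose i (Suc i) \<circ> \<gamma>) > perm_length n \<gamma> \<longleftrightarrow> inv \<gamma> i < inv \<gamma> (Suc i)"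
    if "\<gamma> permutes {1..n}" "i \<in> {1..<n}" for i
    using card_inversions_transpose[OF that] perm_length_eq[OF that(1)]
      perm_length_eq[OF transpose_Suc_permutes[OF that]] by auto
  then show ?thesis
    unfolding left_cover_def by auto
qed

lemma left_cover_rtrancl_inversions:
  "(\<sigma>, \<rho>) \<in> (left_cover n)\<^sup>* \<Longrightarrow> inversions n \<sigma> \<subseteq> inversions n \<rho>"
proof (induction rule: rtrancl_induct)
  case (step \<gamma> \<delta>)
  then show ?case
    using inversions_transpose(1) by (auto simp: left_cover_iff)
qed simp

text \<open>Repeated use of \<open>inversions_descend\<close> walks from \<rho> down to \<sigma>,
  one cover at a time; so containment of inversion sets is the weak order itself.\<close>

lemma left_cover_rtrancl:
  assumes "\<sigma> permutes {1..n}" "\<rho> permutes {1..n}" "inversions n \<sigma> \<subseteq> inversions n \<rho>"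
  shows "(\<sigma>, \<rho>) \<in> (left_cover n)\<^sup>*"
  using assms(2,3)
proof (induction "card (inversions n \<rho>)" arbitrary: \<rho> rule: less_induct)
  case less
  show ?case
  proof (cases "\<sigma> = \<rho>")
    case False
    from inversions_descend[OF assms(1) less.prems False]
    obtain i where i: "i \<in> {1..<n}" "inv \<rho> (Suc i) < inv \<rho> i"
      "inversions n \<sigma> \<subseteq> inversions n (transpose i (Suc i) \<circ> \<rho>)"
      "card (inversions n \<rho>) = Suc (card (inversions n (transpose i (Suc i) \<circ> \<rho>)))"
      by blast
    let ?\<delta> = "transpose i (Suc i) \<circ> \<rho>"
    have \<delta>: "?\<delta> permutes {1..n}"
      using less.prems(1) i(1) by (rule transpose_Suc_permutes)
    have "(?\<delta>, \<rho>) \<in> left_cover n"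
      unfolding left_cover_iff
      using \<delta> i inv_transpose_comp[OF less.prems(1)] by (auto intro!: bexI[of _ i])
    moreover have "(\<sigma>, ?\<delta>) \<in> (left_cover n)\<^sup>*"
      using less.hyps[OF _ \<delta>] i by simp
    ultimately show ?thesis
      by simp
  qed simp
qed

lemma left_interval_eq:
  assumes "\<sigma> permutes {1..n}" "\<rho> permutes {1..n}"
  shows "left_interval n \<sigma> \<rho> = {\<gamma>. \<gamma> permutes {1..n} \<and>
    inversions n \<sigma> \<subseteq> inversions n \<gamma> \<and> inversions n \<gamma> \<subseteq> inversions n \<rho>}"
  unfolding left_interval_def
  using assms left_cover_rtrancl left_cover_rtrancl_inversions by blast

section \<open>Linear extensions and P-partitions\<close>

text \<open>Linear extensions are built from injective numerical keys: \<open>inv \<sigma>\<close>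
  is the rank of an element for the key, so \<sigma> lists the elements in increasing key
  order.\<close>

lemma increasing_enumeration:
  fixes g :: "nat \<Rightarrow> nat"
  assumes "inj_on g {1..n}"
  obtains \<sigma> where "\<sigma> permutes {1..n}"
    "\<And>i j. i \<in> {1..n} \<Longrightarrow> j \<in> {1..n} \<Longrightarrow> g i < g j \<Longrightarrow> inv \<sigma> i < inv \<sigma> j"
proof -
  define r where "r = (\<lambda>i. if i \<in> {1..n} then card {j \<in> {1..n}. g j \<le> g i} else i)"
  have mono: "r i < r j" if "i \<in> {1..n}" "j \<in> {1..n}" "g i < g j" for i j
  proof -
    have "{k \<in> {1..n}. g k \<le> g i} \<subseteq> {k \<in> {1..n}. g k \<le> g j}"
      "j \<in> {k \<in> {1..n}. g k \<le> g j} - {k \<in> {1..n}. g k \<le> g i}"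
      using that by auto
    then have "{k \<in> {1..n}. g k \<le> g i} \<subset> {k \<in> {1..n}. g k \<le> g j}"
      by blast
    then have "card {k \<in> {1..n}. g k \<le> g i} < card {k \<in> {1..n}. g k \<le> g j}"
      by (intro psubset_card_mono) simp_all
    then show ?thesis
      using that by (simp add: r_def)
  qed
  have "inj_on r {1..n}"
  proof (rule inj_onI)
    fix i j
    assume "i \<in> {1..n}" "j \<in> {1..n}" "r i = r j"
    then have "g i = g j"
      using mono[of i j] mono[of j i] by (metis less_irrefl linorder_neqE_nat)
    with assms show "i = j"
      using \<open>i \<in> {1..n}\<close> \<open>j \<in> {1..n}\<close> by (auto dest: inj_onD)
  qed
  moreover have "r ` {1..n} \<subseteq> {1..n}"
  proof
    fix x
    assume "x \<in> r ` {1..n}"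
    then obtain i where i: "i \<in> {1..n}" "x = card {j \<in> {1..n}. g j \<le> g i}"
      by (auto simp: r_def)
    moreover have "card {j \<in> {1..n}. g j \<le> g i} \<le> card {1..n}"
      by (intro card_mono) auto
    moreover have "card {j \<in> {1..n}. g j \<le> g i} > 0"
      using i by (auto simp: card_gt_0_iff)
    ultimately show "x \<in> {1..n}"
      by auto
  qed
  ultimately have "bij_betw r {1..n} {1..n}"
    by (simp add: bij_betw_def endo_inj_surj)
  then have r: "r permutes {1..n}"
    by (intro bij_imp_permutes) (auto simp: r_def)
  show ?thesis
  proof
    show "inv r permutes {1..n}"
      using r by (rule permutes_inv)
    show "inv (inv r) i < inv (inv r) j" if "i \<in> {1..n}" "j \<in> {1..n}" "g i < g j" for i j
      using mono[OF that] by (simp add: permutes_inv_inv[OF r])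
  qed
qed

text \<open>The up-set of i is moved behind everything else; as j is outside it, j then comes before
  i. Inside either half, elements are sorted by the size of their principal down-set, which grows
  strictly along \<open>P\<close>.\<close>

lemma linear_extension_exists:
  assumes P: "partial_order_on {1..n} P" and i: "i \<in> {1..n}" and j: "j \<in> {1..n}" and ij: "(i, j) \<notin> P"
  obtains \<sigma> where "\<sigma> \<in> Sigma_R n P" "inv \<sigma> j < inv \<sigma> i"
proof -
  let ?D = "\<lambda>x. {z. (z, x) \<in> P}"
  define N where "N = Suc n"
  \<comment> \<open>Lexicographic key: membership in the up-set, then size of the down-set, then
    label. \<open>N\<close> exceeds every label, and \<open>(N + 1) * N\<close> exceeds every value
    of the last two parts together.\<close>
  define g where "g = (\<lambda>x. (if (i, x) \<in> P then (N + 1) * N else 0) + (card (?D x) * N + x))"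
  have Psub: "P \<subseteq> {1..n} \<times> {1..n}" and refl: "\<And>x. x \<in> {1..n} \<Longrightarrow> (x, x) \<in> P"
    and trans: "\<And>x y z. (x, y) \<in> P \<Longrightarrow> (y, z) \<in> P \<Longrightarrow> (x, z) \<in> P"
    and antisym: "\<And>x y. (x, y) \<in> P \<Longrightarrow> (y, x) \<in> P \<Longrightarrow> x = y"
    using P by (auto simp: partial_order_on_def preorder_on_def refl_on_def trans_def antisym_def)
  have finD: "finite (?D x)" for x
    by (rule finite_subset[of _ "{1..n}"]) (use Psub in auto)
  have cardD: "card (?D x) \<le> n" for x
    using card_mono[of "{1..n}" "?D x"] Psub by auto
  have div: "card (?D x) * N + x < (N + 1) * N" if "x \<in> {1..n}" for x
  proof -
    have "card (?D x) * N \<le> N * N"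
      using cardD[of x] by (intro mult_right_mono) (auto simp: N_def)
    with that show ?thesis
      by (auto simp: N_def)
  qed
  have mono: "g x < g y" if "(x, y) \<in> P" "x \<noteq> y" for x y
  proof -
    have "?D x \<subseteq> ?D y" "y \<in> ?D y" "y \<notin> ?D x"
      using that trans antisym refl Psub by blast+
    then have "Suc (card (?D x)) \<le> card (?D y)"
      using psubset_card_mono[OF finD, of "?D x" y] by (metis Suc_leI psubsetI)
    then have "Suc (card (?D x)) * N \<le> card (?D y) * N"
      by (rule mult_right_mono) simp
    moreover have "x < N"
      using that Psub by (auto simp: N_def)
    ultimately have "card (?D x) * N + x < card (?D y) * N + y"
      by simp
    moreover have "(i, x) \<in> P \<longrightarrow> (i, y) \<in> P"
      using that(1) trans by blast
    ultimately show ?thesis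
      by (simp add: g_def)
  qed
  have "inj_on g {1..n}"
  proof (rule inj_onI)
    fix x y
    assume xy: "x \<in> {1..n}" "y \<in> {1..n}" "g x = g y"
    have "g x mod N = x mod N" "g y mod N = y mod N"
      unfolding g_def by (auto simp: mod_add_left_eq[symmetric])
    with xy show "x = y"
      by (auto simp: N_def)
  qed
  then obtain \<sigma> where \<sigma>: "\<sigma> permutes {1..n}"
    "\<And>i j. i \<in> {1..n} \<Longrightarrow> j \<in> {1..n} \<Longrightarrow> g i < g j \<Longrightarrow> inv \<sigma> i < inv \<sigma> j"
    using increasing_enumeration by blast
  show ?thesis
  proof
    show "\<sigma> \<in> Sigma_R n P"
      unfolding Sigma_R_def using \<sigma> mono Psub by blast
    have "g j < g i"
      using div[OF j] ij refl[OF i] by (simp add: g_def)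
    then show "inv \<sigma> j < inv \<sigma> i"
      using \<sigma>(2) i j by blast
  qed
qed

text \<open>A poset is the intersection of its linear extensions: a pair of \<open>Q\<close> missing
  from \<open>P\<close> is reversed in some linear extension of \<open>P\<close>, which then cannot
  be one of \<open>Q\<close>.\<close>

lemma partial_order_Sigma_R_subset:
  assumes "partial_order_on {1..n} P" "partial_order_on {1..n} Q" "Sigma_R n P \<subseteq> Sigma_R n Q"
  shows "Q \<subseteq> P"
proof (rule subrelI, rule ccontr)
  fix i j
  assume ij: "(i, j) \<in> Q" "(i, j) \<notin> P"
  have "i \<in> {1..n}" "j \<in> {1..n}"
    using ij assms(2) by (auto simp: partial_order_on_def preorder_on_def)
  then obtain \<sigma> where "\<sigma> \<in> Sigma_R n P" "inv \<sigma> j < inv \<sigma> i"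
    using linear_extension_exists[OF assms(1) _ _ ij(2)] by blast
  moreover have "i \<noteq> j"
    using ij \<open>i \<in> {1..n}\<close> assms(1) by (auto simp: partial_order_on_def preorder_on_def refl_on_def)
  ultimately show False
    using ij(1) assms(3) unfolding Sigma_R_def by fastforce
qed

lemma partial_order_Sigma_R_inject:
  assumes "partial_order_on {1..n} P" "partial_order_on {1..n} Q" "Sigma_R n P = Sigma_R n Q"
  shows "P = Q"
  using partial_order_Sigma_R_subset[OF assms(1,2)] partial_order_Sigma_R_subset[OF assms(2,1)] assms(3)
  by blast

lemma finite_Sigma_R [simp]: "finite (Sigma_R n P)"
  by (rule finite_subset[OF _ finite_permutations[of "{1..n}"]]) (auto simp: Sigma_R_def)

definition descents :: "nat \<Rightarrow> (nat \<Rightarrow> nat) \<Rightarrow> nat set" where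
  "descents n \<sigma> = {i \<in> {1..<n}. \<sigma> (Suc i) < \<sigma> i}"

lemma descents_subset: "descents n \<sigma> \<subseteq> {1..<n}"
  by (auto simp: descents_def)

lemma descent_between:
  fixes \<sigma> :: "nat \<Rightarrow> nat"
  assumes "p < q" "\<sigma> q < \<sigma> p"
  obtains r where "p \<le> r" "r < q" "\<sigma> (Suc r) < \<sigma> r"
proof -
  have "\<exists>r. p \<le> r \<and> r < q \<and> \<sigma> (Suc r) < \<sigma> r"
  proof (rule ccontr)
    assume *: "\<not> ?thesis"
    have "p \<le> r \<Longrightarrow> r \<le> q \<longrightarrow> \<sigma> p \<le> \<sigma> r" for r
      by (induction r rule: dec_induct) (use * in \<open>auto intro: order_trans simp: not_less\<close>)
    from this[of q] assms show False
      by simp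
  qed
  with that show ?thesis
    by blast
qed

text \<open>A \<open>P\<close>-partition with image multiset \<open>m\<close> is the sorted list of \<open>m\<close> read along the linear
  extension that sorts \<open>{1..n}\<close> by value, ties being broken by label.\<close>

theorem K_eq_sum_fund:
  assumes P: "partial_order_on {1..n} P"
  shows "K n P = (\<Sum>\<sigma>\<in>Sigma_R n P. fund (comp_of n (descents n \<sigma>)))"
proof
  fix m :: "nat multiset"
  let ?l = "sorted_list_of_multiset m"
  define F where "F = {f \<in> P_partitions n P. image_mset f (mset_set {1..n}) = m}"
  \<comment> \<open>The linear extensions whose fundamental function contains the monomial
    \<open>m\<close>. As each coefficient is 0 or 1, counting them gives the right-hand side, and
    \<open>h\<close> matches them with the P-partitions of content \<open>m\<close>.\<close>
  define S where "S = {\<sigma> \<in> Sigma_R n P. size m = n \<and> (\<forall>i\<in>#m. 1 \<le> i) \<and>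
    (\<forall>j\<in>descents n \<sigma>. ?l ! (j - 1) < ?l ! j)}"
  define h where "h = (\<lambda>\<sigma>. restrict (\<lambda>i. ?l ! (inv \<sigma> i - 1)) {1..n})"
  have Psub: "P \<subseteq> {1..n} \<times> {1..n}"
    using P by (auto simp: partial_order_on_def preorder_on_def)
  have perm: "\<sigma> permutes {1..n}" if "\<sigma> \<in> S" for \<sigma>
    using that by (auto simp: S_def Sigma_R_def)
  have inv_in: "inv \<sigma> i \<in> {1..n}" if "\<sigma> permutes {1..n}" "i \<in> {1..n}" for \<sigma> i
    using permutes_in_image[OF permutes_inv[OF that(1)]] that(2) by auto
  have len: "length ?l = n" if "\<sigma> \<in> S" for \<sigma>
    using that by (simp add: S_def)
  have le: "?l ! (p - 1) \<le> ?l ! (q - 1)" if "\<sigma> \<in> S" "p \<le> q" "q \<in> {1..n}" for \<sigma> p q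
  proof -
    have "p - 1 \<le> q - 1" "q - 1 < length ?l"
      using that len[OF that(1)] by auto
    then show ?thesis
      by (intro sorted_nth_mono) auto
  qed
  \<comment> \<open>If the label at q is smaller than the one at p, there is a descent in between,
    and the list rises strictly there.\<close>
  have less: "?l ! (p - 1) < ?l ! (q - 1)"
    if \<sigma>: "\<sigma> \<in> S" and pq: "p < q" "p \<in> {1..n}" "q \<in> {1..n}" "\<sigma> q < \<sigma> p" for \<sigma> p q
  proof -
    obtain r where r: "p \<le> r" "r < q" "\<sigma> (Suc r) < \<sigma> r"
      using descent_between pq by blast
    then have "r \<in> descents n \<sigma>"
      using pq by (auto simp: descents_def)
    then have "?l ! (r - 1) < ?l ! (Suc r - 1)"
      using \<sigma> by (simp add: S_def)
    moreover have "?l ! (p - 1) \<le> ?l ! (r - 1)" "?l ! (Suc r - 1) \<le> ?l ! (q - 1)"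
      using le[OF \<sigma>, of p r] le[OF \<sigma>, of "Suc r" q] r pq by auto
    ultimately show ?thesis
      by simp
  qed
  \<comment> \<open>The linear extension is recovered from its image as the order by value and then
    by label, which gives both injectivity and the P-partition inequalities.\<close>
  have h_sorts: "inv \<sigma> i < inv \<sigma> j \<longleftrightarrow> (h \<sigma> i < h \<sigma> j \<or> h \<sigma> i = h \<sigma> j \<and> i < j)"
    if \<sigma>: "\<sigma> \<in> S" and ij: "i \<in> {1..n}" "j \<in> {1..n}" for \<sigma> i j
  proof -
    have app: "\<sigma> (inv \<sigma> x) = x" for x
      using permutes_inverses[OF perm[OF \<sigma>]] by auto
    have *: "h \<sigma> i < h \<sigma> j \<or> h \<sigma> i = h \<sigma> j \<and> i < j"
      if "inv \<sigma> i < inv \<sigma> j" "i \<in> {1..n}" "j \<in> {1..n}" for i j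
      using le[OF \<sigma>, of "inv \<sigma> i" "inv \<sigma> j"] less[OF \<sigma>, of "inv \<sigma> i" "inv \<sigma> j"]
        inv_in[OF perm[OF \<sigma>]] that app
      by (force simp: h_def)
    show ?thesis
    proof (cases "inv \<sigma> i = inv \<sigma> j")
      case True
      then have "i = j"
        using app by metis
      then show ?thesis
        by simp
    next
      case False
      then show ?thesis
        using *[of i j] *[of j i] ij by linarith
    qed
  qed
  have "bij_betw h S F"
    unfolding bij_betw_def
  proof
    show "inj_on h S"
    proof (rule inj_onI)
      fix \<sigma> \<tau>
      assume \<sigma>\<tau>: "\<sigma> \<in> S" "\<tau> \<in> S" "h \<sigma> = h \<tau>"
      have p: "inv \<tau> \<circ> \<sigma> permutes {1..n}"
        using perm \<sigma>\<tau> by (intro permutes_compose permutes_inv) auto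
      have "(inv \<tau> \<circ> \<sigma>) i < (inv \<tau> \<circ> \<sigma>) (Suc i)" if "i \<in> {1..<n}" for i
      proof -
        have "\<sigma> i \<in> {1..n}" "\<sigma> (Suc i) \<in> {1..n}"
          using permutes_in_image[OF perm[OF \<sigma>\<tau>(1)]] that by auto
        moreover have "inv \<sigma> (\<sigma> i) < inv \<sigma> (\<sigma> (Suc i))"
          using permutes_inverses[OF perm[OF \<sigma>\<tau>(1)]] by simp
        ultimately show ?thesis
          using h_sorts[OF \<sigma>\<tau>(1)] h_sorts[OF \<sigma>\<tau>(2)] \<sigma>\<tau>(3) by simp
      qed
      from increasing_permutes_id[OF p this] have "inv \<tau> (\<sigma> x) = x" for x
        by (simp add: fun_eq_iff)
      then show "\<sigma> = \<tau>"
        using permutes_inverses[OF perm[OF \<sigma>\<tau>(2)]] by (metis ext)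
    qed
    show "h ` S = F"
    proof (intro equalityI subsetI)
      fix f
      assume "f \<in> h ` S"
      then obtain \<sigma> where \<sigma>: "\<sigma> \<in> S" and f: "f = h \<sigma>"
        by blast
      have bij: "bij_betw (\<lambda>i. inv \<sigma> i - 1) {1..n} {0..<n}"
      proof -
        have "bij_betw (inv \<sigma>) {1..n} {1..n}"
          using permutes_inv[OF perm[OF \<sigma>]] by (rule permutes_imp_bij)
        moreover have "bij_betw (\<lambda>i. i - 1) {1..n} {0..<n}"
          by (rule bij_betw_byWitness[of _ Suc]) auto
        ultimately show ?thesis
          using bij_betw_trans[of "inv \<sigma>" _ _ "\<lambda>i. i - 1"] by (simp add: comp_def)
      qed
      have "image_mset f (mset_set {1..n}) = image_mset (\<lambda>i. ?l ! (inv \<sigma> i - 1)) (mset_set {1..n})"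
        unfolding f h_def by (intro image_mset_cong) auto
      also have "\<dots> = image_mset (\<lambda>i. ?l ! i) (image_mset (\<lambda>i. inv \<sigma> i - 1) (mset_set {1..n}))"
        by (simp add: image_mset.compositionality comp_def)
      also have "image_mset (\<lambda>i. inv \<sigma> i - 1) (mset_set {1..n}) = mset_set {0..<n}"
        using bij by (simp add: image_mset_mset_set bij_betw_def)
      also have "image_mset (\<lambda>i. ?l ! i) (mset_set {0..<n}) = mset (map (\<lambda>i. ?l ! i) [0..<n])"
        by simp
      also have "map (\<lambda>i. ?l ! i) [0..<n] = ?l"
        using map_nth[of ?l] len[OF \<sigma>] by simp
      finally have img: "image_mset f (mset_set {1..n}) = m"
        by simp
      have "?l ! (inv \<sigma> i - 1) \<in># m" if "i \<in> {1..n}" for i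
        using bij_betwE[OF bij] that len[OF \<sigma>] nth_mem[of "inv \<sigma> i - 1" ?l] by fastforce
      then have "f \<in> {1..n} \<rightarrow>\<^sub>E {1..}"
        using \<sigma> unfolding f h_def S_def by auto
      moreover have "f i \<le> f j \<and> (i > j \<longrightarrow> f i < f j)" if "(i, j) \<in> P" for i j
      proof (cases "i = j")
        case False
        with that \<sigma> have "inv \<sigma> i < inv \<sigma> j"
          by (auto simp: S_def Sigma_R_def)
        moreover have "i \<in> {1..n}" "j \<in> {1..n}"
          using that Psub by auto
        ultimately have "h \<sigma> i < h \<sigma> j \<or> h \<sigma> i = h \<sigma> j \<and> i < j"
          using h_sorts[OF \<sigma>] by simp
        then show ?thesis
          unfolding f by auto
      qed simp
      ultimately show "f \<in> F"
        using img unfolding F_def P_partitions_def by blast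
    next
      fix f
      assume "f \<in> F"
      then have f: "f \<in> {1..n} \<rightarrow>\<^sub>E {1..}" "\<And>i j. (i, j) \<in> P \<Longrightarrow> f i \<le> f j \<and> (i > j \<longrightarrow> f i < f j)"
        and img: "image_mset f (mset_set {1..n}) = m"
        by (auto simp: F_def P_partitions_def)
      \<comment> \<open>Key for sorting by value and then by label; the factor \<open>Suc n\<close>
        exceeds every label.\<close>
      define g where "g = (\<lambda>i. f i * Suc n + i)"
      have g_less: "g i < g j" if "i \<in> {1..n}" "f i < f j \<or> f i = f j \<and> i < j" for i j
        using that(2)
      proof
        assume "f i < f j"
        then have "Suc (f i) * Suc n \<le> f j * Suc n"
          by (intro mult_right_mono) auto
        with that(1) show ?thesis
          by (simp add: g_def)
      qed (simp add: g_def)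
      have "inj_on g {1..n}"
      proof (rule inj_onI)
        fix i j
        assume "i \<in> {1..n}" "j \<in> {1..n}" "g i = g j"
        then show "i = j"
          using g_less[of i j] g_less[of j i] by (metis less_irrefl linorder_neqE_nat)
      qed
      then obtain \<sigma> where \<sigma>: "\<sigma> permutes {1..n}"
        and mono: "\<And>i j. i \<in> {1..n} \<Longrightarrow> j \<in> {1..n} \<Longrightarrow> g i < g j \<Longrightarrow> inv \<sigma> i < inv \<sigma> j"
        using increasing_enumeration by blast
      have app: "\<sigma> (inv \<sigma> x) = x" "inv \<sigma> (\<sigma> x) = x" for x
        using permutes_inverses[OF \<sigma>] by auto
      have \<sigma>_in: "\<sigma> i \<in> {1..n}" if "i \<in> {1..n}" for i
        using permutes_in_image[OF \<sigma>] that by auto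
      have step: "f (\<sigma> i) < f (\<sigma> j) \<or> f (\<sigma> i) = f (\<sigma> j) \<and> \<sigma> i < \<sigma> j"
        if "i < j" "i \<in> {1..n}" "j \<in> {1..n}" for i j
      proof (rule ccontr)
        assume "\<not> ?thesis"
        moreover have "\<sigma> i \<noteq> \<sigma> j"
          using that app(2) by (metis less_irrefl)
        ultimately have "g (\<sigma> j) < g (\<sigma> i)"
          using \<sigma>_in that by (intro g_less) auto
        then have "inv \<sigma> (\<sigma> j) < inv \<sigma> (\<sigma> i)"
          using \<sigma>_in that by (intro mono) auto
        with that app show False
          by simp
      qed
      have "sorted (map (\<lambda>i. f (\<sigma> (Suc i))) [0..<n])"
        unfolding sorted_iff_nth_mono_less
      proof (intro allI impI)
        fix i j
        assume "i < j" "j < length (map (\<lambda>i. f (\<sigma> (Suc i))) [0..<n])"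
        then show "map (\<lambda>i. f (\<sigma> (Suc i))) [0..<n] ! i \<le> map (\<lambda>i. f (\<sigma> (Suc i))) [0..<n] ! j"
          using step[of "Suc i" "Suc j"] by auto
      qed
      moreover have "mset (map (\<lambda>i. f (\<sigma> (Suc i))) [0..<n]) = m"
      proof -
        have bij: "bij_betw (\<lambda>i. \<sigma> (Suc i)) {0..<n} {1..n}"
        proof -
          have "bij_betw Suc {0..<n} {1..n}"
            by (rule bij_betw_byWitness[of _ "\<lambda>i. i - 1"]) auto
          from bij_betw_trans[OF this permutes_imp_bij[OF \<sigma>]] show ?thesis
            by (simp add: comp_def)
        qed
        have "mset (map (\<lambda>i. f (\<sigma> (Suc i))) [0..<n]) =
          image_mset f (image_mset (\<lambda>i. \<sigma> (Suc i)) (mset_set {0..<n}))"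
          by (simp add: image_mset.compositionality comp_def)
        also have "image_mset (\<lambda>i. \<sigma> (Suc i)) (mset_set {0..<n}) = mset_set {1..n}"
          using bij by (simp add: image_mset_mset_set bij_betw_def)
        finally show ?thesis
          using img by simp
      qed
      ultimately have l: "?l = map (\<lambda>i. f (\<sigma> (Suc i))) [0..<n]"
        by (metis sorted_list_of_multiset_mset sorted_sort_id)
      have nth: "?l ! (i - 1) = f (\<sigma> i)" if "i \<in> {1..n}" for i
        using that unfolding l by (subst nth_map) auto
      have "\<sigma> \<in> S"
        unfolding S_def
      proof (intro CollectI conjI ballI)
        show "\<sigma> \<in> Sigma_R n P"
        proof -
          have "inv \<sigma> i < inv \<sigma> j" if "(i, j) \<in> P" "i \<noteq> j" for i j
            using f(2)[OF that(1)] that Psub by (intro mono g_less) (auto simp: order.order_iff_strict)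
          then show ?thesis
            using \<sigma> by (auto simp: Sigma_R_def)
        qed
        show "size m = n"
          using img by auto
        show "1 \<le> i" if "i \<in># m" for i
          using that img f(1) by auto
        show "?l ! (j - 1) < ?l ! j" if "j \<in> descents n \<sigma>" for j
          using that step[of j "Suc j"] nth[of j] nth[of "Suc j"] by (auto simp: descents_def)
      qed
      moreover have "h \<sigma> = f"
      proof
        fix i
        show "h \<sigma> i = f i"
        proof (cases "i \<in> {1..n}")
          case True
          then show ?thesis
            using nth[OF inv_in[OF \<sigma> True]] app(1) by (simp add: h_def)
        next
          case False
          then show ?thesis
            using PiE_arb[OF f(1) False] by (auto simp: h_def restrict_def)
        qed
      qed
      ultimately show "f \<in> h ` S"
        by blast
    qed
  qed
  then have "card F = card S"
    by (simp add: bij_betw_same_card)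
  moreover have "(\<Sum>\<sigma>\<in>Sigma_R n P. fund (comp_of n (descents n \<sigma>))) m =
    (\<Sum>\<sigma>\<in>Sigma_R n P. if \<sigma> \<in> S then 1 else 0)"
    unfolding sum_fun_app
  proof (rule sum.cong[OF refl])
    fix \<sigma>
    assume "\<sigma> \<in> Sigma_R n P"
    then show "fund (comp_of n (descents n \<sigma>)) m = (if \<sigma> \<in> S then 1 else 0)"
      using comp_of_composition[OF descents_subset[of n \<sigma>]] comp_set_comp_of[OF descents_subset[of n \<sigma>]]
      by (auto simp: fund_eq S_def composition_def)
  qed
  moreover have "(\<Sum>\<sigma>\<in>Sigma_R n P. if \<sigma> \<in> S then 1 else 0) = int (card S)"
  proof -
    have "Sigma_R n P \<inter> S = S"
      by (auto simp: S_def)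
    then show ?thesis
      by (simp add: sum.If_cases)
  qed
  ultimately show "K n P m = (\<Sum>\<sigma>\<in>Sigma_R n P. fund (comp_of n (descents n \<sigma>))) m"
    by (simp add: K_def F_def)
qed


section \<open>Complementation and reversal of linear extensions\<close>

lemma partial_order_bar:
  assumes "partial_order_on {1..n} P"
  shows "partial_order_on {1..n} (poset_bar n P)"
proof -
  have "P \<subseteq> {1..n} \<times> {1..n}" "refl_on {1..n} P" "trans P" "antisym P"
    using assms by (auto simp: partial_order_on_def preorder_on_def)
  have "n + 1 - u \<in> {1..n}" if "u \<in> {1..n}" for u
    using that by auto
  then have "refl_on {1..n} (poset_bar n P)"
    using \<open>refl_on {1..n} P\<close> by (auto simp: refl_on_def poset_bar_def)
  moreover have "trans (poset_bar n P)"
    using \<open>trans P\<close> unfolding trans_def poset_bar_def by blast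
  moreover have "antisym (poset_bar n P)"
  proof (rule antisymI)
    fix u v
    assume uv: "(u, v) \<in> poset_bar n P" "(v, u) \<in> poset_bar n P"
    then have "n + 1 - u = n + 1 - v"
      using \<open>antisym P\<close> by (auto simp: poset_bar_def dest: antisymD)
    with uv show "u = v"
      by (auto simp: poset_bar_def)
  qed
  ultimately show ?thesis
    by (auto simp: partial_order_on_def preorder_on_def poset_bar_def)
qed

lemma partial_order_star:
  "partial_order_on A P \<Longrightarrow> partial_order_on A (poset_star P)"
  by (simp add: poset_star_def)

lemma poset_bar_bar:
  assumes "partial_order_on {1..n} P"
  shows "poset_bar n (poset_bar n P) = P"
proof -
  have "P \<subseteq> {1..n} \<times> {1..n}"
    using assms by (auto simp: partial_order_on_def preorder_on_def)
  moreover have "n + 1 - u \<in> {1..n}" "n + 1 - (n + 1 - u) = u" if "u \<in> {1..n}" for u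
    using that by auto
  ultimately show ?thesis
    unfolding poset_bar_def by auto
qed

lemma longest_perm_permutes: "longest_perm n permutes {1..n}"
proof (rule bij_imp_permutes)
  show "bij_betw (longest_perm n) {1..n} {1..n}"
    by (rule bij_betw_byWitness[of _ "longest_perm n"]) (auto simp: longest_perm_def)
qed (auto simp: longest_perm_def)

lemma longest_perm_twice [simp]: "longest_perm n (longest_perm n i) = i"
  by (auto simp: longest_perm_def)

lemma inv_longest_perm [simp]: "inv (longest_perm n) = longest_perm n"
  by (rule inv_equality) auto

lemma longest_perm_less_iff:
  "i \<in> {1..n} \<Longrightarrow> j \<in> {1..n} \<Longrightarrow> longest_perm n i < longest_perm n j \<longleftrightarrow> j < i"
  by (auto simp: longest_perm_def)

lemma poset_bar_iff:
  assumes "partial_order_on {1..n} P"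
  shows "(u, v) \<in> poset_bar n P \<longleftrightarrow> (longest_perm n u, longest_perm n v) \<in> P"
proof -
  have "P \<subseteq> {1..n} \<times> {1..n}"
    using assms by (auto simp: partial_order_on_def preorder_on_def)
  then show ?thesis
    by (auto simp: poset_bar_def longest_perm_def)
qed

lemma inv_comp_permutes:
  "p permutes S \<Longrightarrow> q permutes T \<Longrightarrow> inv (p \<circ> q) = inv q \<circ> inv p"
  by (simp add: o_inv_distrib permutes_bij)

text \<open>A linear extension is the word \<sigma> of poset elements and
  \<open>inv \<sigma>\<close> gives their positions, so relabelling the poset acts on the values, by
  left multiplication.\<close>

lemma Sigma_R_bar_aux:
  assumes P: "partial_order_on {1..n} P" and \<sigma>: "\<sigma> \<in> Sigma_R n P"
  shows "longest_perm n \<circ> \<sigma> \<in> Sigma_R n (poset_bar n P)"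
proof -
  have perm: "\<sigma> permutes {1..n}"
    using \<sigma> by (simp add: Sigma_R_def)
  have "inv (longest_perm n \<circ> \<sigma>) i < inv (longest_perm n \<circ> \<sigma>) j"
    if "(i, j) \<in> poset_bar n P" "i \<noteq> j" for i j
  proof -
    have "longest_perm n i \<noteq> longest_perm n j"
      using that(2) by (metis longest_perm_twice)
    moreover have "(longest_perm n i, longest_perm n j) \<in> P"
      using that(1) poset_bar_iff[OF P] by simp
    ultimately show ?thesis
      using \<sigma> by (auto simp: Sigma_R_def inv_comp_permutes[OF longest_perm_permutes perm])
  qed
  then show ?thesis
    using permutes_compose[OF perm longest_perm_permutes] by (auto simp: Sigma_R_def)
qed

lemma Sigma_R_bar:
  assumes P: "partial_order_on {1..n} P"
  shows "bij_betw (\<lambda>\<sigma>. longest_perm n \<circ> \<sigma>) (Sigma_R n P) (Sigma_R n (poset_bar n P))"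
  using Sigma_R_bar_aux[OF P] Sigma_R_bar_aux[OF partial_order_bar[OF P]] poset_bar_bar[OF P]
  by (intro bij_betw_byWitness[of _ "\<lambda>\<sigma>. longest_perm n \<circ> \<sigma>"]) (auto simp: fun_eq_iff)

text \<open>Reversing the poset reverses the word, which acts on the positions, by right
  multiplication.\<close>

lemma Sigma_R_star_aux:
  assumes P: "partial_order_on {1..n} P" and \<sigma>: "\<sigma> \<in> Sigma_R n P"
  shows "\<sigma> \<circ> longest_perm n \<in> Sigma_R n (poset_star P)"
proof -
  have perm: "\<sigma> permutes {1..n}"
    using \<sigma> by (simp add: Sigma_R_def)
  have "inv (\<sigma> \<circ> longest_perm n) i < inv (\<sigma> \<circ> longest_perm n) j"
    if "(i, j) \<in> poset_star P" "i \<noteq> j" for i j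
  proof -
    have "(j, i) \<in> P" "i \<in> {1..n}" "j \<in> {1..n}"
      using that P by (auto simp: poset_star_def partial_order_on_def preorder_on_def)
    moreover from this have "inv \<sigma> i \<in> {1..n}" "inv \<sigma> j \<in> {1..n}" "inv \<sigma> j < inv \<sigma> i"
      using \<sigma> that permutes_in_image[OF permutes_inv[OF perm]] by (auto simp: Sigma_R_def)
    ultimately show ?thesis
      by (simp add: inv_comp_permutes[OF perm longest_perm_permutes] longest_perm_less_iff)
  qed
  then show ?thesis
    using permutes_compose[OF longest_perm_permutes perm] by (auto simp: Sigma_R_def)
qed

lemma Sigma_R_star:
  assumes P: "partial_order_on {1..n} P"
  shows "bij_betw (\<lambda>\<sigma>. \<sigma> \<circ> longest_perm n) (Sigma_R n P) (Sigma_R n (poset_star P))"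
proof (rule bij_betw_byWitness[of _ "\<lambda>\<sigma>. \<sigma> \<circ> longest_perm n"])
  show "(\<lambda>\<sigma>. \<sigma> \<circ> longest_perm n) ` Sigma_R n (poset_star P) \<subseteq> Sigma_R n P"
    using Sigma_R_star_aux[OF partial_order_star[OF P]] by (auto simp: poset_star_def)
qed (use Sigma_R_star_aux[OF P] in \<open>auto simp: fun_eq_iff\<close>)

lemma descents_longest_left:
  assumes \<sigma>: "\<sigma> permutes {1..n}"
  shows "descents n (longest_perm n \<circ> \<sigma>) = {1..<n} - descents n \<sigma>"
proof -
  have "\<sigma> i \<in> {1..n}" "\<sigma> (Suc i) \<in> {1..n}" "\<sigma> i \<noteq> \<sigma> (Suc i)" if "i \<in> {1..<n}" for i
    using that permutes_in_image[OF \<sigma>] permutes_inj[OF \<sigma>] by (auto simp: inj_eq)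
  then have "i \<in> descents n (longest_perm n \<circ> \<sigma>) \<longleftrightarrow> i \<notin> descents n \<sigma>" if "i \<in> {1..<n}" for i
    using that by (force simp: descents_def longest_perm_less_iff)
  then show ?thesis
    using descents_subset by blast
qed

text \<open>The reversed word compares the same neighbours in the opposite order: position i
  corresponds to the old position n - i, so descents are complemented and reflected.\<close>

lemma descents_longest_right:
  assumes \<sigma>: "\<sigma> permutes {1..n}"
  shows "descents n (\<sigma> \<circ> longest_perm n) = (\<lambda>i. n - i) ` ({1..<n} - descents n \<sigma>)"
proof -
  have *: "i \<in> descents n (\<sigma> \<circ> longest_perm n) \<longleftrightarrow> n - i \<in> {1..<n} - descents n \<sigma>"
    if i: "i \<in> {1..<n}" for i
  proof -
    have "longest_perm n i = Suc (n - i)" "longest_perm n (Suc i) = n - i" "n - i \<in> {1..<n}"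
      using i by (auto simp: longest_perm_def)
    moreover have "\<sigma> (Suc (n - i)) \<noteq> \<sigma> (n - i)"
      using permutes_inj[OF \<sigma>] by (simp add: inj_eq)
    ultimately show ?thesis
      using i by (auto simp: descents_def)
  qed
  show ?thesis
  proof (intro equalityI subsetI)
    fix i
    assume i: "i \<in> descents n (\<sigma> \<circ> longest_perm n)"
    then have "i \<in> {1..<n}"
      using descents_subset by blast
    with i * have "n - i \<in> {1..<n} - descents n \<sigma>" "i = n - (n - i)"
      by auto
    then show "i \<in> (\<lambda>i. n - i) ` ({1..<n} - descents n \<sigma>)"
      by blast
  next
    fix i
    assume "i \<in> (\<lambda>i. n - i) ` ({1..<n} - descents n \<sigma>)"
    then obtain j where j: "i = n - j" "j \<in> {1..<n} - descents n \<sigma>"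
      by blast
    then have "i \<in> {1..<n}" "n - i = j"
      by auto
    with j *[of i] show "i \<in> descents n (\<sigma> \<circ> longest_perm n)"
      by simp
  qed
qed

text \<open>The double sum over posets and linear extensions is flattened to one indexed sum of
  fundamental functions, the form in which \<open>fund_linear_sum\<close> applies.\<close>

lemma fund_linear_sum_K:
  assumes "finite I" "\<forall>V\<in>I. partial_order_on {1..n} (P V)"
  shows "fund_linear \<phi> (\<Sum>V\<in>I. K n (P V)) =
    (\<Sum>V\<in>I. \<Sum>\<sigma>\<in>Sigma_R n (P V). fund (\<phi> (comp_of n (descents n \<sigma>))))"
proof -
  let ?S = "Sigma I (\<lambda>V. Sigma_R n (P V))"
  have Sigma: "(\<Sum>V\<in>I. \<Sum>\<sigma>\<in>Sigma_R n (P V). g \<sigma>) = (\<Sum>x\<in>?S. g (snd x))" for g :: "_ \<Rightarrow> series"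
    using assms(1) by (simp add: sum.Sigma split_def)
  have "(\<Sum>V\<in>I. K n (P V)) = (\<Sum>V\<in>I. \<Sum>\<sigma>\<in>Sigma_R n (P V). fund (comp_of n (descents n \<sigma>)))"
    using assms(2) by (intro sum.cong refl K_eq_sum_fund) blast
  also have "\<dots> = (\<Sum>x\<in>?S. fund (comp_of n (descents n (snd x))))"
    by (rule Sigma)
  finally have "fund_linear \<phi> (\<Sum>V\<in>I. K n (P V)) =
    fund_linear \<phi> (\<Sum>x\<in>?S. fund (comp_of n (descents n (snd x))))"
    by (rule arg_cong)
  also have "\<dots> = (\<Sum>x\<in>?S. fund (\<phi> (comp_of n (descents n (snd x)))))"
  proof (rule fund_linear_sum)
    show "finite ?S"
      using assms(1) by simp
    show "0 \<notin> set (comp_of n (descents n (snd x)))" for x :: "'a \<times> (nat \<Rightarrow> nat)"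
      using comp_of_composition[OF descents_subset[of n "snd x"]] by (simp add: composition_def)
  qed
  also have "\<dots> = (\<Sum>V\<in>I. \<Sum>\<sigma>\<in>Sigma_R n (P V). fund (\<phi> (comp_of n (descents n \<sigma>))))"
    by (rule Sigma[symmetric])
  finally show ?thesis .
qed

theorem qsym_psi_sum_K:
  assumes "finite I" "\<forall>V\<in>I. partial_order_on {1..n} (P V)"
  shows "qsym_psi (\<Sum>V\<in>I. K n (P V)) = (\<Sum>V\<in>I. K n (poset_bar n (P V)))"
  unfolding qsym_psi_def fund_linear_sum_K[where I = I and n = n and P = P, OF assms]
proof (rule sum.cong[OF refl])
  fix V
  assume "V \<in> I"
  with assms have P: "partial_order_on {1..n} (P V)"
    by blast
  show "(\<Sum>\<sigma>\<in>Sigma_R n (P V). fund (comp_compl (comp_of n (descents n \<sigma>)))) = K n (poset_bar n (P V))"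
    unfolding K_eq_sum_fund[OF partial_order_bar[OF P]] sum.reindex_bij_betw[OF Sigma_R_bar[OF P], symmetric]
  proof (rule sum.cong[OF refl])
    fix \<sigma>
    assume "\<sigma> \<in> Sigma_R n (P V)"
    then show "fund (comp_compl (comp_of n (descents n \<sigma>))) =
      fund (comp_of n (descents n (longest_perm n \<circ> \<sigma>)))"
      by (simp add: Sigma_R_def descents_longest_left comp_compl_comp_of[OF descents_subset])
  qed
qed

theorem qsym_rho_sum_K:
  assumes "finite I" "\<forall>V\<in>I. partial_order_on {1..n} (P V)"
  shows "qsym_rho (\<Sum>V\<in>I. K n (P V)) = (\<Sum>V\<in>I. K n (poset_star (poset_bar n (P V))))"
  unfolding qsym_rho_def fund_linear_sum_K[where I = I and n = n and P = P, OF assms]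
proof (rule sum.cong[OF refl])
  fix V
  assume "V \<in> I"
  with assms have P: "partial_order_on {1..n} (P V)"
    by blast
  have bij: "bij_betw (\<lambda>\<sigma>. (longest_perm n \<circ> \<sigma>) \<circ> longest_perm n)
    (Sigma_R n (P V)) (Sigma_R n (poset_star (poset_bar n (P V))))"
    using bij_betw_trans[OF Sigma_R_bar[OF P] Sigma_R_star[OF partial_order_bar[OF P]]]
    by (simp add: comp_def)
  show "(\<Sum>\<sigma>\<in>Sigma_R n (P V). fund (rev (comp_of n (descents n \<sigma>)))) =
    K n (poset_star (poset_bar n (P V)))"
    unfolding K_eq_sum_fund[OF partial_order_star[OF partial_order_bar[OF P]]]
      sum.reindex_bij_betw[OF bij, symmetric]
  proof (rule sum.cong[OF refl])
    fix \<sigma>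
    assume "\<sigma> \<in> Sigma_R n (P V)"
    then have \<sigma>: "\<sigma> permutes {1..n}"
      by (simp add: Sigma_R_def)
    \<comment> \<open>Both multiplications complement the descent set; the two complements cancel
      and only the reflection, which reverses the composition, remains.\<close>
    have "descents n ((longest_perm n \<circ> \<sigma>) \<circ> longest_perm n) = (\<lambda>i. n - i) ` descents n \<sigma>"
      unfolding descents_longest_right[OF permutes_compose[OF \<sigma> longest_perm_permutes]]
        descents_longest_left[OF \<sigma>]
      using descents_subset[of n \<sigma>] by (simp add: double_diff)
    then show "fund (rev (comp_of n (descents n \<sigma>))) =
      fund (comp_of n (descents n ((longest_perm n \<circ> \<sigma>) \<circ> longest_perm n)))"
      by (simp only: rev_comp_of[OF descents_subset])
  qed
qed

section \<open>Posets of intervals of readings\<close>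

text \<open>For permutations as end points this is the left weak interval, by
  \<open>left_interval_eq\<close>; comparisons of inversion sets replace chains of covers.\<close>

definition weak_between :: "nat \<Rightarrow> (nat \<Rightarrow> nat) \<Rightarrow> (nat \<Rightarrow> nat) \<Rightarrow> (nat \<Rightarrow> nat) set" where
  "weak_between n \<sigma> \<rho> = {\<gamma>. \<gamma> permutes {1..n} \<and>
    inversions n \<sigma> \<subseteq> inversions n \<gamma> \<and> inversions n \<gamma> \<subseteq> inversions n \<rho>}"

lemma Sigma_R_iff:
  "\<sigma> \<in> Sigma_R n P \<longleftrightarrow>
    \<sigma> permutes {1..n} \<and> (\<forall>i j. (i, j) \<in> P \<longrightarrow> i \<noteq> j \<longrightarrow> inv \<sigma> i < inv \<sigma> j)"
  by (auto simp: Sigma_R_def)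

text \<open>On positions the interval consists of all permutations compatible with the intersection
  \<open>Q\<close> of the two linear orders given by \<sigma> and \<rho>: a pair ordered alike at
  both ends is squeezed between the two inversion sets. This proves existence; uniqueness comes from
  recovering a poset from its linear extensions.\<close>

lemma interval_poset:
  assumes \<sigma>: "\<sigma> permutes {1..n}" and \<rho>: "\<rho> permutes {1..n}"
    and sub: "inversions n \<sigma> \<subseteq> inversions n \<rho>"
  shows partial_order_interval_poset: "partial_order_on {1..n} (interval_poset n \<sigma> \<rho>)"
    and Sigma_R_interval_poset:
      "Sigma_R n (interval_poset n \<sigma> \<rho>) = (\<lambda>\<gamma>. longest_perm n \<circ> inv \<gamma>) ` weak_between n \<sigma> \<rho>"
proof -
  define Q where "Q = {(a, b). a \<in> {1..n} \<and> b \<in> {1..n} \<and> \<sigma> a \<le> \<sigma> b \<and> \<rho> a \<le> \<rho> b}"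
  have Q_iff: "(a, b) \<in> Q \<longleftrightarrow> a \<in> {1..n} \<and> b \<in> {1..n} \<and> \<sigma> a \<le> \<sigma> b \<and> \<rho> a \<le> \<rho> b" for a b
    by (simp add: Q_def)
  have inversions_iff: "(a, b) \<in> inversions n \<gamma> \<longleftrightarrow>
    a \<in> {1..n} \<and> b \<in> {1..n} \<and> a < b \<and> \<gamma> b < \<gamma> a" for a b \<gamma>
    by (simp add: inversions_def)
  have Q: "partial_order_on {1..n} Q"
    unfolding partial_order_on_def preorder_on_def
  proof (intro conjI)
    show "antisym Q"
    proof (rule antisymI)
      fix a b
      assume "(a, b) \<in> Q" "(b, a) \<in> Q"
      then have "\<sigma> a = \<sigma> b"
        by (simp add: Q_def)
      then show "a = b"
        using permutes_inj[OF \<sigma>] by (simp add: inj_eq)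
    qed
    show "trans Q"
      by (rule transI) (simp add: Q_def)
  qed (auto simp: Q_def refl_on_def)
  have between: "\<gamma> \<in> weak_between n \<sigma> \<rho> \<longleftrightarrow> (\<forall>a b. (a, b) \<in> Q \<longrightarrow> a \<noteq> b \<longrightarrow> \<gamma> a < \<gamma> b)"
    if \<gamma>: "\<gamma> permutes {1..n}" for \<gamma>
  proof
    assume "\<gamma> \<in> weak_between n \<sigma> \<rho>"
    then have incl: "inversions n \<sigma> \<subseteq> inversions n \<gamma>" "inversions n \<gamma> \<subseteq> inversions n \<rho>"
      by (auto simp: weak_between_def)
    have "\<gamma> a < \<gamma> b" if "(a, b) \<in> Q" "a \<noteq> b" for a b
    proof -
      have ab: "a \<in> {1..n}" "b \<in> {1..n}" "\<sigma> a \<le> \<sigma> b" "\<rho> a \<le> \<rho> b"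
        using that(1) by (auto simp: Q_def)
      have ne: "\<sigma> a \<noteq> \<sigma> b" "\<gamma> a \<noteq> \<gamma> b"
        using that(2) permutes_inj[OF \<sigma>] permutes_inj[OF \<gamma>] by (auto dest: injD)
      show ?thesis
      proof (cases "a < b")
        case True
        show ?thesis
        proof (rule ccontr)
          assume "\<not> \<gamma> a < \<gamma> b"
          with ne have "\<gamma> b < \<gamma> a"
            by simp
          with True ab have "(a, b) \<in> inversions n \<gamma>"
            by (simp add: inversions_def)
          with incl have "(a, b) \<in> inversions n \<rho>"
            by blast
          with ab show False
            by (simp add: inversions_def)
        qed
      next
        case False
        with that(2) ab ne have "(b, a) \<in> inversions n \<sigma>"
          by (simp add: inversions_def)
        with incl have "(b, a) \<in> inversions n \<gamma>"
          by blast
        then show ?thesis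
          by (simp add: inversions_def)
      qed
    qed
    then show "\<forall>a b. (a, b) \<in> Q \<longrightarrow> a \<noteq> b \<longrightarrow> \<gamma> a < \<gamma> b"
      by blast
  next
    assume *: "\<forall>a b. (a, b) \<in> Q \<longrightarrow> a \<noteq> b \<longrightarrow> \<gamma> a < \<gamma> b"
    have "(a, b) \<in> inversions n \<gamma>" if "(a, b) \<in> inversions n \<sigma>" for a b
    proof -
      have "(a, b) \<in> inversions n \<rho>"
        using that sub by blast
      with that have "(b, a) \<in> Q" "b \<noteq> a"
        unfolding inversions_iff Q_iff by (auto intro: less_imp_le)
      with * have "\<gamma> b < \<gamma> a"
        by blast
      with that show ?thesis
        by (simp add: inversions_def)
    qed
    moreover have "(a, b) \<in> inversions n \<rho>" if "(a, b) \<in> inversions n \<gamma>" for a b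
    proof (rule ccontr)
      assume "(a, b) \<notin> inversions n \<rho>"
      moreover from this have "(a, b) \<notin> inversions n \<sigma>"
        using sub by blast
      ultimately have "(a, b) \<in> Q" "a \<noteq> b"
        using that unfolding inversions_iff Q_iff by (auto intro: leI)
      with * have "\<gamma> a < \<gamma> b"
        by blast
      with that show False
        by (simp add: inversions_def)
    qed
    ultimately show "\<gamma> \<in> weak_between n \<sigma> \<rho>"
      using \<gamma> by (auto simp: weak_between_def)
  qed
  let ?w = "longest_perm n"
  \<comment> \<open>The inverse of \<open>?w \<circ> inv \<gamma>\<close> is
    \<open>\<gamma> \<circ> ?w\<close>, so the required inequalities are those of \<open>Q\<close>
    with both arguments reflected; hence the bar.\<close>
  have mem: "?w \<circ> inv \<gamma> \<in> Sigma_R n (poset_bar n Q) \<longleftrightarrow> \<gamma> \<in> weak_between n \<sigma> \<rho>"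
    if \<gamma>: "\<gamma> permutes {1..n}" for \<gamma>
  proof -
    have inv: "inv (?w \<circ> inv \<gamma>) = \<gamma> \<circ> ?w"
      using inv_comp_permutes[OF longest_perm_permutes permutes_inv[OF \<gamma>]]
      by (simp add: permutes_inv_inv[OF \<gamma>])
    have perm: "?w \<circ> inv \<gamma> permutes {1..n}"
      by (intro permutes_compose permutes_inv \<gamma> longest_perm_permutes)
    have "(\<forall>i j. (i, j) \<in> poset_bar n Q \<longrightarrow> i \<noteq> j \<longrightarrow> \<gamma> (?w i) < \<gamma> (?w j)) \<longleftrightarrow>
      (\<forall>a b. (a, b) \<in> Q \<longrightarrow> a \<noteq> b \<longrightarrow> \<gamma> a < \<gamma> b)"
      (is "?L \<longleftrightarrow> ?R")
    proof -
      have ne: "?w i \<noteq> ?w j" if "i \<noteq> j" for i j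
        using that longest_perm_twice by metis
      have "?R" if L: "?L"
      proof -
        have "\<gamma> a < \<gamma> b" if "(a, b) \<in> Q" "a \<noteq> b" for a b
        proof -
          have "(?w a, ?w b) \<in> poset_bar n Q"
            using that(1) unfolding poset_bar_iff[OF Q] longest_perm_twice .
          with L ne[OF that(2)] have "\<gamma> (?w (?w a)) < \<gamma> (?w (?w b))"
            by blast
          then show ?thesis
            by simp
        qed
        then show ?thesis
          by blast
      qed
      moreover have "?L" if ?R
      proof -
        have "\<gamma> (?w i) < \<gamma> (?w j)" if "(i, j) \<in> poset_bar n Q" "i \<noteq> j" for i j
          using \<open>?R\<close> that(1) ne[OF that(2)] unfolding poset_bar_iff[OF Q] by blast
        then show ?thesis
          by blast
      qed
      ultimately show ?thesis
        by blast
    qed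
    then show ?thesis
      unfolding between[OF \<gamma>] using perm by (simp add: Sigma_R_iff inv)
  qed
  have "Sigma_R n (poset_bar n Q) = (\<lambda>\<gamma>. ?w \<circ> inv \<gamma>) ` weak_between n \<sigma> \<rho>"
  proof (intro equalityI subsetI)
    fix \<tau>
    assume \<tau>: "\<tau> \<in> Sigma_R n (poset_bar n Q)"
    then have perm: "\<tau> permutes {1..n}"
      by (simp add: Sigma_R_def)
    have "inv \<tau> \<circ> ?w permutes {1..n}"
      by (intro permutes_compose permutes_inv perm longest_perm_permutes)
    moreover have "?w \<circ> inv (inv \<tau> \<circ> ?w) = \<tau>"
      using inv_comp_permutes[OF permutes_inv[OF perm] longest_perm_permutes]
      by (simp add: permutes_inv_inv[OF perm] fun_eq_iff)
    ultimately show "\<tau> \<in> (\<lambda>\<gamma>. ?w \<circ> inv \<gamma>) ` weak_between n \<sigma> \<rho>"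
      using mem[of "inv \<tau> \<circ> ?w"] \<tau> by (intro image_eqI[of _ _ "inv \<tau> \<circ> ?w"]) simp_all
  next
    fix \<tau>
    assume "\<tau> \<in> (\<lambda>\<gamma>. ?w \<circ> inv \<gamma>) ` weak_between n \<sigma> \<rho>"
    then show "\<tau> \<in> Sigma_R n (poset_bar n Q)"
      using mem by (auto simp: weak_between_def)
  qed
  moreover have "{?w \<circ> inv \<gamma> | \<gamma>. \<gamma> \<in> left_interval n \<sigma> \<rho>} = (\<lambda>\<gamma>. ?w \<circ> inv \<gamma>) ` weak_between n \<sigma> \<rho>"
    unfolding left_interval_eq[OF \<sigma> \<rho>] weak_between_def by blast
  moreover note partial_order_bar[OF Q]
  ultimately have bar: "partial_order_on {1..n} (poset_bar n Q) \<and>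
    Sigma_R n (poset_bar n Q) = {?w \<circ> inv \<gamma> | \<gamma>. \<gamma> \<in> left_interval n \<sigma> \<rho>}"
    by simp
  have "interval_poset n \<sigma> \<rho> = poset_bar n Q"
    unfolding interval_poset_def
  proof (rule the_equality, rule bar)
    fix P
    assume "partial_order_on {1..n} P \<and>
      Sigma_R n P = {?w \<circ> inv \<gamma> | \<gamma>. \<gamma> \<in> left_interval n \<sigma> \<rho>}"
    with bar show "P = poset_bar n Q"
      using partial_order_Sigma_R_inject[of n P "poset_bar n Q"] by simp
  qed
  with bar \<open>{?w \<circ> inv \<gamma> | \<gamma>. \<gamma> \<in> left_interval n \<sigma> \<rho>} = _\<close>
  show "partial_order_on {1..n} (interval_poset n \<sigma> \<rho>)"
    "Sigma_R n (interval_poset n \<sigma> \<rho>) = (\<lambda>\<gamma>. ?w \<circ> inv \<gamma>) ` weak_between n \<sigma> \<rho>"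
    by simp_all
qed

text \<open>Left multiplication by the longest element complements the descents of
  \<open>inv \<gamma>\<close>, leaving those i whose position precedes that of i + 1.\<close>

lemma K_interval_poset:
  assumes "\<sigma> permutes {1..n}" "\<rho> permutes {1..n}" "inversions n \<sigma> \<subseteq> inversions n \<rho>"
  shows "K n (interval_poset n \<sigma> \<rho>) =
    (\<Sum>\<gamma>\<in>weak_between n \<sigma> \<rho>. fund (comp_of n {i \<in> {1..<n}. inv \<gamma> i < inv \<gamma> (Suc i)}))"
proof -
  have inj: "inj_on (\<lambda>\<gamma>. longest_perm n \<circ> inv \<gamma>) (weak_between n \<sigma> \<rho>)"
  proof (rule inj_onI)
    fix \<gamma> \<delta>
    assume *: "\<gamma> \<in> weak_between n \<sigma> \<rho>" "\<delta> \<in> weak_between n \<sigma> \<rho>"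
      "longest_perm n \<circ> inv \<gamma> = longest_perm n \<circ> inv \<delta>"
    then have "longest_perm n (longest_perm n (inv \<gamma> x)) = longest_perm n (longest_perm n (inv \<delta> x))" for x
      by (simp add: fun_eq_iff)
    then have "inv \<gamma> = inv \<delta>"
      by (simp add: fun_eq_iff)
    then show "\<gamma> = \<delta>"
      using * by (metis (mono_tags, lifting) mem_Collect_eq permutes_inv_inv weak_between_def)
  qed
  have "descents n (longest_perm n \<circ> inv \<gamma>) = {i \<in> {1..<n}. inv \<gamma> i < inv \<gamma> (Suc i)}"
    if "\<gamma> \<in> weak_between n \<sigma> \<rho>" for \<gamma>
  proof -
    have \<gamma>: "inv \<gamma> permutes {1..n}"
      using that by (auto simp: weak_between_def intro: permutes_inv)
    have "inv \<gamma> i \<noteq> inv \<gamma> (Suc i)" for i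
      using permutes_inj[OF \<gamma>] by (simp add: inj_eq)
    then have "\<not> inv \<gamma> (Suc i) < inv \<gamma> i \<longleftrightarrow> inv \<gamma> i < inv \<gamma> (Suc i)" for i
      by (metis not_less_iff_gr_or_eq)
    then show ?thesis
      unfolding descents_longest_left[OF \<gamma>] unfolding descents_def by blast
  qed
  then show ?thesis
    unfolding K_eq_sum_fund[OF partial_order_interval_poset[OF assms]] Sigma_R_interval_poset[OF assms]
      sum.reindex[OF inj] by (intro sum.cong) auto
qed

section \<open>Fillings as an interval of words along a reading order\<close>

lemma sorted_wrt_asym_nth_iff:
  assumes "sorted_wrt R xs" "\<And>a b. a \<in> set xs \<Longrightarrow> b \<in> set xs \<Longrightarrow> R a b \<Longrightarrow> \<not> R b a"
    "i < length xs" "j < length xs"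
  shows "R (xs ! i) (xs ! j) \<longleftrightarrow> i < j"
proof -
  have "\<not> R (xs ! i) (xs ! i)"
    using assms(2)[of "xs ! i" "xs ! i"] assms(3) by auto
  moreover have "\<not> R (xs ! i) (xs ! j)" if "j < i"
    using sorted_wrt_nth_less[OF assms(1) that assms(3)] assms(2)[of "xs ! j" "xs ! i"] assms(3,4) by simp
  moreover have "R (xs ! i) (xs ! j)" if "i < j"
    using sorted_wrt_nth_less[OF assms(1) that assms(4)] .
  ultimately show ?thesis
    by (cases i j rule: linorder_cases) auto
qed

lemma sorted_wrt_asym_distinct:
  assumes "sorted_wrt R xs" "\<And>a b. a \<in> set xs \<Longrightarrow> b \<in> set xs \<Longrightarrow> R a b \<Longrightarrow> \<not> R b a"
  shows "distinct xs"
  unfolding distinct_conv_nth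
proof (intro allI impI)
  fix i j
  assume ij: "i < length xs" "j < length xs" "i \<noteq> j"
  then consider "R (xs ! i) (xs ! j)" | "R (xs ! j) (xs ! i)"
    using sorted_wrt_asym_nth_iff[OF assms ij(1,2)] sorted_wrt_asym_nth_iff[OF assms ij(2,1)] by linarith
  then show "xs ! i \<noteq> xs ! j"
    using assms(2)[of "xs ! i" "xs ! i"] ij by cases auto
qed

text \<open>Fillings \<open>E\<close> of the boxes \<open>bs\<close>, read in the order of the list,
  with \<sigma> and \<rho> as the ends of the interval. \<open>lower\<close> and
  \<open>upper\<close> are the two containments of inversion sets and place every word of
  \<open>E\<close> in the interval; \<open>closed\<close> returns every permutation of the interval
  to \<open>E\<close>. That \<open>before\<close> is linear on the boxes comes from the sorted
  list.\<close>

locale reading_interval =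
  fixes n :: nat and bs :: "'b list" and before :: "'b \<Rightarrow> 'b \<Rightarrow> bool"
    and E :: "('b \<Rightarrow> nat) set" and \<sigma> \<rho> :: "'b \<Rightarrow> nat"
  assumes sorted: "sorted_wrt before bs"
    and asym: "a \<in> set bs \<Longrightarrow> b \<in> set bs \<Longrightarrow> before a b \<Longrightarrow> \<not> before b a"
    and bij: "T \<in> E \<Longrightarrow> bij_betw T (set bs) {1..n}"
    and ext: "T \<in> E \<Longrightarrow> T \<in> extensional (set bs)"
    and min_in: "\<sigma> \<in> E" and max_in: "\<rho> \<in> E"
    and closed: "T \<in> extensional (set bs) \<Longrightarrow> bij_betw T (set bs) {1..n} \<Longrightarrow>
      (\<And>a b. a \<in> set bs \<Longrightarrow> b \<in> set bs \<Longrightarrow> \<sigma> a < \<sigma> b \<Longrightarrow> \<rho> a < \<rho> b \<Longrightarrow> T a < T b) \<Longrightarrow> T \<in> E"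
    and lower: "T \<in> E \<Longrightarrow> a \<in> set bs \<Longrightarrow> b \<in> set bs \<Longrightarrow> before a b \<Longrightarrow> \<sigma> b < \<sigma> a \<Longrightarrow> T b < T a"
    and upper: "T \<in> E \<Longrightarrow> a \<in> set bs \<Longrightarrow> b \<in> set bs \<Longrightarrow> before a b \<Longrightarrow> T b < T a \<Longrightarrow> \<rho> b < \<rho> a"
begin

definition box_at :: "nat \<Rightarrow> 'b" where
  "box_at i = bs ! (i - 1)"

abbreviation word :: "('b \<Rightarrow> nat) \<Rightarrow> nat \<Rightarrow> nat" where
  "word T \<equiv> perm_of_word (map T bs)"

lemma distinct: "distinct bs"
  using sorted asym by (rule sorted_wrt_asym_distinct)

lemma length_bs: "length bs = n"
  using bij_betw_same_card[OF bij[OF min_in]] distinct_card[OF distinct] by simp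

lemma box_at_bij: "bij_betw box_at {1..n} (set bs)"
proof -
  have "bij_betw (\<lambda>i. i - 1) {1..n} {..<n}"
    by (rule bij_betw_byWitness[of _ Suc]) auto
  from bij_betw_trans[OF this bij_betw_nth[OF distinct, of "{..<n}" "set bs"]] show ?thesis
    using length_bs by (simp add: box_at_def[abs_def] comp_def)
qed

lemma box_at_in: "i \<in> {1..n} \<Longrightarrow> box_at i \<in> set bs"
  using box_at_bij by (auto simp: bij_betw_def)

lemma box_at_cases:
  assumes "b \<in> set bs"
  obtains i where "i \<in> {1..n}" "b = box_at i"
  using assms bij_betw_imp_surj_on[OF box_at_bij] by blast

lemma before_box_at_iff:
  assumes ij: "i \<in> {1..n}" "j \<in> {1..n}"
  shows "before (box_at i) (box_at j) \<longleftrightarrow> i < j"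
proof -
  have *: "before (box_at i) (box_at j)" if "i < j" "i \<in> {1..n}" "j \<in> {1..n}" for i j
  proof -
    have "i - 1 < j - 1" "j - 1 < length bs"
      using that length_bs by auto
    then show ?thesis
      unfolding box_at_def by (rule sorted_wrt_nth_less[OF sorted])
  qed
  show ?thesis
    using *[of i j] *[of j i] asym[OF box_at_in box_at_in] ij by (metis linorder_neqE_nat)
qed

lemma word_eq: "i \<in> {1..n} \<Longrightarrow> word T i = T (box_at i)"
  using length_bs by (auto simp: perm_of_word_def box_at_def)

lemma word_permutes: "bij_betw T (set bs) {1..n} \<Longrightarrow> word T permutes {1..n}"
proof (rule bij_imp_permutes)
  assume "bij_betw T (set bs) {1..n}"
  from bij_betw_trans[OF box_at_bij this] show "bij_betw (word T) {1..n} {1..n}"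
    by (rule bij_betw_cong[THEN iffD1, rotated]) (simp add: word_eq)
qed (use length_bs in \<open>auto simp: perm_of_word_def\<close>)

lemma inversions_word:
  "inversions n (word T) = {(i, j). i \<in> {1..n} \<and> j \<in> {1..n} \<and> i < j \<and> T (box_at j) < T (box_at i)}"
  by (auto simp: inversions_def word_eq)

lemma inversions_word_between:
  assumes "T \<in> E"
  shows "inversions n (word \<sigma>) \<subseteq> inversions n (word T)"
    and "inversions n (word T) \<subseteq> inversions n (word \<rho>)"
  using lower[OF assms box_at_in box_at_in] upper[OF assms box_at_in box_at_in] before_box_at_iff
  unfolding inversions_word by blast+

text \<open>\<open>inv (word T)\<close> sends an entry to the reading position of its box, so
  comparing positions of entries is comparing their boxes in reading order.\<close>

lemma inv_word_less_iff:
  assumes T: "T \<in> E" and i: "i \<in> {1..n}" and j: "j \<in> {1..n}"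
  shows "inv (word T) i < inv (word T) j \<longleftrightarrow>
    before (the_inv_into (set bs) T i) (the_inv_into (set bs) T j)"
proof -
  have perm: "word T permutes {1..n}"
    using bij[OF T] by (rule word_permutes)
  have inv_in: "inv (word T) k \<in> {1..n}" if "k \<in> {1..n}" for k
    using permutes_in_image[OF permutes_inv[OF perm]] that by blast
  have "the_inv_into (set bs) T k = box_at (inv (word T) k)" if k: "k \<in> {1..n}" for k
  proof (rule the_inv_into_f_eq)
    show "inj_on T (set bs)"
      using bij[OF T] by (rule bij_betw_imp_inj_on)
    show "T (box_at (inv (word T) k)) = k"
      using word_eq[OF inv_in[OF k], of T] permutes_inverses(1)[OF perm, of k] by simp
    show "box_at (inv (word T) k) \<in> set bs"
      using inv_in[OF k] by (rule box_at_in)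
  qed
  with i j inv_in show ?thesis
    by (simp add: before_box_at_iff)
qed

lemma word_bij: "bij_betw word E (weak_between n (word \<sigma>) (word \<rho>))"
  unfolding bij_betw_def
proof
  show "inj_on word E"
  proof (rule inj_onI)
    fix S T
    assume ST: "S \<in> E" "T \<in> E" "word S = word T"
    show "S = T"
    proof (rule extensionalityI[OF ext[OF ST(1)] ext[OF ST(2)]])
      fix b
      assume "b \<in> set bs"
      then obtain i where "i \<in> {1..n}" "b = box_at i"
        by (rule box_at_cases)
      then show "S b = T b"
        using ST(3) word_eq[of i S] word_eq[of i T] by simp
    qed
  qed
  show "word ` E = weak_between n (word \<sigma>) (word \<rho>)"
  proof (intro equalityI subsetI)
    fix \<gamma>
    assume "\<gamma> \<in> word ` E"
    then show "\<gamma> \<in> weak_between n (word \<sigma>) (word \<rho>)"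
      using inversions_word_between word_permutes bij unfolding weak_between_def by blast
  next
    fix \<gamma>
    assume "\<gamma> \<in> weak_between n (word \<sigma>) (word \<rho>)"
    then have \<gamma>: "\<gamma> permutes {1..n}" "inversions n (word \<sigma>) \<subseteq> inversions n \<gamma>"
      "inversions n \<gamma> \<subseteq> inversions n (word \<rho>)"
      by (auto simp: weak_between_def)
    define T where "T = restrict (\<lambda>b. \<gamma> (the_inv_into {1..n} box_at b)) (set bs)"
    have inj: "inj_on box_at {1..n}"
      using box_at_bij by (rule bij_betw_imp_inj_on)
    have T: "T (box_at i) = \<gamma> i" if "i \<in> {1..n}" for i
      using box_at_in[OF that] the_inv_into_f_f[OF inj that] by (simp add: T_def)
    have "bij_betw (\<gamma> \<circ> the_inv_into {1..n} box_at) (set bs) {1..n}"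
      using bij_betw_trans[OF bij_betw_the_inv_into[OF box_at_bij] permutes_imp_bij[OF \<gamma>(1)]] .
    then have bijT: "bij_betw T (set bs) {1..n}"
      by (rule bij_betw_cong[THEN iffD1, rotated]) (simp add: T_def)
    have word: "word T = \<gamma>"
    proof
      fix i
      show "word T i = \<gamma> i"
        using T word_eq permutes_not_in[OF word_permutes[OF bijT]] permutes_not_in[OF \<gamma>(1)]
        by (cases "i \<in> {1..n}") simp_all
    qed
    have "T \<in> E"
    proof (rule closed[OF _ bijT])
      show "T \<in> extensional (set bs)"
        by (simp add: T_def)
      fix a b
      assume ab: "a \<in> set bs" "b \<in> set bs" "\<sigma> a < \<sigma> b" "\<rho> a < \<rho> b"
      then obtain i j where ij: "i \<in> {1..n}" "a = box_at i" "j \<in> {1..n}" "b = box_at j"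
        using box_at_cases by metis
      have ne: "i \<noteq> j" "\<gamma> i \<noteq> \<gamma> j"
        using ab ij permutes_inj[OF \<gamma>(1)] by (auto dest: injD)
      show "T a < T b"
      \<comment> \<open>A pair of boxes ordered alike by \<sigma> and \<rho> is ordered that way by
        \<gamma>: read forwards it is no inversion of \<rho>, read backwards it is one of
        \<sigma>.\<close>
      proof (cases "i < j")
        case True
        have "(i, j) \<notin> inversions n (word \<rho>)"
          using ab ij by (simp add: inversions_word)
        with \<gamma>(3) have "(i, j) \<notin> inversions n \<gamma>"
          by blast
        with True ij ne T show ?thesis
          by (simp add: inversions_def)
      next
        case False
        with ne have "(j, i) \<in> inversions n (word \<sigma>)"
          using ab ij by (simp add: inversions_word)
        with \<gamma>(2) have "(j, i) \<in> inversions n \<gamma>"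
          by blast
        with ij T show ?thesis
          by (simp add: inversions_def)
      qed
    qed
    with word show "\<gamma> \<in> word ` E"
      by blast
  qed
qed

lemma min_max:
  "word \<sigma> permutes {1..n}" "word \<rho> permutes {1..n}" "inversions n (word \<sigma>) \<subseteq> inversions n (word \<rho>)"
  using word_permutes bij min_in max_in inversions_word_between by blast+

lemma word_poset_eq: "word_poset (map \<sigma> bs) (map \<rho> bs) = interval_poset n (word \<sigma>) (word \<rho>)"
  by (simp add: word_poset_def length_bs)

theorem partial_order_word_poset: "partial_order_on {1..n} (word_poset (map \<sigma> bs) (map \<rho> bs))"
  unfolding word_poset_eq by (rule partial_order_interval_poset[OF min_max])

theorem K_word_poset:
  "K n (word_poset (map \<sigma> bs) (map \<rho> bs)) = (\<Sum>T\<in>E. fund (comp_of n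
    {i \<in> {1..<n}. before (the_inv_into (set bs) T i) (the_inv_into (set bs) T (Suc i))}))"
  unfolding word_poset_eq K_interval_poset[OF min_max] sum.reindex_bij_betw[OF word_bij, symmetric]
proof (rule sum.cong[OF refl])
  fix T
  assume "T \<in> E"
  then have "{i \<in> {1..<n}. inv (word T) i < inv (word T) (Suc i)} =
    {i \<in> {1..<n}. before (the_inv_into (set bs) T i) (the_inv_into (set bs) T (Suc i))}"
    using inv_word_less_iff by auto
  then show "fund (comp_of n {i \<in> {1..<n}. inv (word T) i < inv (word T) (Suc i)}) = fund (comp_of n
    {i \<in> {1..<n}. before (the_inv_into (set bs) T i) (the_inv_into (set bs) T (Suc i))})"
    by simp
qed

end

section \<open>Fillings of composition diagrams\<close>

lemma sorted_wrt_concat_map: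
  assumes "sorted_wrt (\<lambda>x y. \<forall>a\<in>set (f x). \<forall>b\<in>set (f y). R a b) xs"
    and "\<And>x. x \<in> set xs \<Longrightarrow> sorted_wrt R (f x)"
  shows "sorted_wrt R (concat (map f xs))"
  using assms by (induction xs) (auto simp: sorted_wrt_append)

lemma fill_along_nth:
  assumes "distinct bs" "i < length bs"
  shows "fill_along bs (bs ! i) = Suc i"
proof -
  have "takeWhile (\<lambda>x. x \<noteq> bs ! i) bs = take i bs"
    using assms by (intro takeWhile_eq_take_P_nth) (auto simp: nth_eq_iff_index_eq)
  then show ?thesis
    using assms by (simp add: fill_along_def)
qed

lemma fill_along:
  assumes "sorted_wrt R bs" "\<And>a b. a \<in> set bs \<Longrightarrow> b \<in> set bs \<Longrightarrow> R a b \<Longrightarrow> \<not> R b a"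
  shows bij_betw_fill_along: "bij_betw (fill_along bs) (set bs) {1..length bs}"
    and fill_along_less_iff: "a \<in> set bs \<Longrightarrow> b \<in> set bs \<Longrightarrow> fill_along bs a < fill_along bs b \<longleftrightarrow> R a b"
proof -
  have dist: "distinct bs"
    using assms by (rule sorted_wrt_asym_distinct)
  have "fill_along bs ` set bs = {1..length bs}"
  proof -
    have "fill_along bs ` set bs = Suc ` {..<length bs}"
      using fill_along_nth[OF dist] by (force simp: set_conv_nth image_iff)
    then show ?thesis
      by (simp add: image_Suc_lessThan)
  qed
  then show "bij_betw (fill_along bs) (set bs) {1..length bs}"
    using dist by (simp add: bij_betw_def eq_card_imp_inj_on distinct_card)
  show "fill_along bs a < fill_along bs b \<longleftrightarrow> R a b" if "a \<in> set bs" "b \<in> set bs"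
    using that sorted_wrt_asym_nth_iff[OF assms] fill_along_nth[OF dist]
    by (auto simp: in_set_conv_nth)
qed

definition reading_boxes :: "nat list \<Rightarrow> box list" where
  "reading_boxes \<alpha> = [(i, j). i \<leftarrow> [1..<Suc (length \<alpha>)], j \<leftarrow> rev [1..<Suc (part \<alpha> i)]]"

definition V_boxes :: "nat list \<Rightarrow> box list" where
  "V_boxes \<alpha> = [(i, 1). i \<leftarrow> [1..<Suc (length \<alpha>)]] @
    [(i, j). i \<leftarrow> rev [1..<Suc (length \<alpha>)], j \<leftarrow> [2..<Suc (part \<alpha> i)]]"

definition reading_before :: "box \<Rightarrow> box \<Rightarrow> bool" where
  "reading_before a b \<longleftrightarrow> fst a < fst b \<or> fst a = fst b \<and> snd b < snd a"

definition row_before :: "box \<Rightarrow> box \<Rightarrow> bool" where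
  "row_before a b \<longleftrightarrow> fst a < fst b \<or> fst a = fst b \<and> snd a < snd b"

definition column_before :: "box \<Rightarrow> box \<Rightarrow> bool" where
  "column_before a b \<longleftrightarrow> snd a < snd b \<or> snd a = snd b \<and> fst a < fst b"

text \<open>The order of the entries in the maximal immaculate tableau: the first column, then the
  remaining boxes row by row from the bottom upwards.\<close>

definition V_before :: "box \<Rightarrow> box \<Rightarrow> bool" where
  "V_before a b \<longleftrightarrow> (if snd a = 1 then snd b = 1 \<longrightarrow> fst a < fst b
    else snd b \<noteq> 1 \<and> (fst b < fst a \<or> fst a = fst b \<and> snd a < snd b))"

lemma reading_eq: "reading \<alpha> T = map T (reading_boxes \<alpha>)"
  by (simp add: reading_def reading_boxes_def map_concat comp_def)

lemma part_le: "i \<in> {1..length \<alpha>} \<Longrightarrow> part \<alpha> i \<le> sum_list \<alpha>"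
  unfolding part_def by (intro elem_le_sum_list) auto

lemma mem_cd [simp]: "(i, j) \<in> cd \<alpha> \<longleftrightarrow> i \<in> {1..length \<alpha>} \<and> j \<in> {1..part \<alpha> i}"
  by (simp add: cd_def)

lemma set_reading_boxes: "set (reading_boxes \<alpha>) = cd \<alpha>"
  by (auto simp: reading_boxes_def cd_def image_iff less_Suc_eq_le simp del: upt_Suc)

lemma set_row_boxes: "set (row_boxes \<alpha>) = cd \<alpha>"
  by (auto simp: row_boxes_def cd_def image_iff less_Suc_eq_le simp del: upt_Suc)

lemma set_column_boxes: "set (column_boxes \<alpha>) = cd \<alpha>"
proof -
  have "(i, j) \<in> set (column_boxes \<alpha>) \<longleftrightarrow> (i, j) \<in> cd \<alpha>" for i j
    using part_le[of i \<alpha>] by (auto simp: column_boxes_def simp del: upt_Suc)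
  then show ?thesis
    by auto
qed

lemma set_V_boxes:
  assumes "0 \<notin> set \<alpha>"
  shows "set (V_boxes \<alpha>) = cd \<alpha>"
proof -
  have "1 \<le> part \<alpha> i" if "i \<in> {1..length \<alpha>}" for i
  proof -
    have "part \<alpha> i \<in> set \<alpha>"
      unfolding part_def using that by (intro nth_mem) auto
    with assms show ?thesis
      by (cases "part \<alpha> i") auto
  qed
  then have "(i, j) \<in> set (V_boxes \<alpha>) \<longleftrightarrow> (i, j) \<in> cd \<alpha>" for i j
    by (cases "j = 1") (auto simp: V_boxes_def image_iff less_Suc_eq_le simp del: upt_Suc)
  then show ?thesis
    by auto
qed

lemma sorted_reading_boxes: "sorted_wrt reading_before (reading_boxes \<alpha>)"
  unfolding reading_boxes_def
proof (rule sorted_wrt_concat_map)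
  show "sorted_wrt (\<lambda>x y. \<forall>a\<in>set (map (Pair x) (rev [1..<Suc (part \<alpha> x)])).
    \<forall>b\<in>set (map (Pair y) (rev [1..<Suc (part \<alpha> y)])). reading_before a b) [1..<Suc (length \<alpha>)]"
    by (rule sorted_wrt_mono_rel[OF _ sorted_wrt_upt]) (auto simp: reading_before_def)
  show "sorted_wrt reading_before (map (Pair x) (rev [1..<Suc (part \<alpha> x)]))" for x
    unfolding sorted_wrt_map sorted_wrt_rev
    by (rule sorted_wrt_mono_rel[OF _ sorted_wrt_upt]) (auto simp: reading_before_def)
qed

lemma sorted_row_boxes: "sorted_wrt row_before (row_boxes \<alpha>)"
  unfolding row_boxes_def
proof (rule sorted_wrt_concat_map)
  show "sorted_wrt (\<lambda>x y. \<forall>a\<in>set (map (Pair x) [1..<Suc (part \<alpha> x)]).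
    \<forall>b\<in>set (map (Pair y) [1..<Suc (part \<alpha> y)]). row_before a b) [1..<Suc (length \<alpha>)]"
    by (rule sorted_wrt_mono_rel[OF _ sorted_wrt_upt]) (auto simp: row_before_def)
  show "sorted_wrt row_before (map (Pair x) [1..<Suc (part \<alpha> x)])" for x
    unfolding sorted_wrt_map
    by (rule sorted_wrt_mono_rel[OF _ sorted_wrt_upt]) (auto simp: row_before_def)
qed

lemma sorted_column_boxes: "sorted_wrt column_before (column_boxes \<alpha>)"
  unfolding column_boxes_def
proof (rule sorted_wrt_concat_map)
  show "sorted_wrt (\<lambda>x y.
    \<forall>a\<in>set (concat (map (\<lambda>i. if x \<le> part \<alpha> i then [(i, x)] else []) [1..<Suc (length \<alpha>)])).
    \<forall>b\<in>set (concat (map (\<lambda>i. if y \<le> part \<alpha> i then [(i, y)] else []) [1..<Suc (length \<alpha>)])).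
      column_before a b) [1..<Suc (sum_list \<alpha>)]"
    by (rule sorted_wrt_mono_rel[OF _ sorted_wrt_upt])
      (auto simp: column_before_def split: if_splits)
  show "sorted_wrt column_before
    (concat (map (\<lambda>i. if x \<le> part \<alpha> i then [(i, x)] else []) [1..<Suc (length \<alpha>)]))" for x
  proof (rule sorted_wrt_concat_map)
    show "sorted_wrt (\<lambda>i j. \<forall>a\<in>set (if x \<le> part \<alpha> i then [(i, x)] else []).
      \<forall>b\<in>set (if x \<le> part \<alpha> j then [(j, x)] else []). column_before a b) [1..<Suc (length \<alpha>)]"
      by (rule sorted_wrt_mono_rel[OF _ sorted_wrt_upt])
        (auto simp: column_before_def split: if_splits)
  qed auto
qed

lemma sorted_V_boxes: "sorted_wrt V_before (V_boxes \<alpha>)"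
  unfolding V_boxes_def sorted_wrt_append
proof (intro conjI)
  let ?f = "\<lambda>i. map (Pair i) [2..<Suc (part \<alpha> i)]"
  show "sorted_wrt V_before (map (\<lambda>i. (i, 1)) [1..<Suc (length \<alpha>)])"
    unfolding sorted_wrt_map
    by (rule sorted_wrt_mono_rel[OF _ sorted_wrt_upt]) (auto simp: V_before_def)
  show "sorted_wrt V_before (concat (map ?f (rev [1..<Suc (length \<alpha>)])))"
  proof (rule sorted_wrt_concat_map)
    show "sorted_wrt (\<lambda>x y. \<forall>a\<in>set (?f x). \<forall>b\<in>set (?f y). V_before a b) (rev [1..<Suc (length \<alpha>)])"
      unfolding sorted_wrt_rev
      by (rule sorted_wrt_mono_rel[OF _ sorted_wrt_upt]) (auto simp: V_before_def)
    show "sorted_wrt V_before (?f x)" for x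
      unfolding sorted_wrt_map
      by (rule sorted_wrt_mono_rel[OF _ sorted_wrt_upt]) (auto simp: V_before_def)
  qed
qed (auto simp: V_before_def)

lemma card_cd: "card (cd \<alpha>) = sum_list \<alpha>"
proof -
  have "distinct (row_boxes \<alpha>)"
    using sorted_row_boxes by (rule sorted_wrt_asym_distinct) (auto simp: row_before_def)
  then have "card (cd \<alpha>) = length (row_boxes \<alpha>)"
    using distinct_card set_row_boxes by metis
  also have "\<dots> = sum_list (map (part \<alpha>) [1..<Suc (length \<alpha>)])"
    by (simp add: row_boxes_def length_concat comp_def del: upt_Suc)
  also have "map (part \<alpha>) [1..<Suc (length \<alpha>)] = \<alpha>"
    by (rule nth_equalityI) (auto simp: part_def simp del: upt_Suc)
  finally show ?thesis .
qed

lemma finite_cd [simp]: "finite (cd \<alpha>)"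
  using set_row_boxes[of \<alpha>] by (metis List.finite_set)

lemma finite_fillings: "finite (fillings \<alpha>)"
proof (rule finite_subset)
  show "fillings \<alpha> \<subseteq> cd \<alpha> \<rightarrow>\<^sub>E {1..sum_list \<alpha>}"
    by (auto simp: fillings_def bij_betw_def PiE_def)
qed (intro finite_PiE, auto)

lemma fill_along_filling:
  assumes "sorted_wrt R bs" "\<And>a b. a \<in> set bs \<Longrightarrow> b \<in> set bs \<Longrightarrow> R a b \<Longrightarrow> \<not> R b a"
    and "set bs = cd \<alpha>"
  shows "fill_along bs \<in> fillings \<alpha>"
proof -
  have "length bs = sum_list \<alpha>"
    using distinct_card[OF sorted_wrt_asym_distinct[OF assms(1,2)]] card_cd assms(3) by simp
  then show ?thesis
    using bij_betw_fill_along[OF assms(1,2)] assms(3) restrict_extensional[of _ "set bs"]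
    by (simp add: fillings_def fill_along_def)
qed

lemma box_of:
  assumes "T \<in> fillings \<alpha>"
  shows box_of_eq: "a \<in> cd \<alpha> \<Longrightarrow> box_of \<alpha> T (T a) = a"
    and box_of_in: "i \<in> {1..sum_list \<alpha>} \<Longrightarrow> box_of \<alpha> T i \<in> cd \<alpha>"
    and filling_box_of: "i \<in> {1..sum_list \<alpha>} \<Longrightarrow> T (box_of \<alpha> T i) = i"
    and filling_in: "a \<in> cd \<alpha> \<Longrightarrow> T a \<in> {1..sum_list \<alpha>}"
    and filling_inject: "a \<in> cd \<alpha> \<Longrightarrow> b \<in> cd \<alpha> \<Longrightarrow> T a = T b \<longleftrightarrow> a = b"
proof -
  have T: "bij_betw T (cd \<alpha>) {1..sum_list \<alpha>}"
    using assms by (simp add: fillings_def)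
  show "box_of \<alpha> T (T a) = a" if "a \<in> cd \<alpha>"
    unfolding box_of_def by (rule the_inv_into_f_f[OF bij_betw_imp_inj_on[OF T] that])
  show "box_of \<alpha> T i \<in> cd \<alpha>" if "i \<in> {1..sum_list \<alpha>}"
    unfolding box_of_def using bij_betw_the_inv_into[OF T] that by (rule bij_betwE[rule_format])
  show "T (box_of \<alpha> T i) = i" if "i \<in> {1..sum_list \<alpha>}"
    unfolding box_of_def using T that by (rule f_the_inv_into_f_bij_betw)
  show "T a \<in> {1..sum_list \<alpha>}" if "a \<in> cd \<alpha>"
    using T that by (rule bij_betwE[rule_format])
  show "T a = T b \<longleftrightarrow> a = b" if "a \<in> cd \<alpha>" "b \<in> cd \<alpha>"
    using bij_betw_imp_inj_on[OF T] that by (rule inj_on_eq_iff)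
qed

section \<open>Fillings compatible with a relation on boxes\<close>

definition order_fillings :: "nat list \<Rightarrow> box rel \<Rightarrow> filling set" where
  "order_fillings \<alpha> R = {T \<in> fillings \<alpha>. \<forall>a b. (a, b) \<in> R \<longrightarrow> T a < T b}"

lemma order_fillingsD:
  assumes "T \<in> order_fillings \<alpha> R"
  shows "T \<in> fillings \<alpha>" "(a, b) \<in> R \<Longrightarrow> T a < T b"
  using assms unfolding order_fillings_def by blast+

text \<open>\<open>closed\<close> holds automatically: \<sigma> and \<rho> both respect
  \<open>R\<close>, so every pair of \<open>R\<close> lies in the intersection of their orders. What
  remains is to compare the two ends with the other fillings.\<close>

lemma reading_interval_order_fillings:
  assumes R: "R \<subseteq> cd \<alpha> \<times> cd \<alpha>" and bs: "set bs = cd \<alpha>" "sorted_wrt before bs"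
    and asym: "\<And>a b. a \<in> cd \<alpha> \<Longrightarrow> b \<in> cd \<alpha> \<Longrightarrow> before a b \<Longrightarrow> \<not> before b a"
    and in_E: "\<sigma> \<in> order_fillings \<alpha> R" "\<rho> \<in> order_fillings \<alpha> R"
    and lower: "\<And>T a b. T \<in> order_fillings \<alpha> R \<Longrightarrow> a \<in> cd \<alpha> \<Longrightarrow> b \<in> cd \<alpha> \<Longrightarrow> before a b \<Longrightarrow>
      \<sigma> b < \<sigma> a \<Longrightarrow> T b < T a"
    and upper: "\<And>T a b. T \<in> order_fillings \<alpha> R \<Longrightarrow> a \<in> cd \<alpha> \<Longrightarrow> b \<in> cd \<alpha> \<Longrightarrow> before a b \<Longrightarrow>
      T b < T a \<Longrightarrow> \<rho> b < \<rho> a"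
  shows "reading_interval (sum_list \<alpha>) bs before (order_fillings \<alpha> R) \<sigma> \<rho>"
proof
  show "T \<in> order_fillings \<alpha> R"
    if "T \<in> extensional (set bs)" "bij_betw T (set bs) {1..sum_list \<alpha>}"
      "\<And>a b. a \<in> set bs \<Longrightarrow> b \<in> set bs \<Longrightarrow> \<sigma> a < \<sigma> b \<Longrightarrow> \<rho> a < \<rho> b \<Longrightarrow> T a < T b" for T
    using that R order_fillingsD(2)[OF in_E(1)] order_fillingsD(2)[OF in_E(2)] unfolding bs(1)
    unfolding order_fillings_def fillings_def by fast
  show "bij_betw T (set bs) {1..sum_list \<alpha>}" "T \<in> extensional (set bs)"
    if "T \<in> order_fillings \<alpha> R" for T
    using that bs(1) by (simp_all add: order_fillings_def fillings_def)
  show "\<not> before b a" if "a \<in> set bs" "b \<in> set bs" "before a b" for a b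
    using asym that bs(1) by simp
  show "T b < T a"
    if "T \<in> order_fillings \<alpha> R" "a \<in> set bs" "b \<in> set bs" "before a b" "\<sigma> b < \<sigma> a" for T a b
    using lower that bs(1) by simp
  show "\<rho> b < \<rho> a"
    if "T \<in> order_fillings \<alpha> R" "a \<in> set bs" "b \<in> set bs" "before a b" "T b < T a" for T a b
    using upper[OF that(1)] that bs(1) by simp
qed (rule bs in_E)+

text \<open>Covers dual immaculate and extended Schur functions: both have the row filling as minimum.\<close>

lemma row_interval:
  assumes R: "R \<subseteq> cd \<alpha> \<times> cd \<alpha>"
    and row: "\<And>i j k. (i, j) \<in> cd \<alpha> \<Longrightarrow> (i, k) \<in> cd \<alpha> \<Longrightarrow> j < k \<Longrightarrow> ((i, j), (i, k)) \<in> R"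
    and R_row: "\<And>a b. (a, b) \<in> R \<Longrightarrow> row_before a b"
    and \<rho>: "\<rho> \<in> order_fillings \<alpha> R"
    and upper: "\<And>T a b. T \<in> order_fillings \<alpha> R \<Longrightarrow> a \<in> cd \<alpha> \<Longrightarrow> b \<in> cd \<alpha> \<Longrightarrow>
      fst a < fst b \<Longrightarrow> \<rho> a < \<rho> b \<Longrightarrow> T a < T b"
  defines "P \<equiv> word_poset (reading \<alpha> (fill_along (row_boxes \<alpha>))) (reading \<alpha> \<rho>)"
  shows "partial_order_on {1..sum_list \<alpha>} P \<and>
    K (sum_list \<alpha>) P = (\<Sum>T\<in>order_fillings \<alpha> R. fund (comp_of (sum_list \<alpha>) (Des \<alpha> T)))"
proof -
  let ?n = "sum_list \<alpha>" and ?\<sigma> = "fill_along (row_boxes \<alpha>)" and ?E = "order_fillings \<alpha> R"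
  have asym: "row_before a b \<Longrightarrow> \<not> row_before b a" for a b
    by (auto simp: row_before_def)
  have less: "?\<sigma> a < ?\<sigma> b \<longleftrightarrow> row_before a b" if "a \<in> cd \<alpha>" "b \<in> cd \<alpha>" for a b
    using that fill_along_less_iff[OF sorted_row_boxes asym] by (simp add: set_row_boxes)
  have \<sigma>: "?\<sigma> \<in> ?E"
    using fill_along_filling[OF sorted_row_boxes asym set_row_boxes] R R_row less
    by (auto simp: order_fillings_def)
  have rowT: "T b < T a" if "T \<in> ?E" "a \<in> cd \<alpha>" "b \<in> cd \<alpha>" "fst a = fst b" "snd b < snd a" for T a b
    using that row[of "fst b" "snd b" "snd a"] order_fillingsD(2)[OF that(1), of b a] by (cases a; cases b) auto
  interpret reading_interval ?n "reading_boxes \<alpha>" reading_before ?E ?\<sigma> \<rho>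
  proof (rule reading_interval_order_fillings[OF R set_reading_boxes sorted_reading_boxes _ \<sigma> \<rho>])
    show "\<not> reading_before b a" if "reading_before a b" for a b
      using that by (auto simp: reading_before_def)
    \<comment> \<open>The row filling increases with the row, so an inversion of it in reading order
      lies within one row, where every filling of the set has the same order.\<close>
    show "T b < T a"
      if "T \<in> ?E" "a \<in> cd \<alpha>" "b \<in> cd \<alpha>" "reading_before a b" "?\<sigma> b < ?\<sigma> a" for T a b
    proof (rule rowT[OF that(1-3)])
      show "fst a = fst b" "snd b < snd a"
        using that less[of b a] by (auto simp: reading_before_def row_before_def)
    qed
    show "\<rho> b < \<rho> a"
      if T: "T \<in> ?E" "a \<in> cd \<alpha>" "b \<in> cd \<alpha>" "reading_before a b" "T b < T a" for T a b
    proof (cases "fst a < fst b")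
      case True
      have "\<rho> a \<noteq> \<rho> b"
        using filling_inject[OF order_fillingsD(1)[OF \<rho>] T(2,3)] T(5) by auto
      moreover have "\<not> \<rho> a < \<rho> b"
        using upper[OF T(1-3) True] T(5) by auto
      ultimately show ?thesis
        by simp
    next
      case False
      with T(4) show ?thesis
        by (intro rowT[OF \<rho> T(2,3)]) (auto simp: reading_before_def)
    qed
  qed
  have "partial_order_on {1..?n} P"
    unfolding P_def reading_eq by (rule partial_order_word_poset)
  moreover have Des: "{i \<in> {1..<?n}. reading_before (the_inv_into (set (reading_boxes \<alpha>)) T i)
    (the_inv_into (set (reading_boxes \<alpha>)) T (Suc i))} = Des \<alpha> T" if T: "T \<in> ?E" for T
  proof -
    have "reading_before (box_of \<alpha> T i) (box_of \<alpha> T (Suc i)) \<longleftrightarrow>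
      fst (box_of \<alpha> T i) < fst (box_of \<alpha> T (Suc i))" if i: "i \<in> {1..<?n}" for i
    proof -
      have i': "i \<in> {1..?n}" "Suc i \<in> {1..?n}"
        using i by auto
      note f = order_fillingsD(1)[OF T]
      \<comment> \<open>Within a row i + 1 never lies to the left of i, so i is read before i + 1
        only from a strictly higher row.\<close>
      have "\<not> (fst (box_of \<alpha> T i) = fst (box_of \<alpha> T (Suc i)) \<and>
        snd (box_of \<alpha> T (Suc i)) < snd (box_of \<alpha> T i))"
        using rowT[OF T box_of_in[OF f i'(1)] box_of_in[OF f i'(2)]]
          filling_box_of[OF f i'(1)] filling_box_of[OF f i'(2)] by auto
      then show ?thesis
        by (auto simp: reading_before_def)
    qed
    then show ?thesis
      unfolding Des_def set_reading_boxes box_of_def[symmetric] by auto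
  qed
  moreover have "K ?n P = (\<Sum>T\<in>?E. fund (comp_of ?n (Des \<alpha> T)))"
    unfolding P_def reading_eq K_word_poset using Des by (intro sum.cong) auto
  ultimately show ?thesis
    by blast
qed

lemma SIT_eq:
  "SIT \<alpha> = order_fillings \<alpha> ({((i, j), (i, k)) | i j k. (i, j) \<in> cd \<alpha> \<and> (i, k) \<in> cd \<alpha> \<and> j < k} \<union>
    {((i, 1), (j, 1)) | i j. (i, 1) \<in> cd \<alpha> \<and> (j, 1) \<in> cd \<alpha> \<and> i < j})"
  unfolding SIT_def order_fillings_def by blast

lemma SET_eq:
  "SET \<alpha> = order_fillings \<alpha> ({((i, j), (i, k)) | i j k. (i, j) \<in> cd \<alpha> \<and> (i, k) \<in> cd \<alpha> \<and> j < k} \<union>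
    {((i, k), (j, k)) | i j k. (i, k) \<in> cd \<alpha> \<and> (j, k) \<in> cd \<alpha> \<and> i < j})"
  unfolding SET_def order_fillings_def by blast

text \<open>The maximum keeps a higher box before a lower one only if the higher box is in the first
  column; the first column and the row of the lower box then force the same order in every tableau.
  Positive parts give every row a box in the first column.\<close>

theorem dual_immaculate_eq_K:
  assumes "0 \<notin> set \<alpha>"
  shows "partial_order_on {1..sum_list \<alpha>} (V_poset \<alpha>)"
    and "dual_immaculate \<alpha> = K (sum_list \<alpha>) (V_poset \<alpha>)"
proof -
  let ?R = "{((i, j), (i, k)) | i j k. (i, j) \<in> cd \<alpha> \<and> (i, k) \<in> cd \<alpha> \<and> j < k} \<union>
    {((i, 1), (j, 1)) | i j. (i, 1) \<in> cd \<alpha> \<and> (j, 1) \<in> cd \<alpha> \<and> i < j}"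
  let ?\<rho> = "fill_along (V_boxes \<alpha>)"
  have asym: "V_before a b \<Longrightarrow> \<not> V_before b a" for a b
    by (auto simp: V_before_def split: if_splits)
  note set = set_V_boxes[OF assms]
  have less: "?\<rho> a < ?\<rho> b \<longleftrightarrow> V_before a b" if "a \<in> cd \<alpha>" "b \<in> cd \<alpha>" for a b
    using that fill_along_less_iff[OF sorted_V_boxes asym] by (simp add: set)
  have "?\<rho> \<in> fillings \<alpha>"
    by (rule fill_along_filling[OF sorted_V_boxes asym set])
  moreover have "?\<rho> a < ?\<rho> b" if "(a, b) \<in> ?R" for a b
    using that by (subst less) (auto simp: V_before_def)
  ultimately have \<rho>: "?\<rho> \<in> order_fillings \<alpha> ?R"
    unfolding order_fillings_def by blast
  have upper: "T a < T b" if T: "T \<in> order_fillings \<alpha> ?R" "a \<in> cd \<alpha>" "b \<in> cd \<alpha>" "fst a < fst b" "?\<rho> a < ?\<rho> b"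
    for T a b
  proof -
    obtain i j k where ab: "a = (i, 1)" "b = (j, k)" "i < j"
      using T(4,5) less[OF T(2,3)] by (cases a; cases b) (auto simp: V_before_def split: if_splits)
    with T have cd: "(i, 1) \<in> cd \<alpha>" "(j, 1) \<in> cd \<alpha>" "(j, k) \<in> cd \<alpha>"
      by auto
    with ab have "((i, 1), (j, 1)) \<in> ?R"
      by blast
    then have "T (i, 1) < T (j, 1)"
      using order_fillingsD(2)[OF T(1)] by blast
    also have "T (j, 1) \<le> T (j, k)"
    proof (cases "k = 1")
      case False
      with cd have "((j, 1), (j, k)) \<in> ?R"
        by auto
      then show ?thesis
        using order_fillingsD(2)[OF T(1)] less_imp_le by blast
    qed simp
    finally show ?thesis
      using ab by simp
  qed
  have V: "V_poset \<alpha> = word_poset (reading \<alpha> (fill_along (row_boxes \<alpha>))) (reading \<alpha> ?\<rho>)"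
    by (simp add: V_poset_def V_boxes_def)
  have "partial_order_on {1..sum_list \<alpha>} (V_poset \<alpha>) \<and> K (sum_list \<alpha>) (V_poset \<alpha>) =
    (\<Sum>T\<in>order_fillings \<alpha> ?R. fund (comp_of (sum_list \<alpha>) (Des \<alpha> T)))"
    unfolding V
  proof (rule row_interval)
    show "?\<rho> \<in> order_fillings \<alpha> ?R"
      by (rule \<rho>)
    show "T a < T b" if "T \<in> order_fillings \<alpha> ?R" "a \<in> cd \<alpha>" "b \<in> cd \<alpha>" "fst a < fst b" "?\<rho> a < ?\<rho> b"
      for T a b
      by (rule upper[OF that])
  qed (auto simp: row_before_def)
  then show "partial_order_on {1..sum_list \<alpha>} (V_poset \<alpha>)" "dual_immaculate \<alpha> = K (sum_list \<alpha>) (V_poset \<alpha>)"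
    unfolding dual_immaculate_def SIT_eq by simp_all
qed

text \<open>In the column filling a higher box a precedes a lower box b only if b is weakly to the
  right. The box in the row of b and the column of a then exists, and its entry lies weakly between
  those of a and b in every tableau.\<close>

theorem extended_schur_eq_K:
  shows "partial_order_on {1..sum_list \<alpha>} (X_poset \<alpha>)"
    and "extended_schur \<alpha> = K (sum_list \<alpha>) (X_poset \<alpha>)"
proof -
  let ?R = "{((i, j), (i, k)) | i j k. (i, j) \<in> cd \<alpha> \<and> (i, k) \<in> cd \<alpha> \<and> j < k} \<union>
    {((i, k), (j, k)) | i j k. (i, k) \<in> cd \<alpha> \<and> (j, k) \<in> cd \<alpha> \<and> i < j}"
  let ?\<rho> = "fill_along (column_boxes \<alpha>)"
  have asym: "column_before a b \<Longrightarrow> \<not> column_before b a" for a b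
    by (auto simp: column_before_def)
  have less: "?\<rho> a < ?\<rho> b \<longleftrightarrow> column_before a b" if "a \<in> cd \<alpha>" "b \<in> cd \<alpha>" for a b
    using that fill_along_less_iff[OF sorted_column_boxes asym] by (simp add: set_column_boxes)
  have "?\<rho> \<in> fillings \<alpha>"
    by (rule fill_along_filling[OF sorted_column_boxes asym set_column_boxes])
  moreover have "?\<rho> a < ?\<rho> b" if "(a, b) \<in> ?R" for a b
    using that by (subst less) (auto simp: column_before_def)
  ultimately have \<rho>: "?\<rho> \<in> order_fillings \<alpha> ?R"
    unfolding order_fillings_def by blast
  have upper: "T a < T b" if T: "T \<in> order_fillings \<alpha> ?R" "a \<in> cd \<alpha>" "b \<in> cd \<alpha>" "fst a < fst b" "?\<rho> a < ?\<rho> b"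
    for T a b
  proof -
    obtain i j k l where ab: "a = (i, k)" "b = (j, l)" "i < j" "k \<le> l"
      using T(4,5) less[OF T(2,3)] by (cases a; cases b) (auto simp: column_before_def)
    with T have cd: "(i, k) \<in> cd \<alpha>" "(j, k) \<in> cd \<alpha>" "(j, l) \<in> cd \<alpha>"
      by auto
    with ab have "((i, k), (j, k)) \<in> ?R"
      by blast
    then have "T (i, k) < T (j, k)"
      using order_fillingsD(2)[OF T(1)] by blast
    also have "T (j, k) \<le> T (j, l)"
    proof (cases "k = l")
      case False
      with ab cd have "((j, k), (j, l)) \<in> ?R"
        by auto
      then show ?thesis
        using order_fillingsD(2)[OF T(1)] less_imp_le by blast
    qed simp
    finally show ?thesis
      using ab by simp
  qed
  have "partial_order_on {1..sum_list \<alpha>} (X_poset \<alpha>) \<and> K (sum_list \<alpha>) (X_poset \<alpha>) =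
    (\<Sum>T\<in>order_fillings \<alpha> ?R. fund (comp_of (sum_list \<alpha>) (Des \<alpha> T)))"
    unfolding X_poset_def
  proof (rule row_interval)
    show "?\<rho> \<in> order_fillings \<alpha> ?R"
      by (rule \<rho>)
    show "T a < T b" if "T \<in> order_fillings \<alpha> ?R" "a \<in> cd \<alpha>" "b \<in> cd \<alpha>" "fst a < fst b" "?\<rho> a < ?\<rho> b"
      for T a b
      by (rule upper[OF that])
  qed (auto simp: row_before_def)
  then show "partial_order_on {1..sum_list \<alpha>} (X_poset \<alpha>)" "extended_schur \<alpha> = K (sum_list \<alpha>) (X_poset \<alpha>)"
    unfolding extended_schur_def SET_eq by simp_all
qed

section \<open>Linear extensions of posets covered by adjacent chains\<close>

text \<open>The columns are chains and a generating relation changes the column by at most one, so a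
  chain of relations meets every column in between. This is what makes elements in strictly
  intermediate columns comparable to one of the end points.\<close>

locale column_poset =
  fixes B :: "'b set" and n :: nat and col :: "'b \<Rightarrow> int" and R :: "'b rel"
  assumes R_sub: "R \<subseteq> B \<times> B"
    and col_step: "(x, y) \<in> R \<Longrightarrow> \<bar>col x - col y\<bar> \<le> 1"
    and column_chain: "x \<in> B \<Longrightarrow> y \<in> B \<Longrightarrow> col x = col y \<Longrightarrow> x \<noteq> y \<Longrightarrow> (x, y) \<in> R \<or> (y, x) \<in> R"
begin

definition labelings :: "('b \<Rightarrow> nat) set" where
  "labelings = {T \<in> extensional B. bij_betw T B {1..n} \<and> (\<forall>a b. (a, b) \<in> R \<longrightarrow> T a < T b)}"

definition incomparable :: "'b \<Rightarrow> 'b \<Rightarrow> bool" where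
  "incomparable a b \<longleftrightarrow> a \<in> B \<and> b \<in> B \<and> a \<noteq> b \<and> (a, b) \<notin> R\<^sup>+ \<and> (b, a) \<notin> R\<^sup>+"

text \<open>Abstract form of both extreme conditions: with column indices it describes source
  tableaux, with negated column indices sink tableaux.\<close>

definition source :: "('b \<Rightarrow> nat) \<Rightarrow> bool" where
  "source T \<longleftrightarrow> (\<forall>a\<in>B. \<forall>b\<in>B. T b = Suc (T a) \<longrightarrow> col b < col a \<longrightarrow> (a, b) \<in> R)"

definition column_sorted :: "('b \<Rightarrow> nat) \<Rightarrow> bool" where
  "column_sorted T \<longleftrightarrow> (\<forall>a b. incomparable a b \<longrightarrow> col a < col b \<longrightarrow> T a < T b)"

lemma labeling_less: "T \<in> labelings \<Longrightarrow> (a, b) \<in> R \<Longrightarrow> T a < T b"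
  by (simp add: labelings_def)

lemma labeling_trancl_less:
  assumes "T \<in> labelings" "(a, b) \<in> R\<^sup>+"
  shows "T a < T b"
  using assms(2) by (induction rule: trancl_induct) (use labeling_less[OF assms(1)] in \<open>auto intro: less_trans\<close>)

lemma labeling_bij: "T \<in> labelings \<Longrightarrow> bij_betw T B {1..n}"
  by (simp add: labelings_def)

lemma labeling_inject:
  "T \<in> labelings \<Longrightarrow> a \<in> B \<Longrightarrow> b \<in> B \<Longrightarrow> T a = T b \<longleftrightarrow> a = b"
  using bij_betw_imp_inj_on[OF labeling_bij] by (auto dest: inj_onD)

lemma labeling_in: "T \<in> labelings \<Longrightarrow> a \<in> B \<Longrightarrow> T a \<in> {1..n}"
  using labeling_bij bij_betwE by blast

lemma labeling_onto:
  assumes "T \<in> labelings" "i \<in> {1..n}"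
  obtains a where "a \<in> B" "T a = i"
proof -
  have "i \<in> T ` B"
    using bij_betw_imp_surj_on[OF labeling_bij[OF assms(1)]] assms(2) by simp
  with that show ?thesis
    by blast
qed

lemma trancl_meets_column:
  assumes "(x, z) \<in> R\<^sup>+" "col x \<le> c \<and> c \<le> col z \<or> col z \<le> c \<and> c \<le> col x"
  shows "\<exists>w\<in>B. col w = c \<and> (x, w) \<in> R\<^sup>* \<and> (w, z) \<in> R\<^sup>*"
  using assms
proof (induction rule: trancl_induct)
  case (base z)
  then have "c = col x \<or> c = col z"
    using col_step[of x z] by auto
  with base(1) R_sub show ?case
    by blast
next
  case (step y z)
  show ?case
  proof (cases "c = col z")
    case True
    have "z \<in> B" "(x, z) \<in> R\<^sup>*"
      using step.hyps R_sub by auto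
    with True show ?thesis
      by blast
  next
    case False
    then have "col x \<le> c \<and> c \<le> col y \<or> col y \<le> c \<and> c \<le> col x"
      using step.prems col_step[OF step.hyps(2)] by linarith
    with step.IH obtain w where "w \<in> B" "col w = c" "(x, w) \<in> R\<^sup>*" "(w, y) \<in> R\<^sup>*"
      by blast
    with step.hyps(2) show ?thesis
      using rtrancl_into_rtrancl by fast
  qed
qed

text \<open>The chain meets the column of y in some w, and columns are chains, so y equals w or is
  joined to it by a generating relation. The element w is returned because
  \<open>cover_adjacent\<close> uses that nothing lies between two given elements.\<close>

lemma trancl_through_column:
  assumes xz: "(x, z) \<in> R\<^sup>+"
    and y: "y \<in> B" "col x < col y \<and> col y < col z \<or> col z < col y \<and> col y < col x"
  obtains "(x, y) \<in> R\<^sup>+" "(y, z) \<in> R\<^sup>+"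
    | w where "(x, w) \<in> R\<^sup>+" "(w, y) \<in> R" "(w, z) \<in> R\<^sup>+"
    | w where "(x, w) \<in> R\<^sup>+" "(y, w) \<in> R" "(w, z) \<in> R\<^sup>+"
proof -
  have "col x \<le> col y \<and> col y \<le> col z \<or> col z \<le> col y \<and> col y \<le> col x"
    using y(2) by linarith
  from trancl_meets_column[OF xz this]
  obtain w where w: "w \<in> B" "col w = col y" "(x, w) \<in> R\<^sup>*" "(w, z) \<in> R\<^sup>*"
    by blast
  then have "x \<noteq> w" "w \<noteq> z"
    using y(2) by auto
  with w have xwz: "(x, w) \<in> R\<^sup>+" "(w, z) \<in> R\<^sup>+"
    by (auto dest: rtranclD)
  show ?thesis
  proof (cases "w = y")
    case True
    with xwz that(1) show ?thesis
      by blast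
  next
    case False
    with column_chain[OF w(1) y(1) w(2)] xwz that(2,3) show ?thesis
      by blast
  qed
qed

lemma trancl_regular:
  assumes "(x, z) \<in> R\<^sup>+" "y \<in> B" "col x < col y \<and> col y < col z \<or> col z < col y \<and> col y < col x"
  shows "(x, y) \<in> R\<^sup>+ \<or> (y, z) \<in> R\<^sup>+"
  using assms by (rule trancl_through_column) (auto intro: trancl_into_trancl trancl_into_trancl2)

lemma incomparable_sym: "incomparable a b \<Longrightarrow> incomparable b a"
  by (auto simp: incomparable_def)

lemma incomparable_columns: "incomparable a b \<Longrightarrow> col a \<noteq> col b"
  using column_chain unfolding incomparable_def by blast

lemma labeling_cases:
  assumes "T \<in> labelings" "a \<in> B" "b \<in> B" "T a < T b"
  obtains "(a, b) \<in> R\<^sup>+" | "incomparable a b"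
  using assms labeling_trancl_less[OF assms(1), of b a] unfolding incomparable_def by force

text \<open>Induction on the difference of the entries of a pair in the wrong order. The element c
  after the smaller entry splits the pair into two with smaller differences, each related or
  correctly sorted by columns. Two relations would compose, two sorted pairs contradict the columns
  of a and b, and in the mixed cases an end point lies strictly between the columns of a related
  pair, so \<open>trancl_regular\<close> breaks one of the incomparabilities.\<close>

lemma source_column_sorted:
  assumes T: "T \<in> labelings" and src: "source T"
  shows "column_sorted T"
proof -
  have False if "incomparable a b" "col a < col b" "T b < T a" for a b
    using that
  proof (induction "T a - T b" arbitrary: a b rule: less_induct)
    case less
    have ab: "a \<in> B" "b \<in> B" "(a, b) \<notin> R\<^sup>+" "(b, a) \<notin> R\<^sup>+"
      using less.prems(1) by (auto simp: incomparable_def)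
    show False
    proof (cases "T a = Suc (T b)")
      case True
      with src ab less.prems(2) have "(b, a) \<in> R"
        by (auto simp: source_def)
      with ab show False
        by blast
    next
      case False
      have "Suc (T b) \<in> {1..n}"
        using less.prems(3) labeling_in[OF T ab(1)] by auto
      then obtain c where c: "c \<in> B" "T c = Suc (T b)"
        using labeling_onto[OF T] by blast
      have bc: "T b < T c" and ca: "T c < T a"
        using False less.prems(3) c by auto
      then have gap: "T c - T b < T a - T b" "T a - T c < T a - T b"
        by linarith+
      from T ab(2) c(1) bc have "(b, c) \<in> R\<^sup>+ \<or> incomparable b c \<and> col b < col c"
      proof (rule labeling_cases)
        assume bc_inc: "incomparable b c"
        have "\<not> col c < col b"
          using less.hyps[of c b] incomparable_sym[OF bc_inc] bc gap by auto
        with incomparable_columns[OF bc_inc] bc_inc show ?thesis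
          by auto
      qed blast
      moreover from T c(1) ab(1) ca have "(c, a) \<in> R\<^sup>+ \<or> incomparable c a \<and> col c < col a"
      proof (rule labeling_cases)
        assume ca_inc: "incomparable c a"
        have "\<not> col a < col c"
          using less.hyps[of a c] incomparable_sym[OF ca_inc] ca gap by auto
        with incomparable_columns[OF ca_inc] ca_inc show ?thesis
          by auto
      qed blast
      ultimately consider "(b, c) \<in> R\<^sup>+" "(c, a) \<in> R\<^sup>+"
        | "(b, c) \<in> R\<^sup>+" "incomparable c a" "col c < col a"
        | "incomparable b c" "col b < col c" "(c, a) \<in> R\<^sup>+"
        using less.prems(2) by fastforce
      then show False
      proof cases
        case 1
        with ab show False
          by (meson trancl_trans)
      next
        case 2
        with trancl_regular[OF 2(1) ab(1)] less.prems(2) ab show False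
          by (auto simp: incomparable_def)
      next
        case 3
        with trancl_regular[OF 3(3) ab(2)] less.prems(2) ab show False
          by (auto simp: incomparable_def)
      qed
    qed
  qed
  then show ?thesis
    unfolding column_sorted_def
    using labeling_inject[OF T] by (metis incomparable_def linorder_neqE_nat)
qed

text \<open>Relations decide the comparable pairs and columns the incomparable ones, so both
  labelings order all pairs alike; a label is the rank of its element in this order.\<close>

lemma column_sorted_unique:
  assumes S: "S \<in> labelings" "column_sorted S" and T: "T \<in> labelings" "column_sorted T"
  shows "S = T"
proof -
  have imp: "T b \<le> T a" if "S \<in> labelings" "column_sorted S" "T \<in> labelings" "column_sorted T"
    "a \<in> B" "b \<in> B" "S b \<le> S a" for S T a b
  proof (cases "a = b")
    case False
    with that labeling_inject[OF that(1,5,6)] have "S b < S a"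
      by simp
    from that(1,6,5) this show ?thesis
    proof (rule labeling_cases)
      assume "(b, a) \<in> R\<^sup>+"
      then show ?thesis
        using labeling_trancl_less[OF that(3)] by (simp add: less_imp_le)
    next
      assume inc: "incomparable b a"
      have "\<not> col a < col b"
        using that(2) incomparable_sym[OF inc] \<open>S b < S a\<close> unfolding column_sorted_def by fastforce
      with incomparable_columns[OF inc] have "col b < col a"
        by simp
      with that(4) inc show ?thesis
        unfolding column_sorted_def by (simp add: less_imp_le)
    qed
  qed simp
  have rank: "T a = card {b \<in> B. T b \<le> T a}" if T: "T \<in> labelings" and a: "a \<in> B" for T a
  proof -
    have "T ` {b \<in> B. T b \<le> T a} = {1..T a}"
    proof (intro equalityI subsetI)
      fix i
      assume "i \<in> {1..T a}"
      moreover from this have "i \<in> {1..n}"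
        using labeling_in[OF T a] by auto
      then obtain b where "b \<in> B" "T b = i"
        by (rule labeling_onto[OF T])
      ultimately show "i \<in> T ` {b \<in> B. T b \<le> T a}"
        by auto
    qed (use labeling_in[OF T] in auto)
    moreover have "inj_on T {b \<in> B. T b \<le> T a}"
      using bij_betw_imp_inj_on[OF labeling_bij[OF T]] by (rule inj_on_subset) auto
    ultimately show ?thesis
      using card_image by fastforce
  qed
  show ?thesis
  proof (rule extensionalityI[of _ B])
    fix a
    assume a: "a \<in> B"
    have "{b \<in> B. S b \<le> S a} = {b \<in> B. T b \<le> T a}"
      using imp[OF S T a] imp[OF T S a] by blast
    then show "S a = T a"
      using rank[OF S(1) a] rank[OF T(1) a] by simp
  qed (use S T in \<open>auto simp: labelings_def\<close>)
qed

text \<open>Exchanging two consecutive labels changes the comparison of these two elements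
  only.\<close>

lemma swap_labeling:
  assumes T: "T \<in> labelings" and ab: "a \<in> B" "b \<in> B" "T b = Suc (T a)" "(a, b) \<notin> R"
  shows "T(a := T b, b := T a) \<in> labelings"
proof -
  let ?t = "transpose (T a) (Suc (T a))"
  have ne: "a \<noteq> b"
    using ab(3) by auto
  have app: "(T(a := T b, b := T a)) x = ?t (T x)" if "x \<in> B" for x
    using that ab ne labeling_inject[OF T, of x a] labeling_inject[OF T, of x b]
    by (auto simp: transpose_def)
  have "bij_betw ?t {1..n} {1..n}"
    using labeling_in[OF T ab(1)] labeling_in[OF T ab(2)] ab(3)
    by (intro permutes_imp_bij permutes_swap_id) auto
  from bij_betw_trans[OF labeling_bij[OF T] this]
  have "bij_betw (T(a := T b, b := T a)) B {1..n}"
    by (rule bij_betw_cong[THEN iffD1, rotated]) (simp only: app comp_apply)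
  moreover have "T(a := T b, b := T a) \<in> extensional B"
    using T ab by (auto simp: labelings_def extensional_def)
  moreover have "(T(a := T b, b := T a)) x < (T(a := T b, b := T a)) y" if "(x, y) \<in> R" for x y
  proof -
    have xy: "x \<in> B" "y \<in> B"
      using that R_sub by auto
    have less: "T x < T y"
      using labeling_less[OF T that] .
    have "{T x, T y} \<noteq> {T a, Suc (T a)}"
    proof
      assume "{T x, T y} = {T a, Suc (T a)}"
      with less have "T x = T a" "T y = T b"
        using ab(3) by (auto simp: doubleton_eq_iff)
      then have "x = a" "y = b"
        using labeling_inject[OF T xy(1) ab(1)] labeling_inject[OF T xy(2) ab(2)] by blast+
      with that ab(4) show False
        by simp
    qed
    moreover have "T x \<noteq> T y"
      using less by simp
    ultimately show ?thesis
      using less transpose_Suc_less_iff[of "T x" "T y" "T a"] unfolding app[OF xy(1)] app[OF xy(2)] by blast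
  qed
  ultimately show ?thesis
    by (simp add: labelings_def)
qed

text \<open>Maximise the sum of column times label. If consecutive labels violated the source
  condition, exchanging them would keep all relations and raise the sum by the difference of their
  columns.\<close>

lemma source_exists:
  assumes finB: "finite B" and ne: "labelings \<noteq> {}"
  shows "\<exists>T\<in>labelings. source T"
proof -
  let ?w = "\<lambda>T. \<Sum>x\<in>B. col x * int (T x)"
  have "labelings \<subseteq> B \<rightarrow>\<^sub>E {1..n}"
    by (auto simp: labelings_def bij_betw_def PiE_def)
  then have fin: "finite labelings"
    by (rule finite_subset[OF _ finite_PiE]) (use finB in auto)
  define M where "M = Max (?w ` labelings)"
  have "M \<in> ?w ` labelings"
    unfolding M_def using fin ne by (intro Max_in) auto
  then obtain T where T: "T \<in> labelings" "?w T = M"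
    by blast
  have max: "?w S \<le> ?w T" if "S \<in> labelings" for S
    using that fin T(2) unfolding M_def by auto
  have "(a, b) \<in> R" if ab: "a \<in> B" "b \<in> B" "T b = Suc (T a)" "col b < col a" for a b
  proof (rule ccontr)
    assume "(a, b) \<notin> R"
    let ?S = "T(a := T b, b := T a)"
    have "a \<noteq> b"
      using ab by auto
    have "?w ?S - ?w T = (\<Sum>x\<in>B. col x * int (?S x) - col x * int (T x))"
      by (simp add: sum_subtractf)
    also have "\<dots> = (\<Sum>x\<in>B. (if x = a then col a else 0) - (if x = b then col b else 0))"
      using ab(3) \<open>a \<noteq> b\<close> by (intro sum.cong) (auto simp: algebra_simps)
    also have "\<dots> = col a - col b"
      using finB ab(1,2) by (simp add: sum_subtractf)
    finally have "?w T < ?w ?S"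
      using ab(4) by simp
    with max[OF swap_labeling[OF T(1) ab(1-3) \<open>(a, b) \<notin> R\<close>]] show False
      by simp
  qed
  with T(1) show ?thesis
    by (auto simp: source_def)
qed

text \<open>Suppose some c lies between a and b in \<open>S\<close>. In \<open>T\<close> it lies
  below both or above both, as a and b are consecutive there. In the first case c is incomparable to
  a, hence in a larger column by sortedness of \<open>S\<close>, and related to b; the chain from c
  to b crosses the column of a, which would put c below a or some element between a and b. The
  second case is symmetric.\<close>

lemma cover_adjacent:
  assumes S: "S \<in> labelings" "column_sorted S" and T: "T \<in> labelings"
    and ab: "(a, b) \<in> R" "T b = Suc (T a)" "col b < col a"
  shows "S b = Suc (S a)"
proof (rule ccontr)
  assume "S b \<noteq> Suc (S a)"
  have aB: "a \<in> B" and bB: "b \<in> B"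
    using ab(1) R_sub by auto
  have "S a < S b"
    using S(1) ab(1) by (rule labeling_less)
  moreover have "Suc (S a) \<in> {1..n}"
    using \<open>S a < S b\<close> labeling_in[OF S(1) bB] by auto
  ultimately obtain c where c: "c \<in> B" "S a < S c" "S c < S b"
    using labeling_onto[OF S(1)] \<open>S b \<noteq> Suc (S a)\<close> by (metis Suc_lessI lessI)
  have nR: "(c, a) \<notin> R\<^sup>+" "(b, c) \<notin> R\<^sup>+"
    using labeling_trancl_less[OF S(1)] c by (meson less_asym)+
  have not_between: "(a, w) \<notin> R\<^sup>+ \<or> (w, b) \<notin> R\<^sup>+" for w
    using labeling_trancl_less[OF T, of a w] labeling_trancl_less[OF T, of w b] ab(2) by linarith
  have sorted: "col x < col y" if "incomparable x y" "S x < S y" for x y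
    using that S(2) incomparable_sym[OF that(1)] incomparable_columns[OF that(1)]
    unfolding column_sorted_def by (metis linorder_neqE less_asym)
  have "T c \<noteq> T a" "T c \<noteq> T b"
    using labeling_inject[OF T] c aB bB by auto
  then consider "T c < T a" | "T b < T c"
    using ab(2) by linarith
  then show False
  proof cases
    case 1
    then have "(a, c) \<notin> R\<^sup>+"
      using labeling_trancl_less[OF T, of a c] by auto
    with nR c aB have "incomparable a c"
      by (auto simp: incomparable_def)
    then have "col a < col c"
      using c sorted by blast
    have "(c, b) \<in> R\<^sup>+"
      using S(1) c(1) bB c(3)
    proof (rule labeling_cases)
      assume "incomparable c b"
      with sorted[of c b] c \<open>col a < col c\<close> ab(3) show ?thesis
        by simp
    qed
    then show False
    proof (rule trancl_through_column[OF _ aB])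
      show "col c < col a \<and> col a < col b \<or> col b < col a \<and> col a < col c"
        using \<open>col a < col c\<close> ab(3) by simp
    qed (use nR not_between in \<open>auto intro: trancl_into_trancl\<close>)
  next
    case 2
    then have "(c, b) \<notin> R\<^sup>+"
      using labeling_trancl_less[OF T, of c b] by auto
    with nR c bB have "incomparable c b"
      by (auto simp: incomparable_def)
    then have "col c < col b"
      using c sorted by blast
    have "(a, c) \<in> R\<^sup>+"
      using S(1) aB c(1) c(2)
    proof (rule labeling_cases)
      assume "incomparable a c"
      with sorted[of a c] c \<open>col c < col b\<close> ab(3) show ?thesis
        by simp
    qed
    then show False
    proof (rule trancl_through_column[OF _ bB])
      show "col a < col b \<and> col b < col c \<or> col c < col b \<and> col b < col a"
        using \<open>col c < col b\<close> ab(3) by simp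
    qed (use nR not_between in \<open>auto intro: trancl_into_trancl2\<close>)
  qed
qed

lemma consecutive_trancl:
  assumes T: "T \<in> labelings" and ab: "(a, b) \<in> R\<^sup>+" "T b = Suc (T a)"
  shows "(a, b) \<in> R"
  using ab(1)
proof (cases rule: tranclE)
  case (step c)
  then have "T a < T c" "T c < T b"
    using labeling_trancl_less[OF T] labeling_less[OF T] by auto
  with ab(2) show ?thesis
    by simp
qed

end

section \<open>Classes of standard reverse composition tableaux\<close>

lemma SRCTD:
  assumes "T \<in> SRCT \<alpha>"
  shows SRCT_filling: "T \<in> fillings \<alpha>"
    and SRCT_row: "(i, j) \<in> cd \<alpha> \<Longrightarrow> (i, k) \<in> cd \<alpha> \<Longrightarrow> j < k \<Longrightarrow> T (i, k) < T (i, j)"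
    and SRCT_first_column: "(i, 1) \<in> cd \<alpha> \<Longrightarrow> (j, 1) \<in> cd \<alpha> \<Longrightarrow> i < j \<Longrightarrow> T (i, 1) < T (j, 1)"
    and SRCT_triple: "(i, k) \<in> cd \<alpha> \<Longrightarrow> (j, Suc k) \<in> cd \<alpha> \<Longrightarrow> i < j \<Longrightarrow> T (j, Suc k) < T (i, k) \<Longrightarrow>
      (i, Suc k) \<in> cd \<alpha> \<and> T (j, Suc k) < T (i, Suc k)"
  using assms unfolding SRCT_def by blast+

text \<open>Pairs (a, b) for which a must carry the smaller entry. The third clause is the triple
  condition in contrapositive form: if the box to the right of a is missing, or is smaller than b in
  the fixed column order, the conclusion of the condition fails, so a must be smaller than
  b.\<close>

definition srct_relation :: "nat list \<Rightarrow> filling \<Rightarrow> box rel" where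
  "srct_relation \<alpha> \<tau> = {(a, b). a \<in> cd \<alpha> \<and> b \<in> cd \<alpha> \<and>
    (snd a = snd b \<and> \<tau> a < \<tau> b \<or>
     fst a = fst b \<and> snd a = Suc (snd b) \<or>
     snd b = Suc (snd a) \<and> fst a < fst b \<and>
       ((fst a, snd b) \<in> cd \<alpha> \<longrightarrow> \<tau> (fst a, snd b) < \<tau> b))}"

locale srct_class =
  fixes \<alpha> :: "nat list" and \<tau>0 :: filling
  assumes \<tau>0: "\<tau>0 \<in> SRCT \<alpha>"
begin

abbreviation "n \<equiv> sum_list \<alpha>"
abbreviation "R \<equiv> srct_relation \<alpha> \<tau>0"
abbreviation "E \<equiv> column_equiv \<alpha> `` {\<tau>0}"

lemma R_cases:
  assumes "(a, b) \<in> R"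
  obtains (column) i j k where "a = (i, k)" "b = (j, k)" "\<tau>0 (i, k) < \<tau>0 (j, k)"
    | (row) i k where "a = (i, Suc k)" "b = (i, k)"
    | (triple) i j k where "a = (i, k)" "b = (j, Suc k)" "i < j"
        "(i, Suc k) \<in> cd \<alpha> \<longrightarrow> \<tau>0 (i, Suc k) < \<tau>0 (j, Suc k)"
  using assms by (cases a; cases b) (auto simp: srct_relation_def simp del: mem_cd)

lemma R_in: "(a, b) \<in> R \<Longrightarrow> a \<in> cd \<alpha> \<and> b \<in> cd \<alpha>"
  by (simp add: srct_relation_def)

lemma R_column: "(i, k) \<in> cd \<alpha> \<Longrightarrow> (j, k) \<in> cd \<alpha> \<Longrightarrow> \<tau>0 (i, k) < \<tau>0 (j, k) \<Longrightarrow> ((i, k), (j, k)) \<in> R"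
  by (simp add: srct_relation_def)

lemma R_row: "(i, k) \<in> cd \<alpha> \<Longrightarrow> (i, Suc k) \<in> cd \<alpha> \<Longrightarrow> ((i, Suc k), (i, k)) \<in> R"
  by (simp add: srct_relation_def)

lemma R_triple:
  "(i, k) \<in> cd \<alpha> \<Longrightarrow> (j, Suc k) \<in> cd \<alpha> \<Longrightarrow> i < j \<Longrightarrow>
    ((i, Suc k) \<in> cd \<alpha> \<Longrightarrow> \<tau>0 (i, Suc k) < \<tau>0 (j, Suc k)) \<Longrightarrow> ((i, k), (j, Suc k)) \<in> R"
  unfolding srct_relation_def by (auto simp del: mem_cd)

text \<open>The two signs yield the locale once for source tableaux and once for sink
  tableaux.\<close>

lemma column_poset_sign:
  assumes "s = 1 \<or> s = - 1"
  shows "column_poset (cd \<alpha>) (\<lambda>b. s * int (snd b)) R"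
proof
  show "R \<subseteq> cd \<alpha> \<times> cd \<alpha>"
    using R_in by auto
  show "\<bar>s * int (snd x) - s * int (snd y)\<bar> \<le> 1" if "(x, y) \<in> R" for x y
    using that by (rule R_cases) (use assms in auto)
  show "(x, y) \<in> R \<or> (y, x) \<in> R"
    if "x \<in> cd \<alpha>" "y \<in> cd \<alpha>" "s * int (snd x) = s * int (snd y)" "x \<noteq> y" for x y
  proof -
    have "snd x = snd y"
      using that(3) assms by auto
    moreover have "\<tau>0 x \<noteq> \<tau>0 y"
      using filling_inject[OF SRCT_filling[OF \<tau>0] that(1,2)] that(4) by simp
    ultimately show ?thesis
      using that R_column[of "fst x" "snd x" "fst y"] R_column[of "fst y" "snd x" "fst x"]
      by (metis linorder_neqE_nat prod.collapse)
  qed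
qed

sublocale column_poset "cd \<alpha>" n "\<lambda>b. int (snd b)" R
  using column_poset_sign[of 1] by simp

sublocale rev: column_poset "cd \<alpha>" n "\<lambda>b. - int (snd b)" R
  using column_poset_sign[of "- 1"] by simp

lemma labelings_filling: "T \<in> labelings \<Longrightarrow> T \<in> fillings \<alpha>"
  by (simp add: labelings_def fillings_def)

lemma class_subset: "E \<subseteq> labelings"
proof
  fix T
  assume "T \<in> E"
  then have T: "T \<in> SRCT \<alpha>"
    and col: "\<And>i j k. (i, k) \<in> cd \<alpha> \<Longrightarrow> (j, k) \<in> cd \<alpha> \<Longrightarrow> \<tau>0 (i, k) < \<tau>0 (j, k) \<longleftrightarrow> T (i, k) < T (j, k)"
    unfolding column_equiv_def by blast+
  have "T a < T b" if ab: "(a, b) \<in> R" for a b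
    using ab
  proof (cases rule: R_cases)
    case (column i j k)
    then show ?thesis
      using col R_in[OF ab] by blast
  next
    case (row i k)
    then show ?thesis
      using SRCT_row[OF T, of i k "Suc k"] R_in[OF ab] by blast
  next
    case (triple i j k)
    show ?thesis
    proof (rule ccontr)
      assume "\<not> T a < T b"
      moreover have "T a \<noteq> T b"
        using filling_inject[OF SRCT_filling[OF T]] R_in[OF ab] triple by auto
      ultimately have "T (j, Suc k) < T (i, k)"
        using triple by simp
      then have "(i, Suc k) \<in> cd \<alpha> \<and> T (j, Suc k) < T (i, Suc k)"
        using SRCT_triple[OF T, of i k j] R_in[OF ab] triple by blast
      moreover from this have "T (i, Suc k) < T (j, Suc k)"
        using col[of i "Suc k" j] triple R_in[OF ab] by blast
      ultimately show False
        by simp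
    qed
  qed
  then show "T \<in> labelings"
    using SRCT_filling[OF T] by (simp add: labelings_def fillings_def)
qed

lemma trancl_row:
  assumes cd: "(i, j) \<in> cd \<alpha>" "(i, k) \<in> cd \<alpha>" and jk: "j < k"
  shows "((i, k), (i, j)) \<in> R\<^sup>+"
proof -
  have "(i, j) \<in> cd \<alpha> \<longrightarrow> (i, k) \<in> cd \<alpha> \<longrightarrow> ((i, k), (i, j)) \<in> R\<^sup>+"
    using jk
  proof (induction rule: less_Suc_induct)
    case (1 j)
    then show ?case
      using R_row[of i j] by blast
  next
    case (2 j l k)
    have "(i, l) \<in> cd \<alpha>" if "(i, j) \<in> cd \<alpha>" "(i, k) \<in> cd \<alpha>"
      using that 2(1,2) by auto
    with 2(3,4) show ?case
      by (meson trancl_trans)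
  qed
  with cd show ?thesis
    by blast
qed

text \<open>The relation contains the column orders of \<open>\<tau>0\<close>, so a labeling has the
  same column patterns and inherits the increasing first column. A pair ordered against a triple
  relation is not in \<open>R\<close>, so the exception in its clause holds, and this is the
  conclusion of the triple condition.\<close>

lemma labelings_subset: "labelings \<subseteq> E"
proof
  fix T
  assume T: "T \<in> labelings"
  note inj = filling_inject[OF SRCT_filling[OF \<tau>0]]
  have col: "\<tau>0 (i, k) < \<tau>0 (j, k) \<longleftrightarrow> T (i, k) < T (j, k)"
    if "(i, k) \<in> cd \<alpha>" "(j, k) \<in> cd \<alpha>" for i j k
    using labeling_less[OF T R_column[OF that]] labeling_less[OF T R_column[OF that(2,1)]]
      inj[OF that] by (cases "\<tau>0 (i, k)" "\<tau>0 (j, k)" rule: linorder_cases) auto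
  have row: "T (i, k) < T (i, j)" if "(i, j) \<in> cd \<alpha>" "(i, k) \<in> cd \<alpha>" "j < k" for i j k
    using labeling_trancl_less[OF T trancl_row[OF that]] .
  have first: "T (i, 1) < T (j, 1)" if "(i, 1) \<in> cd \<alpha>" "(j, 1) \<in> cd \<alpha>" "i < j" for i j
    using SRCT_first_column[OF \<tau>0 that] col[OF that(1,2)] by simp
  have triple: "(i, Suc k) \<in> cd \<alpha> \<and> T (j, Suc k) < T (i, Suc k)"
    if cd: "(i, k) \<in> cd \<alpha>" "(j, Suc k) \<in> cd \<alpha>" and ij: "i < j" and gt: "T (j, Suc k) < T (i, k)" for i j k
  proof -
    have "((i, k), (j, Suc k)) \<notin> R"
      using labeling_less[OF T, of "(i, k)" "(j, Suc k)"] gt by auto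
    then have *: "(i, Suc k) \<in> cd \<alpha>" "\<not> \<tau>0 (i, Suc k) < \<tau>0 (j, Suc k)"
      using R_triple[OF cd ij] by blast+
    then have "\<tau>0 (j, Suc k) < \<tau>0 (i, Suc k)"
      using inj[OF *(1) cd(2)] ij by auto
    with col[OF cd(2) *(1)] *(1) show ?thesis
      by blast
  qed
  have "T \<in> SRCT \<alpha>"
    unfolding SRCT_def using labelings_filling[OF T] row first triple by blast
  with \<tau>0 col show "T \<in> E"
    unfolding column_equiv_def by blast
qed

lemma class_eq: "E = labelings"
  using class_subset labelings_subset by (rule subset_antisym)

lemma Des_SRCT_box:
  assumes T: "T \<in> labelings" and ab: "a \<in> cd \<alpha>" "b \<in> cd \<alpha>" "T b = Suc (T a)"
  shows "T a \<in> Des_SRCT \<alpha> T \<longleftrightarrow> snd a \<le> snd b"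
proof -
  note f = labelings_filling[OF T]
  have "T a \<in> {1..<n}"
    using filling_in[OF f ab(1)] filling_in[OF f ab(2)] ab(3) by auto
  then show ?thesis
    using box_of_eq[OF f ab(1)] box_of_eq[OF f ab(2)] ab(3) by (simp add: Des_SRCT_def)
qed

lemma consecutive_boxes:
  assumes T: "T \<in> labelings" and i: "i \<in> {1..<n}"
  shows "box_of \<alpha> T i \<in> cd \<alpha>" "box_of \<alpha> T (Suc i) \<in> cd \<alpha>"
    "T (box_of \<alpha> T i) = i" "T (box_of \<alpha> T (Suc i)) = Suc i"
  using box_of_in[OF labelings_filling[OF T], of i] box_of_in[OF labelings_filling[OF T], of "Suc i"]
    filling_box_of[OF labelings_filling[OF T], of i] filling_box_of[OF labelings_filling[OF T], of "Suc i"] i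
  by auto

text \<open>Among the generating relations only those within a row lead to a smaller column, and
  they lead exactly one box to the left.\<close>

lemma is_source_iff:
  assumes T: "T \<in> labelings"
  shows "is_source \<alpha> T \<longleftrightarrow> source T"
proof
  assume src: "is_source \<alpha> T"
  have "(a, b) \<in> R" if ab: "a \<in> cd \<alpha>" "b \<in> cd \<alpha>" "T b = Suc (T a)" "int (snd b) < int (snd a)" for a b
  proof -
    note f = labelings_filling[OF T]
    have "T a \<in> {1..<n} - Des_SRCT \<alpha> T"
      using filling_in[OF f ab(1)] filling_in[OF f ab(2)] ab(3,4) Des_SRCT_box[OF T ab(1-3)] by auto
    with src have "fst (box_of \<alpha> T (Suc (T a))) = fst (box_of \<alpha> T (T a))"
      "Suc (snd (box_of \<alpha> T (Suc (T a)))) = snd (box_of \<alpha> T (T a))"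
      unfolding is_source_def by blast+
    then have "fst b = fst a" "Suc (snd b) = snd a"
      using box_of_eq[OF f ab(1)] box_of_eq[OF f ab(2)] ab(3) by simp_all
    then show ?thesis
      using R_row[of "fst a" "snd b"] ab(1,2) by (metis prod.collapse)
  qed
  then show "source T"
    unfolding source_def by blast
next
  assume src: "source T"
  show "is_source \<alpha> T"
    unfolding is_source_def
  proof
    fix i
    assume i: "i \<in> {1..<n} - Des_SRCT \<alpha> T"
    then have i': "i \<in> {1..<n}"
      by blast
    note c = consecutive_boxes[OF T i']
    have lt: "snd (box_of \<alpha> T (Suc i)) < snd (box_of \<alpha> T i)"
      using i by (auto simp: Des_SRCT_def)
    then have "(box_of \<alpha> T i, box_of \<alpha> T (Suc i)) \<in> R"
      using src c by (simp add: source_def)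
    then show "fst (box_of \<alpha> T (Suc i)) = fst (box_of \<alpha> T i) \<and>
      Suc (snd (box_of \<alpha> T (Suc i))) = snd (box_of \<alpha> T i)"
      using lt by (cases rule: R_cases) auto
  qed
qed

text \<open>The generating relations that lead to a larger column are the triple ones. Conversely, a
  consecutive entry lying lower-right in the adjacent column satisfies the clause of such a
  relation.\<close>

lemma is_sink_iff:
  assumes T: "T \<in> labelings"
  shows "is_sink \<alpha> T \<longleftrightarrow> rev.source T"
proof
  assume snk: "is_sink \<alpha> T"
  have "(a, b) \<in> R" if ab: "a \<in> cd \<alpha>" "b \<in> cd \<alpha>" "T b = Suc (T a)" "- int (snd b) < - int (snd a)" for a b
  proof -
    note f = labelings_filling[OF T]
    have "T a \<in> Des_SRCT \<alpha> T"
      using ab Des_SRCT_box[OF T ab(1-3)] by simp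
    with snk have "snd (box_of \<alpha> T (Suc (T a))) = snd (box_of \<alpha> T (T a)) \<or>
      snd (box_of \<alpha> T (Suc (T a))) = Suc (snd (box_of \<alpha> T (T a))) \<and>
      fst (box_of \<alpha> T (T a)) < fst (box_of \<alpha> T (Suc (T a)))"
      unfolding is_sink_def by blast
    then have *: "snd b = Suc (snd a)" "fst a < fst b"
      using box_of_eq[OF f ab(1)] box_of_eq[OF f ab(2)] ab(3,4) by auto
    obtain i k where a: "a = (i, k)"
      by (cases a)
    with * obtain j where b: "b = (j, Suc k)" "i < j"
      by (cases b) auto
    have "((i, k), (j, Suc k)) \<in> R"
    proof (rule R_triple)
      show "(i, k) \<in> cd \<alpha>" "(j, Suc k) \<in> cd \<alpha>"
        using ab a b by blast+
      \<comment> \<open>Otherwise column and row give T (j, k + 1) < T (i, k + 1) < T (i, k),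
        although T (j, k + 1) is the successor of T (i, k).\<close>
      show "\<tau>0 (i, Suc k) < \<tau>0 (j, Suc k)" if cd: "(i, Suc k) \<in> cd \<alpha>"
      proof (rule ccontr)
        assume "\<not> ?thesis"
        moreover have "\<tau>0 (i, Suc k) \<noteq> \<tau>0 (j, Suc k)"
          using filling_inject[OF SRCT_filling[OF \<tau>0] cd, of b] ab(2) b by auto
        ultimately have "T (j, Suc k) < T (i, Suc k)"
          using labeling_less[OF T R_column[OF _ cd, of j]] ab(2) b by (metis linorder_neqE_nat)
        moreover have "T (i, Suc k) < T (i, k)"
          using labeling_less[OF T R_row[OF _ cd]] ab(1) a by blast
        ultimately show False
          using ab(3) a b by simp
      qed
    qed (rule b(2))
    with a b show ?thesis
      by simp
  qed
  then show "rev.source T"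
    unfolding rev.source_def by blast
next
  assume snk: "rev.source T"
  show "is_sink \<alpha> T"
    unfolding is_sink_def
  proof
    fix i
    assume i: "i \<in> Des_SRCT \<alpha> T"
    then have i': "i \<in> {1..<n}" and le: "snd (box_of \<alpha> T i) \<le> snd (box_of \<alpha> T (Suc i))"
      by (auto simp: Des_SRCT_def)
    note c = consecutive_boxes[OF T i']
    show "snd (box_of \<alpha> T (Suc i)) = snd (box_of \<alpha> T i) \<or>
      snd (box_of \<alpha> T (Suc i)) = Suc (snd (box_of \<alpha> T i)) \<and>
      fst (box_of \<alpha> T i) < fst (box_of \<alpha> T (Suc i))"
    proof (cases "snd (box_of \<alpha> T (Suc i)) = snd (box_of \<alpha> T i)")
      case False
      with le snk c have "(box_of \<alpha> T i, box_of \<alpha> T (Suc i)) \<in> R"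
        by (simp add: rev.source_def)
      then show ?thesis
        using False le by (cases rule: R_cases) auto
    qed simp
  qed
qed

lemma labelings_nonempty: "labelings \<noteq> {}"
proof -
  have "(\<tau>0, \<tau>0) \<in> column_equiv \<alpha>"
    using \<tau>0 by (simp add: column_equiv_def)
  then show ?thesis
    unfolding class_eq[symmetric] by blast
qed

abbreviation "src \<equiv> source_tableau \<alpha> E"
abbreviation "snk \<equiv> sink_tableau \<alpha> E"

lemma src: "src \<in> labelings" "is_source \<alpha> src"
proof -
  have "\<exists>!\<tau>. \<tau> \<in> E \<and> is_source \<alpha> \<tau>"
    unfolding class_eq
    using source_exists[OF finite_cd labelings_nonempty] is_source_iff source_column_sorted
      column_sorted_unique by metis
  from theI'[OF this] show "src \<in> labelings" "is_source \<alpha> src"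
    unfolding source_tableau_def class_eq by blast+
qed

lemma snk: "snk \<in> labelings" "is_sink \<alpha> snk"
proof -
  have "\<exists>!\<tau>. \<tau> \<in> E \<and> is_sink \<alpha> \<tau>"
    unfolding class_eq
    using rev.source_exists[OF finite_cd labelings_nonempty] is_sink_iff rev.source_column_sorted
      rev.column_sorted_unique by metis
  from theI'[OF this] show "snk \<in> labelings" "is_sink \<alpha> snk"
    unfolding sink_tableau_def class_eq by blast+
qed

lemma src_column_sorted: "column_sorted src"
  using source_column_sorted src is_source_iff by blast

lemma src_less: "incomparable a b \<Longrightarrow> snd a < snd b \<Longrightarrow> src a < src b"
  using src_column_sorted[unfolded column_sorted_def, rule_format, of a b] by simp

lemma src_less_iff:
  assumes "incomparable a b"
  shows "src a < src b \<longleftrightarrow> snd a < snd b"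
  using src_less[OF assms] src_less[OF incomparable_sym[OF assms]] incomparable_columns[OF assms]
  by (cases "snd a" "snd b" rule: linorder_cases) auto

lemma snk_less:
  assumes "incomparable a b" "snd a < snd b"
  shows "snk b < snk a"
proof -
  have "rev.column_sorted snk"
    using rev.source_column_sorted snk is_sink_iff by blast
  then show ?thesis
    using incomparable_sym[OF assms(1)] assms(2) unfolding rev.column_sorted_def by fastforce
qed

section \<open>Strips of the source tableau and their reading order\<close>

definition separated :: "box \<Rightarrow> box \<Rightarrow> bool" where
  "separated a b \<longleftrightarrow> (\<exists>d\<in>Des_SRCT \<alpha> src. src a \<le> d \<and> d < src b)"

text \<open>The reading order without lists: earlier strips first, and columns from left to right
  within a strip. \<open>separated\<close> says that a strip of the source ends between the two
  entries.\<close>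

definition strip_before :: "box \<Rightarrow> box \<Rightarrow> bool" where
  "strip_before a b \<longleftrightarrow> separated a b \<or> \<not> separated a b \<and> \<not> separated b a \<and> snd a < snd b"

lemma separated_less: "separated a b \<Longrightarrow> src a < src b"
  by (auto simp: separated_def)

lemma strip_before_asym: "strip_before a b \<Longrightarrow> \<not> strip_before b a"
  using separated_less[of a b] separated_less[of b a] by (auto simp: strip_before_def)

text \<open>No descent of the source occurs from the entry of a up to that of b, so every step in
  between moves exactly one box to the left in the same row.\<close>

lemma not_separated:
  assumes cd: "a \<in> cd \<alpha>" "b \<in> cd \<alpha>" and less: "src a < src b" and nsep: "\<not> separated a b"
  shows "fst b = fst a" "snd b < snd a"
proof -
  note f = labelings_filling[OF src(1)]
  have "i \<le> src b \<longrightarrow> fst (box_of \<alpha> src i) = fst a \<and> snd (box_of \<alpha> src i) + (i - src a) = snd a"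
    if "src a \<le> i" for i
    using that
  proof (induction i rule: dec_induct)
    case base
    then show ?case
      using box_of_eq[OF f cd(1)] by simp
  next
    case (step i)
    show ?case
    proof
      assume "Suc i \<le> src b"
      then have "i \<in> {1..<n} - Des_SRCT \<alpha> src"
        using step.hyps nsep filling_in[OF f cd(1)] filling_in[OF f cd(2)] by (auto simp: separated_def)
      then have "fst (box_of \<alpha> src (Suc i)) = fst (box_of \<alpha> src i)"
        "Suc (snd (box_of \<alpha> src (Suc i))) = snd (box_of \<alpha> src i)"
        using src(2) unfolding is_source_def by blast+
      with step.IH step.hyps \<open>Suc i \<le> src b\<close>
      show "fst (box_of \<alpha> src (Suc i)) = fst a \<and>
        snd (box_of \<alpha> src (Suc i)) + (Suc i - src a) = snd a"
        by auto
    qed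
  qed
  from this[of "src b"] less box_of_eq[OF f cd(2)] show "fst b = fst a" "snd b < snd a"
    by auto
qed

definition strip_boxes :: "box list" where
  "strip_boxes = concat (map (\<lambda>H. filter (\<lambda>b. b \<in> H) (column_boxes \<alpha>)) (strips \<alpha> src))"

lemma strip_reading_eq: "strip_reading \<alpha> E T = map T strip_boxes"
  by (simp add: strip_reading_def strip_boxes_def map_concat comp_def)

definition cuts :: "nat list" where
  "cuts = sorted_list_of_set (Des_SRCT \<alpha> src)"

lemma cuts: "set cuts = Des_SRCT \<alpha> src" "sorted_wrt (<) cuts"
proof -
  have "finite (Des_SRCT \<alpha> src)"
    by (simp add: Des_SRCT_def)
  then show "set cuts = Des_SRCT \<alpha> src" "sorted_wrt (<) cuts"
    by (simp_all add: cuts_def)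
qed

lemma cuts_mono: "k \<le> l \<Longrightarrow> l < length cuts \<Longrightarrow> cuts ! k \<le> cuts ! l"
  using cuts(2) by (simp add: strict_sorted_iff sorted_nth_mono)

text \<open>Counted from 0: with m the length of \<open>cuts\<close>, d_0 = 0 and d_{m+1} = n,
  \<open>strip i\<close> holds the entries of the source above d_i and up to d_{i+1}.\<close>

definition strip :: "nat \<Rightarrow> box set" where
  "strip i = {b \<in> cd \<alpha>. (0 # cuts) ! i < src b \<and> src b \<le> (cuts @ [n]) ! i}"

lemma strips_eq: "strips \<alpha> src = map strip [0..<Suc (length cuts)]"
  by (rule nth_equalityI)
    (simp_all add: strips_def strip_def cuts_def[symmetric] Let_def del: upt_Suc)

lemma strip_separated:
  assumes "i < j" "j \<le> length cuts" "a \<in> strip i" "b \<in> strip j"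
  shows "separated a b"
proof -
  have "(cuts @ [n]) ! i = cuts ! i" "(0 # cuts) ! j = cuts ! (j - 1)"
    using assms(1,2) by (simp_all add: nth_append nth_Cons')
  moreover have "cuts ! i \<le> cuts ! (j - 1)"
    using assms(1,2) by (intro cuts_mono) linarith+
  moreover have "cuts ! i \<in> Des_SRCT \<alpha> src"
    using assms(1,2) cuts(1) nth_mem[of i cuts] by simp
  ultimately show ?thesis
    using assms(3,4) unfolding separated_def strip_def by (intro bexI[of _ "cuts ! i"]) auto
qed

lemma strip_not_separated:
  assumes "i \<le> length cuts" "a \<in> strip i" "b \<in> strip i"
  shows "\<not> separated a b"
proof
  assume "separated a b"
  then obtain k where k: "k < length cuts" "src a \<le> cuts ! k" "cuts ! k < src b"
    unfolding separated_def cuts(1)[symmetric] by (auto simp: in_set_conv_nth)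
  show False
  proof (cases "k < i")
    case True
    then have "cuts ! k \<le> cuts ! (i - 1)"
      using assms(1) by (intro cuts_mono) linarith+
    with True k assms(2) show False
      by (auto simp: strip_def nth_Cons')
  next
    case False
    then have "cuts ! i \<le> cuts ! k"
      using k(1) by (intro cuts_mono) linarith+
    with False k assms(3) show False
      by (auto simp: strip_def nth_append)
  qed
qed

lemma strip_exists:
  assumes "b \<in> cd \<alpha>"
  obtains i where "i \<le> length cuts" "b \<in> strip i"
proof -
  note src_b = filling_in[OF labelings_filling[OF src(1)] assms]
  \<comment> \<open>The first right bound that reaches the entry; the bound before it is smaller
    than the entry and is the left bound of the strip.\<close>
  define i where "i = (LEAST i. src b \<le> (cuts @ [n]) ! i)"
  have last: "src b \<le> (cuts @ [n]) ! length cuts"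
    using src_b by simp
  have le: "src b \<le> (cuts @ [n]) ! i"
    unfolding i_def using last by (rule LeastI)
  have i: "i \<le> length cuts"
    unfolding i_def using last by (rule Least_le)
  have "(0 # cuts) ! i < src b"
  proof (cases i)
    case 0
    then show ?thesis
      using src_b by simp
  next
    case (Suc k)
    then have "\<not> src b \<le> (cuts @ [n]) ! k"
      using not_less_Least[of k "\<lambda>i. src b \<le> (cuts @ [n]) ! i"] by (simp add: i_def)
    with Suc i show ?thesis
      by (simp add: nth_append)
  qed
  with le i assms that show ?thesis
    by (simp add: strip_def)
qed

lemma set_strip_boxes: "set strip_boxes = cd \<alpha>"
proof -
  have "set strip_boxes = (\<Union>i\<in>{0..<Suc (length cuts)}. {b \<in> cd \<alpha>. b \<in> strip i})"
    unfolding strip_boxes_def strips_eq by (simp add: set_column_boxes del: upt_Suc mem_cd)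
  moreover have "\<exists>i\<in>{0..<Suc (length cuts)}. b \<in> strip i" if b: "b \<in> cd \<alpha>" for b
  proof -
    obtain i where "i \<le> length cuts" "b \<in> strip i"
      using b by (rule strip_exists)
    then show ?thesis
      by (intro bexI[of _ i]) auto
  qed
  ultimately show ?thesis
    by blast
qed

lemma sorted_strip_boxes: "sorted_wrt strip_before strip_boxes"
  unfolding strip_boxes_def strips_eq map_map
proof (rule sorted_wrt_concat_map)
  let ?f = "(\<lambda>H. filter (\<lambda>b. b \<in> H) (column_boxes \<alpha>)) \<circ> strip"
  have "sorted_wrt (\<lambda>i j. i < j) [0..<Suc (length cuts)]"
    by (rule sorted_wrt_upt)
  then show "sorted_wrt (\<lambda>i j. \<forall>a\<in>set (?f i). \<forall>b\<in>set (?f j). strip_before a b) [0..<Suc (length cuts)]"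
    by (rule sorted_wrt_mono_rel[rotated]) (auto simp: strip_before_def less_Suc_eq_le intro!: strip_separated)
  fix i
  assume "i \<in> set [0..<Suc (length cuts)]"
  then have i: "i \<le> length cuts"
    by auto
  have "sorted_wrt column_before (filter (\<lambda>b. b \<in> strip i) (column_boxes \<alpha>))"
    using sorted_column_boxes by (rule sorted_wrt_filter)
  then have "sorted_wrt strip_before (filter (\<lambda>b. b \<in> strip i) (column_boxes \<alpha>))"
  proof (rule sorted_wrt_mono_rel[rotated])
    fix a b
    assume "a \<in> set (filter (\<lambda>b. b \<in> strip i) (column_boxes \<alpha>))"
      "b \<in> set (filter (\<lambda>b. b \<in> strip i) (column_boxes \<alpha>))" and before: "column_before a b"
    then have ab: "a \<in> strip i" "b \<in> strip i" "a \<in> cd \<alpha>" "b \<in> cd \<alpha>"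
      by (auto simp: strip_def)
    note nsep = strip_not_separated[OF i ab(1,2)] strip_not_separated[OF i ab(2,1)]
    have "src a \<noteq> src b"
      using labeling_inject[OF src(1) ab(3,4)] before by (auto simp: column_before_def)
    \<comment> \<open>A strip lies in a single row, so the column order of the filtered list is the
      order from left to right.\<close>
    then have "fst a = fst b"
      using not_separated(1)[OF ab(3,4) _ nsep(1)] not_separated(1)[OF ab(4,3) _ nsep(2)]
      by (cases "src a" "src b" rule: linorder_cases) auto
    with before nsep show "strip_before a b"
      by (auto simp: column_before_def strip_before_def)
  qed
  then show "sorted_wrt strip_before (?f i)"
    by simp
qed

text \<open>The source orders incomparable boxes by columns, so a strip boundary between them also
  points from left to right.\<close>

lemma strip_before_incomparable:
  assumes "incomparable a b"
  shows "strip_before a b \<longleftrightarrow> snd a < snd b"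
proof -
  have "separated a b \<Longrightarrow> snd a < snd b"
    using separated_less src_less_iff[OF assms] by blast
  moreover have "separated b a \<Longrightarrow> snd b < snd a"
    using separated_less src_less_iff[OF incomparable_sym[OF assms]] by blast
  ultimately show ?thesis
    by (auto simp: strip_before_def)
qed

sublocale reading_interval n strip_boxes strip_before E src snk
proof
  show "sorted_wrt strip_before strip_boxes"
    by (rule sorted_strip_boxes)
  show "\<not> strip_before b a" if "strip_before a b" for a b
    using that by (rule strip_before_asym)
  show "bij_betw T (set strip_boxes) {1..n}" "T \<in> extensional (set strip_boxes)" if "T \<in> E" for T
    using that unfolding class_eq set_strip_boxes by (simp_all add: labelings_def)
  show "src \<in> E" "snk \<in> E"
    using src(1) snk(1) by (simp_all only: class_eq)
  show "T \<in> E"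
    if "T \<in> extensional (set strip_boxes)" "bij_betw T (set strip_boxes) {1..n}"
      "\<And>a b. a \<in> set strip_boxes \<Longrightarrow> b \<in> set strip_boxes \<Longrightarrow> src a < src b \<Longrightarrow> snk a < snk b \<Longrightarrow> T a < T b"
    for T
  proof -
    have "T a < T b" if "(a, b) \<in> R" for a b
      using \<open>\<And>a b. _ \<Longrightarrow> _ \<Longrightarrow> _ \<Longrightarrow> _ \<Longrightarrow> T a < T b\<close>[of a b] R_in[OF that]
        labeling_less[OF src(1) that] labeling_less[OF snk(1) that] by (simp only: set_strip_boxes)
    with that(1,2) show ?thesis
      unfolding class_eq labelings_def set_strip_boxes by blast
  qed
  \<comment> \<open>A reading inversion of the source cannot cross strips, so the two boxes share a
    row, where the relations force the same inversion in every tableau.\<close>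
  show "T b < T a"
    if T: "T \<in> E" and cd: "a \<in> set strip_boxes" "b \<in> set strip_boxes"
      and before: "strip_before a b" and less: "src b < src a" for T a b
  proof -
    have ab: "a \<in> cd \<alpha>" "b \<in> cd \<alpha>"
      using cd by (simp_all only: set_strip_boxes)
    have "\<not> separated b a"
      using before less separated_less[of a b] by (auto simp: strip_before_def)
    from not_separated[OF ab(2,1) less this] have "fst a = fst b" "snd a < snd b"
      by simp_all
    moreover from before have False if "snd a < snd b" "separated a b"
      using separated_less[OF that(2)] less by simp
    ultimately have "(b, a) \<in> R\<^sup>+"
      using trancl_row[of "fst a" "snd a" "snd b"] ab unfolding class_eq by (metis prod.collapse)
    then show ?thesis
      using labeling_trancl_less T unfolding class_eq by blast
  qed
  \<comment> \<open>An inversion in some tableau is forced by the relations, or its boxes are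
    incomparable, hence read by columns and inverted by the sink.\<close>
  show "snk b < snk a"
    if T: "T \<in> E" and cd: "a \<in> set strip_boxes" "b \<in> set strip_boxes"
      and before: "strip_before a b" and less: "T b < T a" for T a b
  proof -
    have ab: "a \<in> cd \<alpha>" "b \<in> cd \<alpha>"
      using cd by (simp_all only: set_strip_boxes)
    from T have T': "T \<in> labelings"
      by (simp only: class_eq)
    from T' ab(2,1) less show ?thesis
    proof (rule labeling_cases)
      assume "(b, a) \<in> R\<^sup>+"
      then show ?thesis
        by (rule labeling_trancl_less[OF snk(1)])
    next
      assume "incomparable b a"
      then have inc: "incomparable a b"
        by (rule incomparable_sym)
      with before show ?thesis
        using strip_before_incomparable snk_less by blast
    qed
  qed
qed

text \<open>This transfers the descent rule to every tableau of the class. For incomparable boxes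
  reading order is column order. Otherwise the boxes are joined by one generating relation: a step
  weakly to the right crosses a strip boundary of the source, while a step to the left is
  consecutive in the source too, is no descent there, and stays inside one strip.\<close>

lemma strip_before_consecutive:
  assumes T: "T \<in> labelings" and ab: "a \<in> cd \<alpha>" "b \<in> cd \<alpha>" "T b = Suc (T a)"
  shows "strip_before a b \<longleftrightarrow> snd a \<le> snd b"
proof -
  have "T a < T b"
    using ab by simp
  with T ab(1,2) show ?thesis
  proof (rule labeling_cases)
    assume "incomparable a b"
    with incomparable_columns[of a b] show ?thesis
      by (auto simp: strip_before_incomparable)
  next
    assume "(a, b) \<in> R\<^sup>+"
    then have R: "(a, b) \<in> R"
      using consecutive_trancl[OF T _ ab(3)] by blast
    have less: "src a < src b"
      using labeling_less[OF src(1) R] .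
    show ?thesis
    proof (cases "snd a \<le> snd b")
      case True
      with not_separated(2)[OF ab(1,2) less] have "separated a b"
        by fastforce
      with True show ?thesis
        by (simp add: strip_before_def)
    next
      case False
      then have Suc: "src b = Suc (src a)"
        using cover_adjacent[OF src(1) src_column_sorted T R ab(3)] by simp
      with Des_SRCT_box[OF src(1) ab(1,2)] False have "src a \<notin> Des_SRCT \<alpha> src"
        by simp
      then have "\<not> separated a b"
        using Suc by (auto simp: separated_def less_Suc_eq_le dest: le_antisym)
      with False show ?thesis
        by (simp add: strip_before_def)
    qed
  qed
qed

lemma S_poset_eq: "S_poset \<alpha> E = word_poset (map src strip_boxes) (map snk strip_boxes)"
  by (simp add: S_poset_def strip_reading_eq)

lemma partial_order_S_poset: "partial_order_on {1..n} (S_poset \<alpha> E)"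
  unfolding S_poset_eq by (rule partial_order_word_poset)

lemma K_S_poset: "K n (S_poset \<alpha> E) = (\<Sum>T\<in>E. fund (comp_of n (Des_SRCT \<alpha> T)))"
  unfolding S_poset_eq K_word_poset
proof (rule sum.cong[OF refl])
  fix T
  assume "T \<in> E"
  then have T: "T \<in> labelings"
    by (simp only: class_eq)
  have "strip_before (box_of \<alpha> T i) (box_of \<alpha> T (Suc i)) \<longleftrightarrow>
    snd (box_of \<alpha> T i) \<le> snd (box_of \<alpha> T (Suc i))" if "i \<in> {1..<n}" for i
    using consecutive_boxes[OF T that] by (intro strip_before_consecutive[OF T]) simp_all
  then have "{i \<in> {1..<n}. strip_before (box_of \<alpha> T i) (box_of \<alpha> T (Suc i))} = Des_SRCT \<alpha> T"
    unfolding Des_SRCT_def by auto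
  then show "fund (comp_of n {i \<in> {1..<n}. strip_before (the_inv_into (set strip_boxes) T i)
      (the_inv_into (set strip_boxes) T (Suc i))}) = fund (comp_of n (Des_SRCT \<alpha> T))"
    unfolding set_strip_boxes box_of_def by simp
qed

end

section \<open>Summation over the classes of tableaux\<close>

lemma equiv_column_equiv: "equiv (SRCT \<alpha>) (column_equiv \<alpha>)"
proof (rule equivI)
  show "column_equiv \<alpha> \<subseteq> SRCT \<alpha> \<times> SRCT \<alpha>"
    by (auto simp: column_equiv_def)
  show "refl_on (SRCT \<alpha>) (column_equiv \<alpha>)"
    by (auto simp: refl_on_def column_equiv_def)
  show "sym (column_equiv \<alpha>)"
    unfolding sym_def column_equiv_def by blast
  show "trans (column_equiv \<alpha>)"
    unfolding trans_def column_equiv_def by blast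
qed

lemma finite_SRCT: "finite (SRCT \<alpha>)"
  by (rule finite_subset[OF _ finite_fillings]) (auto simp: SRCT_def)

lemma finite_SRCT_classes: "finite (SRCT_classes \<alpha>)"
  unfolding SRCT_classes_def
  using finite_SRCT equiv_column_equiv by (intro finite_quotient) (auto simp: column_equiv_def)

text \<open>The classes partition the tableaux, and each class contributes the generating function
  of its own poset.\<close>

theorem quasi_schur_eq_sum_K:
  shows "\<forall>C\<in>SRCT_classes \<alpha>. partial_order_on {1..sum_list \<alpha>} (S_poset \<alpha> C)"
    and "quasi_schur \<alpha> = (\<Sum>C\<in>SRCT_classes \<alpha>. K (sum_list \<alpha>) (S_poset \<alpha> C))"
proof -
  have single: "partial_order_on {1..sum_list \<alpha>} (S_poset \<alpha> C) \<and>
    K (sum_list \<alpha>) (S_poset \<alpha> C) = (\<Sum>T\<in>C. fund (comp_of (sum_list \<alpha>) (Des_SRCT \<alpha> T)))"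
    if C: "C \<in> SRCT_classes \<alpha>" for C
  proof -
    obtain \<tau> where \<tau>: "\<tau> \<in> SRCT \<alpha>" "C = column_equiv \<alpha> `` {\<tau>}"
      using C by (auto simp: SRCT_classes_def elim: quotientE)
    interpret srct_class \<alpha> \<tau>
      by unfold_locales (rule \<tau>(1))
    show ?thesis
      using partial_order_S_poset K_S_poset \<tau>(2) by simp
  qed
  then show "\<forall>C\<in>SRCT_classes \<alpha>. partial_order_on {1..sum_list \<alpha>} (S_poset \<alpha> C)"
    by blast
  let ?F = "\<lambda>T. fund (comp_of (sum_list \<alpha>) (Des_SRCT \<alpha> T))"
  have Union: "\<Union> (SRCT_classes \<alpha>) = SRCT \<alpha>"
    unfolding SRCT_classes_def by (rule Union_quotient[OF equiv_column_equiv])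
  have "quasi_schur \<alpha> = sum ?F (\<Union> (SRCT_classes \<alpha>))"
    by (simp add: quasi_schur_def Union)
  also have "\<dots> = (\<Sum>C\<in>SRCT_classes \<alpha>. sum ?F C)"
  proof (subst sum.Union_disjoint)
    show "\<forall>C\<in>SRCT_classes \<alpha>. finite C"
      using finite_SRCT Union by (metis Sup_upper rev_finite_subset)
    show "\<forall>A\<in>SRCT_classes \<alpha>. \<forall>B\<in>SRCT_classes \<alpha>. A \<noteq> B \<longrightarrow> A \<inter> B = {}"
      using quotient_disj[OF equiv_column_equiv] unfolding SRCT_classes_def by blast
  qed simp
  also have "\<dots> = (\<Sum>C\<in>SRCT_classes \<alpha>. K (sum_list \<alpha>) (S_poset \<alpha> C))"
    using single by (intro sum.cong) auto
  finally show "quasi_schur \<alpha> = (\<Sum>C\<in>SRCT_classes \<alpha>. K (sum_list \<alpha>) (S_poset \<alpha> C))" .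
qed

section \<open>The eight families\<close>

theorem mainTheorem6:
  fixes n :: nat and \<alpha> :: "nat list" and Y :: family
  assumes "composition \<alpha> n"
  shows "(\<forall>V\<in>ind Y \<alpha>. partial_order_on {1..n} (ind_poset Y \<alpha> V)) \<and>
    qfun Y \<alpha> = (\<Sum>V\<in>ind Y \<alpha>. K n (ind_poset Y \<alpha> V))"
proof -
  have n: "sum_list \<alpha> = n" and pos: "0 \<notin> set \<alpha>"
    using assms by (auto simp: composition_def)
  have Class: "(\<Sum>V\<in>Class ` \<C>. f V) = (\<Sum>C\<in>\<C>. f (Class C))" for \<C> and f :: "_ \<Rightarrow> series"
    by (simp add: sum.reindex inj_on_def)
  \<comment> \<open>The families with a single poset are the case of a one-element index
    set.\<close>
  have psi: "qsym_psi (K n P) = K n (poset_bar n P)" if "partial_order_on {1..n} P" for P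
    using qsym_psi_sum_K[of "{()}" n "\<lambda>_. P"] that by simp
  note S = quasi_schur_eq_sum_K[of \<alpha>, unfolded n]
  note S' = quasi_schur_eq_sum_K[of "rev \<alpha>", unfolded sum_list_rev n]
  note D = dual_immaculate_eq_K[OF pos, unfolded n]
  note X = extended_schur_eq_K[of \<alpha>, unfolded n]
  have bar: "\<forall>C\<in>SRCT_classes \<beta>. partial_order_on {1..n} (poset_bar n (S_poset \<beta> C))"
    if "\<forall>C\<in>SRCT_classes \<beta>. partial_order_on {1..n} (S_poset \<beta> C)" for \<beta>
    using that partial_order_bar by blast
  show ?thesis
  proof (cases Y)
    case QS
    then show ?thesis
      using S by (simp add: Class)
  next
    case YQS
    then show ?thesis
      using qsym_rho_sum_K[OF finite_SRCT_classes S'(1)] bar[OF S'(1)]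
      by (simp add: Class S'(2) n partial_order_star)
  next
    case RQS
    then show ?thesis
      using qsym_psi_sum_K[OF finite_SRCT_classes S(1)] bar[OF S(1)] by (simp add: Class S(2) n)
  next
    case YRQS
    \<comment> \<open>\<psi> contributes a bar and \<rho> the star of a bar; the two bars
      cancel.\<close>
    have "qsym_rho (qsym_psi (quasi_schur (rev \<alpha>))) =
      (\<Sum>C\<in>SRCT_classes (rev \<alpha>). K n (poset_star (poset_bar n (poset_bar n (S_poset (rev \<alpha>) C)))))"
      unfolding S'(2) qsym_psi_sum_K[OF finite_SRCT_classes S'(1)]
        qsym_rho_sum_K[OF finite_SRCT_classes bar[OF S'(1)]] ..
    also have "\<dots> = (\<Sum>C\<in>SRCT_classes (rev \<alpha>). K n (poset_star (S_poset (rev \<alpha>) C)))"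
      using S'(1) by (intro sum.cong) (auto simp: poset_bar_bar)
    finally show ?thesis
      using YRQS S'(1) by (simp add: Class partial_order_star)
  next
    case DI
    then show ?thesis
      using D by simp
  next
    case RDI
    then show ?thesis
      using D partial_order_bar[OF D(1)] by (simp add: psi n)
  next
    case ES
    then show ?thesis
      using X by simp
  next
    case RES
    then show ?thesis
      using X partial_order_bar[OF X(1)] by (simp add: psi n)
  qed
qed

end
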